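(* Let $a\in\mathcal F$ be such that the measure $\mu_a$ is finite, and assume $\lambda_1(-L_a)>0$. Then for every $b\in\mathcal F$, $$\sigma(-L_a)\setminus\{0\} = \sigma(-L_{ab}+M_a^b),\qquad \sigma_{ess}(-L_a) = \sigma_{ess}(-L_{ab}+M_a^b),$$ and for every integer $n\ge 1$, $\lambda_n(-L_a) = \lambda_{n-1}(-L_{ab}+M_a^b)$.
   Context: Let $V\in C^\infty(\mathbb R)$. Let $\mathcal F$ be the set of nowhere-vanishing functions in $C^\infty(\mathbb R)$. For $a\in\mathcal F$ set $V_a=V+\log(a^2)$, let $\mu_a$ be the (possibly infinite) measure on $\mathbb R$ with Lebesgue density $e^{-V_a}$, and $L_af = f''-V_a'f'$. For $a,b\in\mathcal F$, $M_a^b = V_a'' - b\,L_a(1/b)$ (a smooth function), and $L_{ab}$ is defined as $L_a$ with $ab$ in place of $a$. The operator $-L_a$ is regarded as a self-adjoint operator in $L^2(\mu_a)$ and the Schrödinger operator $f\mapsto -L_{ab}f+M_a^b f$ as a self-adjoint operator in $L^2(\mu_{ab})$; in each case this is the unique self-adjoint extension of the operator defined on $C_0^\infty(\mathbb R)$ (both are essentially self-adjoint and nonnegative there). For a nonnegative self-adjoint operator $T$ in $L^2(\nu)$ with domain $D(T)$: $\sigma(T)$ is its spectrum, $\sigma_{disc}(T)$ the set of isolated eigenvalues of finite multiplicity, $\sigma_{ess}(T)=\sigma(T)\setminus\sigma_{disc}(T)$; $\lambda_0(T)=\inf_{f\in D(T),f\neq0}\frac{\int fTf\,d\nu}{\int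 f^2d\nu}$ and for $n\ge1$ $$\lambda_n(T)=\sup_{g_0,\dots,g_{n-1}\in L^2(\nu)}\ \inf_{\substack{f\in D(T),\,f\ne 0\\ f\perp_\nu g_i,\ i=0,\dots,n-1}}\frac{\int fTf\,d\nu}{\int f^2d\nu}$$ (max-min values; $\lambda_n(T)$ is either the $(n+1)$-th eigenvalue, with discrete spectrum below it, or the bottom of $\sigma_{ess}(T)$). When $\mu_a$ is finite, $\lambda_0(-L_a)=0$ and $\lambda_1(-L_a)$ is the spectral gap. *)

theory Defs
  imports "HOL-Analysis.Analysis"
begin

definition smooth :: "(real \<Rightarrow> real) \<Rightarrow> bool" where
  "smooth f \<longleftrightarrow> (\<forall>k x. ((deriv ^^ k) f) differentiable (at x))"

definition Fcls :: "(real \<Rightarrow> real) set" where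
  "Fcls = {a. smooth a \<and> (\<forall>x. a x \<noteq> 0)}"

definition test_fun :: "(real \<Rightarrow> real) \<Rightarrow> bool" where
  "test_fun f \<longleftrightarrow> smooth f \<and> compact (closure {x. f x \<noteq> 0})"

definition Vw :: "(real \<Rightarrow> real) \<Rightarrow> (real \<Rightarrow> real) \<Rightarrow> real \<Rightarrow> real" where
  "Vw V a = (\<lambda>x. V x + ln ((a x)\<^sup>2))"

definition mu :: "(real \<Rightarrow> real) \<Rightarrow> (real \<Rightarrow> real) \<Rightarrow> real measure" where
  "mu V a = density lborel (\<lambda>x. ennreal (exp (- Vw V a x)))"

definition Lop :: "(real \<Rightarrow> real) \<Rightarrow> (real \<Rightarrow> real) \<Rightarrow> (real \<Rightarrow> real) \<Rightarrow> real \<Rightarrow> real" where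
  "Lop V a f = (\<lambda>x. deriv (deriv f) x - deriv (Vw V a) x * deriv f x)"

definition Mab :: "(real \<Rightarrow> real) \<Rightarrow> (real \<Rightarrow> real) \<Rightarrow> (real \<Rightarrow> real) \<Rightarrow> real \<Rightarrow> real" where
  "Mab V a b = (\<lambda>x. deriv (deriv (Vw V a)) x - b x * Lop V a (\<lambda>y. 1 / b y) x)"

definition negL :: "(real \<Rightarrow> real) \<Rightarrow> (real \<Rightarrow> real) \<Rightarrow> (real \<Rightarrow> real) \<Rightarrow> real \<Rightarrow> real" where
  "negL V a f = (\<lambda>x. - Lop V a f x)"

definition schr :: "(real \<Rightarrow> real) \<Rightarrow> (real \<Rightarrow> real) \<Rightarrow> (real \<Rightarrow> real) \<Rightarrow> (real \<Rightarrow> real) \<Rightarrow> real \<Rightarrow> real" where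
  "schr V a b f = (\<lambda>x. - Lop V (\<lambda>y. a y * b y) f x + Mab V a b x * f x)"

definition L2 :: "real measure \<Rightarrow> (real \<Rightarrow> real) set" where
  "L2 \<nu> = {f. f \<in> borel_measurable \<nu> \<and> integrable \<nu> (\<lambda>x. (f x)\<^sup>2)}"

definition ip :: "real measure \<Rightarrow> (real \<Rightarrow> real) \<Rightarrow> (real \<Rightarrow> real) \<Rightarrow> real" where
  "ip \<nu> f g = (\<integral>x. f x * g x \<partial>\<nu>)"

definition L2norm :: "real measure \<Rightarrow> (real \<Rightarrow> real) \<Rightarrow> real" where
  "L2norm \<nu> f = sqrt (\<integral>x. (f x)\<^sup>2 \<partial>\<nu>)"

text \<open>Graph of the closure in L^2(nu) of the operator T defined on C_0^infinity.
  Since T is essentially self-adjoint, this is (the graph of) its unique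
  self-adjoint extension.  Graphs are sets of pairs of representatives; all
  notions below are invariant under a.e. modification.\<close>
definition closure_graph ::
  "real measure \<Rightarrow> ((real \<Rightarrow> real) \<Rightarrow> (real \<Rightarrow> real)) \<Rightarrow> ((real \<Rightarrow> real) \<times> (real \<Rightarrow> real)) set" where
  "closure_graph \<nu> T = {(f, g). f \<in> L2 \<nu> \<and> g \<in> L2 \<nu> \<and>
     (\<exists>\<phi>::nat \<Rightarrow> real \<Rightarrow> real. (\<forall>k. test_fun (\<phi> k)) \<and>
        (\<lambda>k. L2norm \<nu> (\<lambda>x. \<phi> k x - f x)) \<longlonglongrightarrow> 0 \<and>
        (\<lambda>k. L2norm \<nu> (\<lambda>x. T (\<phi> k) x - g x)) \<longlonglongrightarrow> 0)}"

text \<open>Resolvent set and spectrum (real points; the operators are self-adjoint,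
  so their spectrum is real).\<close>
definition in_resolvent :: "real measure \<Rightarrow> ((real \<Rightarrow> real) \<times> (real \<Rightarrow> real)) set \<Rightarrow> real \<Rightarrow> bool" where
  "in_resolvent \<nu> G l \<longleftrightarrow>
     (\<exists>C. \<forall>(f, g)\<in>G. L2norm \<nu> f \<le> C * L2norm \<nu> (\<lambda>x. g x - l * f x)) \<and>
     (\<forall>h\<in>L2 \<nu>. \<exists>(f, g)\<in>G. AE x in \<nu>. g x - l * f x = h x)"

definition spec :: "real measure \<Rightarrow> ((real \<Rightarrow> real) \<times> (real \<Rightarrow> real)) set \<Rightarrow> real set" where
  "spec \<nu> G = {l. \<not> in_resolvent \<nu> G l}"

definition eigenspace :: "real measure \<Rightarrow> ((real \<Rightarrow> real) \<times> (real \<Rightarrow> real)) set \<Rightarrow> real \<Rightarrow> (real \<Rightarrow> real) set" where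
  "eigenspace \<nu> G l = {f. \<exists>g. (f, g) \<in> G \<and> (AE x in \<nu>. g x = l * f x)}"

definition is_eigenvalue :: "real measure \<Rightarrow> ((real \<Rightarrow> real) \<times> (real \<Rightarrow> real)) set \<Rightarrow> real \<Rightarrow> bool" where
  "is_eigenvalue \<nu> G l \<longleftrightarrow> (\<exists>f\<in>eigenspace \<nu> G l. \<not> (AE x in \<nu>. f x = 0))"

definition finite_mult :: "real measure \<Rightarrow> ((real \<Rightarrow> real) \<times> (real \<Rightarrow> real)) set \<Rightarrow> real \<Rightarrow> bool" where
  "finite_mult \<nu> G l \<longleftrightarrow> (\<exists>B. finite B \<and> B \<subseteq> L2 \<nu> \<and>
     (\<forall>f\<in>eigenspace \<nu> G l. \<exists>c. AE x in \<nu>. f x = (\<Sum>h\<in>B. c h * h x)))"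

definition spec_disc :: "real measure \<Rightarrow> ((real \<Rightarrow> real) \<times> (real \<Rightarrow> real)) set \<Rightarrow> real set" where
  "spec_disc \<nu> G = {l \<in> spec \<nu> G. \<not> (l islimpt spec \<nu> G) \<and>
                          is_eigenvalue \<nu> G l \<and> finite_mult \<nu> G l}"

definition spec_ess :: "real measure \<Rightarrow> ((real \<Rightarrow> real) \<times> (real \<Rightarrow> real)) set \<Rightarrow> real set" where
  "spec_ess \<nu> G = spec \<nu> G - spec_disc \<nu> G"

text \<open>Max-min values lambda_n (n = 0 gives the bottom of the spectrum).\<close>
definition maxmin :: "real measure \<Rightarrow> ((real \<Rightarrow> real) \<times> (real \<Rightarrow> real)) set \<Rightarrow> nat \<Rightarrow> ereal" where
  "maxmin \<nu> G n =
     (SUP gs \<in> {gs :: nat \<Rightarrow> real \<Rightarrow> real. \<forall>i<n. gs i \<in> L2 \<nu>}.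
        (INF fg \<in> {(f, g). (f, g) \<in> G \<and> \<not> (AE x in \<nu>. f x = 0) \<and> (\<forall>i<n. ip \<nu> f (gs i) = 0)}.
           ereal (ip \<nu> (fst fg) (snd fg) / ip \<nu> (fst fg) (fst fg))))"

end

theory Submission
  imports Defs
begin

text \<open>
  Write \<open>D\<close> for the derivative and \<open>D\<^sup>*u = V\<^sub>a' u - u'\<close> for its formal adjoint in
  \<open>L\<^sup>2(\<mu>\<^sub>a)\<close>. Then \<open>- L\<^sub>a = D\<^sup>* D\<close>, and conjugation by \<open>b\<close> turns \<open>- L\<^sub>a\<^sub>b + M\<^sub>a\<^sup>b\<close> into \<open>D D\<^sup>*\<close>.
  The spectral gap amounts to a Poincare inequality, under which explicit integral operators \<open>R\<close> and \<open>S\<close>,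
  inverse to \<open>D\<close> (with values of mean zero) and to \<open>D\<^sup>*\<close>, are bounded and adjoint to each other.
  The closure of \<open>D\<^sup>* D\<close> has graph \<open>{(m + R S h, h) | h has mean zero}\<close> and that of \<open>D D\<^sup>*\<close> has graph
  \<open>{(S R k, k)}\<close>; this uses that the primitive of \<open>1 / w\<close>, where \<open>w\<close> is the density of \<open>\<mu>\<^sub>a\<close>,
  is not square integrable at either end, so that boundary terms of test functions can be removed at arbitrarily small cost.
  The two operators are therefore the inverses of \<open>R S\<close> and \<open>S R\<close>, up to constants in the kernel of the first.
  Their resolvents are related by \<open>(1 - l S R)\<^sup>-\<^sup>1 = 1 + l S (1 - l R S)\<^sup>-\<^sup>1 R\<close>, which compares the spectra, and the
  Cauchy-Schwarz inequality shows that \<open>u \<mapsto> R u\<close> and \<open>f \<mapsto> S f\<close> do not increase Rayleigh quotients, which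
  compares the max-min values in both directions.
\<close>

section \<open>Square integrable functions\<close>

text \<open>The obstacle is compact support. For a test function u, \<open>adj u\<close> has mean
  zero, and the derivative of a test function has Lebesgue integral zero; conversely, a test
  function meeting that one scalar condition lies in the range of \<open>adj\<close>, respectively
  \<open>deriv\<close>. Approximating a graph pair thus costs one scalar correction per factor.
  Where only a derivative must be small, a cut-off does it. Where \<open>adj\<close> of the
  correction must be small a cut-off is useless, since \<open>adj\<close> contains the uncontrolled
  factor \<open>deriv v\<close>. Instead, if y' = 1 / w then the Lebesgue integral of u is the inner
  product of y and \<open>adj u\<close>, which could be bounded in terms of \<open>adj u\<close>
  only if y were square integrable. The inequality 2 - 1 / t \<le> t with t = y^2 w excludes this at
  each end, because 1 / (y^2 w) is the derivative of - 1 / y. A second obstacle is that the gap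
  arrives as a max-min value: it gives an inequality on the complement of an unknown function g0,
  which has to be traded for the constants.\<close>

lemma L2_measurable: "f \<in> L2 M \<Longrightarrow> f \<in> borel_measurable M"
  by (simp add: L2_def)

lemma L2_square_integrable: "f \<in> L2 M \<Longrightarrow> integrable M (\<lambda>x. (f x)\<^sup>2)"
  by (simp add: L2_def)

lemma L2_mult_integrable:
  assumes "f \<in> L2 M" "g \<in> L2 M"
  shows "integrable M (\<lambda>x. f x * g x)"
proof (rule Bochner_Integration.integrable_bound)
  show "integrable M (\<lambda>x. (f x)\<^sup>2 + (g x)\<^sup>2)"
    using assms by (intro Bochner_Integration.integrable_add L2_square_integrable)
  show "(\<lambda>x. f x * g x) \<in> borel_measurable M"
    using assms by (intro borel_measurable_times L2_measurable)
  have "\<bar>s * t\<bar> \<le> s\<^sup>2 + t\<^sup>2" for s t :: real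
  proof -
    have "2 * \<bar>s * t\<bar> \<le> s\<^sup>2 + t\<^sup>2"
      using sum_squares_bound[of "\<bar>s\<bar>" "\<bar>t\<bar>"] by (simp add: abs_mult)
    then show ?thesis by linarith
  qed
  then show "AE x in M. norm (f x * g x) \<le> norm ((f x)\<^sup>2 + (g x)\<^sup>2)"
    by (auto intro!: AE_I2)
qed

lemma L2_add: 
  assumes "f \<in> L2 M" "g \<in> L2 M"
  shows "(\<lambda>x. f x + g x) \<in> L2 M"
proof -
  have "integrable M (\<lambda>x. (f x)\<^sup>2 + (g x)\<^sup>2 + 2 * (f x * g x))"
    using assms by (intro Bochner_Integration.integrable_add L2_square_integrable
        integrable_mult_right L2_mult_integrable)
  then show ?thesis
    using assms by (auto simp: L2_def power2_sum algebra_simps)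
qed

lemma L2_scale: "f \<in> L2 M \<Longrightarrow> (\<lambda>x. c * f x) \<in> L2 M"
  by (auto simp: L2_def power_mult_distrib)

lemma L2_uminus: "f \<in> L2 M \<Longrightarrow> (\<lambda>x. - f x) \<in> L2 M"
  by (auto simp: L2_def)

lemma L2_diff: "f \<in> L2 M \<Longrightarrow> g \<in> L2 M \<Longrightarrow> (\<lambda>x. f x - g x) \<in> L2 M"
  using L2_add[of f M "\<lambda>x. - g x"] L2_uminus[of g M] by simp

lemma L2_zero: "(\<lambda>x. 0) \<in> L2 M"
  by (simp add: L2_def)

lemma L2_sum: "(\<And>i. i \<in> I \<Longrightarrow> f i \<in> L2 M) \<Longrightarrow> (\<lambda>x. \<Sum>i\<in>I. f i x) \<in> L2 M"
proof (induction I rule: infinite_finite_induct)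
  case (insert x F)
  then show ?case using L2_add[of "f x" M "\<lambda>y. \<Sum>i\<in>F. f i y"] by simp
qed (auto intro: L2_zero)

lemma L2_abs: "f \<in> L2 M \<Longrightarrow> (\<lambda>x. \<bar>f x\<bar>) \<in> L2 M"
  by (auto simp: L2_def)

lemma L2_bounded_by:
  assumes "g \<in> L2 M" "f \<in> borel_measurable M" "AE x in M. \<bar>f x\<bar> \<le> \<bar>g x\<bar>"
  shows "f \<in> L2 M"
proof -
  have "integrable M (\<lambda>x. (f x)\<^sup>2)"
    by (rule Bochner_Integration.integrable_bound[OF L2_square_integrable[OF assms(1)]])
      (use assms in \<open>auto simp: abs_le_square_iff\<close>)
  then show ?thesis using assms by (simp add: L2_def)
qed

lemma L2_const: "finite_measure M \<Longrightarrow> (\<lambda>x. c) \<in> L2 M"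
  by (simp add: L2_def finite_measure.integrable_const)

section \<open>Inner product and norm\<close>

lemma ip_add_left: "f \<in> L2 M \<Longrightarrow> g \<in> L2 M \<Longrightarrow> h \<in> L2 M \<Longrightarrow>
    ip M (\<lambda>x. f x + g x) h = ip M f h + ip M g h"
  by (simp add: ip_def ring_distribs L2_mult_integrable)

lemma ip_diff_left: "f \<in> L2 M \<Longrightarrow> g \<in> L2 M \<Longrightarrow> h \<in> L2 M \<Longrightarrow>
    ip M (\<lambda>x. f x - g x) h = ip M f h - ip M g h"
  by (simp add: ip_def ring_distribs L2_mult_integrable)

lemma ip_scale_left: "ip M (\<lambda>x. c * f x) h = c * ip M f h"
  by (simp add: ip_def mult.assoc)

lemma ip_commute: "ip M f g = ip M g f"
  by (simp add: ip_def mult.commute)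

lemma ip_add_right: "f \<in> L2 M \<Longrightarrow> g \<in> L2 M \<Longrightarrow> h \<in> L2 M \<Longrightarrow>
    ip M h (\<lambda>x. f x + g x) = ip M h f + ip M h g"
  using ip_add_left[of f M g h] by (simp add: ip_commute[of M h])

lemma ip_diff_right: "f \<in> L2 M \<Longrightarrow> g \<in> L2 M \<Longrightarrow> h \<in> L2 M \<Longrightarrow>
    ip M h (\<lambda>x. f x - g x) = ip M h f - ip M h g"
  using ip_diff_left[of f M g h] by (simp add: ip_commute[of M h])

lemma ip_scale_right: "ip M h (\<lambda>x. c * f x) = c * ip M h f"
  by (simp add: ip_commute[of M h] ip_scale_left)

lemma ip_cong_AE:
  assumes "AE x in M. f x = f' x" "AE x in M. g x = g' x"
    "f \<in> L2 M" "f' \<in> L2 M" "g \<in> L2 M" "g' \<in> L2 M"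
  shows "ip M f g = ip M f' g'"
  unfolding ip_def
  by (rule integral_cong_AE) (use assms in \<open>auto simp: L2_def\<close>)

lemma ip_self_eq: "ip M f f = (L2norm M f)\<^sup>2"
  by (simp add: ip_def L2norm_def power2_eq_square[symmetric])

lemma L2norm_nonneg [simp]: "0 \<le> L2norm M f"
  by (simp add: L2norm_def)

lemma L2norm_eq_0_iff:
  assumes "f \<in> L2 M"
  shows "L2norm M f = 0 \<longleftrightarrow> (AE x in M. f x = 0)"
  using integral_nonneg_eq_0_iff_AE[OF L2_square_integrable[OF assms]]
  by (simp add: L2norm_def)

lemma L2norm_cong_AE:
  assumes "AE x in M. f x = g x" "f \<in> L2 M" "g \<in> L2 M"
  shows "L2norm M f = L2norm M g"
  unfolding L2norm_def
  by (rule arg_cong[where f=sqrt], rule integral_cong_AE)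
    (use assms in \<open>auto simp: L2_def\<close>)

lemma L2norm_scale: "L2norm M (\<lambda>x. c * f x) = \<bar>c\<bar> * L2norm M f"
  by (simp add: L2norm_def power_mult_distrib real_sqrt_mult)

lemma L2norm_uminus: "L2norm M (\<lambda>x. - f x) = L2norm M f"
  by (simp add: L2norm_def)

lemma L2norm_diff_commute: "L2norm M (\<lambda>x. f x - g x) = L2norm M (\<lambda>x. g x - f x)"
  by (simp add: L2norm_def power2_commute)

lemma L2norm_mono:
  assumes "g \<in> L2 M" "f \<in> L2 M" "AE x in M. \<bar>f x\<bar> \<le> \<bar>g x\<bar>"
  shows "L2norm M f \<le> L2norm M g"
  unfolding L2norm_def
  by (rule real_sqrt_le_mono, rule integral_mono_AE)
    (use assms in \<open>auto simp: L2_square_integrable abs_le_square_iff\<close>)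

lemma ip_Cauchy_Schwarz:
  assumes f: "f \<in> L2 M" and g: "g \<in> L2 M"
  shows "\<bar>ip M f g\<bar> \<le> L2norm M f * L2norm M g"
proof (cases "L2norm M g = 0")
  case True
  then have "AE x in M. g x = 0" using L2norm_eq_0_iff g by blast
  then have "ip M f g = ip M f (\<lambda>x. 0)"
    by (intro ip_cong_AE) (auto simp: f g L2_zero)
  then show ?thesis using True by (simp add: ip_def)
next
  case False
  define t where "t = ip M f g / (L2norm M g)\<^sup>2"
  have tg: "(\<lambda>x. t * g x) \<in> L2 M" using g by (rule L2_scale)
  have d: "(\<lambda>x. f x - t * g x) \<in> L2 M" using L2_diff[OF f tg] .
  have "0 \<le> ip M (\<lambda>x. f x - t * g x) (\<lambda>x. f x - t * g x)"
    unfolding ip_self_eq by simp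
  also have "\<dots> = ip M f f - 2 * t * ip M f g + t\<^sup>2 * ip M g g"
    by (simp add: ip_diff_left[OF f tg d] ip_diff_right[OF f tg f] ip_diff_right[OF f tg g]
        ip_scale_left ip_scale_right ip_commute[of M g f] power2_eq_square algebra_simps)
  also have "\<dots> = (L2norm M f)\<^sup>2 - (ip M f g)\<^sup>2 / (L2norm M g)\<^sup>2"
    using False by (simp add: ip_self_eq t_def power2_eq_square field_simps)
  finally have "(ip M f g)\<^sup>2 \<le> (L2norm M f * L2norm M g)\<^sup>2"
    using False by (simp add: field_simps power_mult_distrib)
  then show ?thesis
    by (simp add: abs_le_square_iff[symmetric])
qed

lemma L2norm_triangle:
  assumes f: "f \<in> L2 M" and g: "g \<in> L2 M"
  shows "L2norm M (\<lambda>x. f x + g x) \<le> L2norm M f + L2norm M g"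
proof -
  have "(L2norm M (\<lambda>x. f x + g x))\<^sup>2 = ip M f f + 2 * ip M f g + ip M g g"
    by (simp add: ip_self_eq[symmetric] ip_add_left[OF f g L2_add[OF f g]]
        ip_add_right[OF f g f] ip_add_right[OF f g g] ip_commute[of M g f])
  also have "\<dots> \<le> (L2norm M f + L2norm M g)\<^sup>2"
    using ip_Cauchy_Schwarz[OF f g] by (simp add: ip_self_eq power2_sum)
  finally show ?thesis
    by (rule power2_le_imp_le) simp
qed

lemma L2norm_triangle_diff:
  assumes f: "f \<in> L2 M" and g: "g \<in> L2 M"
  shows "L2norm M (\<lambda>x. f x - g x) \<le> L2norm M f + L2norm M g"
  using L2norm_triangle[OF f L2_uminus[OF g]] by (simp add: L2norm_uminus)

lemma L2norm_triangle_mid: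
  assumes "f \<in> L2 M" "g \<in> L2 M" "h \<in> L2 M"
  shows "L2norm M (\<lambda>x. f x - h x) \<le> L2norm M (\<lambda>x. f x - g x) + L2norm M (\<lambda>x. g x - h x)"
  using L2norm_triangle[OF L2_diff[OF assms(1,2)] L2_diff[OF assms(2,3)]] by simp

lemma L2norm_sum_le:
  assumes "\<And>i. i \<in> I \<Longrightarrow> f i \<in> L2 M"
  shows "L2norm M (\<lambda>x. \<Sum>i\<in>I. f i x) \<le> (\<Sum>i\<in>I. L2norm M (f i))"
  using assms
proof (induction I rule: infinite_finite_induct)
  case (insert x F)
  have "L2norm M (\<lambda>y. \<Sum>i\<in>insert x F. f i y) \<le> L2norm M (f x) + L2norm M (\<lambda>y. \<Sum>i\<in>F. f i y)"
    using L2norm_triangle[of "f x" M "\<lambda>y. \<Sum>i\<in>F. f i y"] insert by (simp add: L2_sum)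
  then show ?case using insert by simp
qed (auto simp: L2norm_def)

lemma ip_tendsto_left:
  assumes "\<And>k. f k \<in> L2 M" "g \<in> L2 M" "h \<in> L2 M"
    and "(\<lambda>k. L2norm M (\<lambda>x. f k x - g x)) \<longlonglongrightarrow> 0"
  shows "(\<lambda>k. ip M (f k) h) \<longlonglongrightarrow> ip M g h"
proof -
  have "(\<lambda>k. L2norm M (\<lambda>x. f k x - g x) * L2norm M h) \<longlonglongrightarrow> 0"
    using tendsto_mult_left_zero[OF assms(4)] .
  moreover have "norm (ip M (f k) h - ip M g h) \<le> L2norm M (\<lambda>x. f k x - g x) * L2norm M h" for k
    using ip_Cauchy_Schwarz[OF L2_diff[OF assms(1,2)] assms(3)] ip_diff_left[OF assms(1,2,3)]
    by simp
  ultimately have "(\<lambda>k. ip M (f k) h - ip M g h) \<longlonglongrightarrow> 0"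
    by (intro Lim_null_comparison[of "\<lambda>k. ip M (f k) h - ip M g h"
          "\<lambda>k. L2norm M (\<lambda>x. f k x - g x) * L2norm M h"]) auto
  then show ?thesis by (simp add: LIM_zero_iff)
qed

lemma L2norm_tendsto:
  assumes "\<And>k. f k \<in> L2 M" "g \<in> L2 M"
    and "(\<lambda>k. L2norm M (\<lambda>x. f k x - g x)) \<longlonglongrightarrow> 0"
  shows "(\<lambda>k. L2norm M (f k)) \<longlonglongrightarrow> L2norm M g"
proof -
  have "norm (L2norm M (f k) - L2norm M g) \<le> L2norm M (\<lambda>x. f k x - g x)" for k
    using L2norm_triangle[OF L2_diff[OF assms(1)[of k] assms(2)] assms(2)]
      L2norm_triangle[OF L2_diff[OF assms(2) assms(1)[of k]] assms(1)[of k]]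
    by (simp add: L2norm_diff_commute[of M g])
  then have "(\<lambda>k. L2norm M (f k) - L2norm M g) \<longlonglongrightarrow> 0"
    by (intro Lim_null_comparison[OF _ assms(3)]) auto
  then show ?thesis by (simp add: LIM_zero_iff)
qed

section \<open>Fatou's lemma and completeness\<close>

lemma L2_nn_integral:
  assumes "f \<in> L2 M"
  shows "(\<integral>\<^sup>+x. ennreal ((f x)\<^sup>2) \<partial>M) = ennreal ((L2norm M f)\<^sup>2)"
  using assms by (simp add: L2norm_def nn_integral_eq_integral L2_square_integrable)

lemma L2_I_nn_integral:
  assumes "f \<in> borel_measurable M" "(\<integral>\<^sup>+x. ennreal ((f x)\<^sup>2) \<partial>M) \<le> ennreal (c\<^sup>2)" "0 \<le> c"
  shows "f \<in> L2 M" and "L2norm M f \<le> c"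
proof -
  have "integrable M (\<lambda>x. (f x)\<^sup>2)"
    using assms by (intro integrableI_nonneg) (auto simp: le_less_trans)
  then show *: "f \<in> L2 M" using assms by (simp add: L2_def)
  have "(L2norm M f)\<^sup>2 \<le> c\<^sup>2"
    using assms(2) unfolding L2_nn_integral[OF *] by (simp add: ennreal_le_iff)
  then show "L2norm M f \<le> c" using assms(3) by (rule power2_le_imp_le)
qed

text \<open>A pointwise limit inherits square integrability and the limit of the norm bounds,
  without any dominating function. The same form serves tails of series, subsequences of primitives
  and truncations.\<close>

lemma L2_Fatou:
  assumes f: "\<And>k. f k \<in> L2 M" and lim: "AE x in M. (\<lambda>k. f k x) \<longlonglongrightarrow> g x"
    and g: "g \<in> borel_measurable M" and bd: "\<And>k. L2norm M (f k) \<le> b k"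
    and b: "b \<longlonglongrightarrow> c"
  shows "g \<in> L2 M" and "L2norm M g \<le> c"
proof -
  have b0: "0 \<le> b k" for k using bd[of k] L2norm_nonneg[of M "f k"] by linarith
  then have c: "0 \<le> c" using LIMSEQ_le_const[OF b] by blast
  have "(\<integral>\<^sup>+x. ennreal ((g x)\<^sup>2) \<partial>M) = (\<integral>\<^sup>+x. liminf (\<lambda>k. ennreal ((f k x)\<^sup>2)) \<partial>M)"
  proof (rule nn_integral_cong_AE, use lim in eventually_elim)
    fix x assume "(\<lambda>k. f k x) \<longlonglongrightarrow> g x"
    then have "(\<lambda>k. ennreal ((f k x)\<^sup>2)) \<longlonglongrightarrow> ennreal ((g x)\<^sup>2)"
      by (intro tendsto_ennrealI tendsto_power)
    then show "ennreal ((g x)\<^sup>2) = liminf (\<lambda>k. ennreal ((f k x)\<^sup>2))"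
      by (intro lim_imp_Liminf[symmetric] sequentially_bot)
  qed
  also have "\<dots> \<le> liminf (\<lambda>k. \<integral>\<^sup>+x. ennreal ((f k x)\<^sup>2) \<partial>M)"
    using f by (intro nn_integral_liminf) (auto simp: L2_def)
  also have "\<dots> \<le> liminf (\<lambda>k. ennreal ((b k)\<^sup>2))"
    by (intro Liminf_mono always_eventually allI)
      (use bd b0 in \<open>auto simp: L2_nn_integral[OF f] intro!: ennreal_leI power_mono\<close>)
  also have "\<dots> = ennreal (c\<^sup>2)"
    by (intro lim_imp_Liminf sequentially_bot tendsto_ennrealI tendsto_power b)
  finally show "g \<in> L2 M" "L2norm M g \<le> c"
    using L2_I_nn_integral[OF g _ c] by blast+
qed

text \<open>Riesz-Fischer in the form needed for a Neumann series. Monotone convergence for the sums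
  of absolute values gives absolute convergence almost everywhere, and Fatou applied to finite
  blocks of the tail bounds the remainder by the tail of the norm series.\<close>

lemma L2_series_convergent:
  assumes f: "\<And>n. f n \<in> L2 M" and sm: "summable (\<lambda>n. L2norm M (f n))"
  obtains g where "g \<in> L2 M"
    "(\<lambda>n. L2norm M (\<lambda>x. (\<Sum>i<n. f i x) - g x)) \<longlonglongrightarrow> 0"
proof -
  define C where "C = (\<Sum>n. L2norm M (f n))"
  define A where "A n x = (\<Sum>i<n. \<bar>f i x\<bar>)" for n x
  have AL2: "A n \<in> L2 M" for n unfolding A_def by (intro L2_sum L2_abs f)
  have abs_norm: "L2norm M (\<lambda>x. \<bar>f i x\<bar>) = L2norm M (f i)" for i by (simp add: L2norm_def)
  have An: "L2norm M (A n) \<le> C" for n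
  proof -
    have "L2norm M (A n) \<le> (\<Sum>i<n. L2norm M (\<lambda>x. \<bar>f i x\<bar>))"
      unfolding A_def by (intro L2norm_sum_le L2_abs f)
    also have "\<dots> \<le> C" unfolding abs_norm C_def by (intro sum_le_suminf sm) auto
    finally show ?thesis .
  qed
  have C0: "0 \<le> C" using An[of 0] L2norm_nonneg[of M "A 0"] by linarith
  have inc: "incseq (\<lambda>n x. ennreal ((A n x)\<^sup>2))"
    by (auto simp: incseq_def le_fun_def A_def intro!: ennreal_leI power_mono sum_mono2 sum_nonneg)
  have "(\<integral>\<^sup>+x. (SUP n. ennreal ((A n x)\<^sup>2)) \<partial>M) = (SUP n. \<integral>\<^sup>+x. ennreal ((A n x)\<^sup>2) \<partial>M)"
    by (rule nn_integral_monotone_convergence_SUP[OF inc]) (use L2_measurable[OF AL2] in measurable)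
  also have "\<dots> \<le> ennreal (C\<^sup>2)"
    by (rule SUP_least) (use An in \<open>auto simp: L2_nn_integral[OF AL2] intro!: ennreal_leI power_mono\<close>)
  finally have "(\<integral>\<^sup>+x. (SUP n. ennreal ((A n x)\<^sup>2)) \<partial>M) \<noteq> \<infinity>"
    by (metis ennreal_less_top infinity_ennreal_def leD top.not_eq_extremum)
  then have "AE x in M. (SUP n. ennreal ((A n x)\<^sup>2)) \<noteq> \<infinity>"
    by (rule nn_integral_noteq_infinite[rotated])
      (use L2_measurable[OF AL2] in measurable)
  then have AEs: "AE x in M. summable (\<lambda>i. f i x)"
  proof eventually_elim
    fix x assume "(SUP n. ennreal ((A n x)\<^sup>2)) \<noteq> \<infinity>"
    then obtain r where r: "(SUP n. ennreal ((A n x)\<^sup>2)) = ennreal r" "0 \<le> r"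
      by (cases "(SUP n. ennreal ((A n x)\<^sup>2))") auto
    have "(A n x)\<^sup>2 \<le> r" for n
      using SUP_upper[of n UNIV "\<lambda>n. ennreal ((A n x)\<^sup>2)"] r by (simp add: ennreal_le_iff)
    then have "A n x \<le> sqrt r" for n by (rule real_le_rsqrt)
    then have "summable (\<lambda>i. \<bar>f i x\<bar>)"
      by (intro summableI_nonneg_bounded[of _ "sqrt r"]) (auto simp: A_def)
    then show "summable (\<lambda>i. f i x)" by (rule summable_rabs_cancel)
  qed
  \<comment> \<open>Where the series diverges, \<open>suminf\<close> is an arbitrary value; this
    concerns a null set only.\<close>
  define g where "g x = (\<Sum>i. f i x)" for x
  have gm: "g \<in> borel_measurable M"
    unfolding g_def using f by (intro borel_measurable_suminf) (auto simp: L2_def)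
  have tail: "L2norm M (\<lambda>x. g x - (\<Sum>i<n. f i x)) \<le> (\<Sum>i. L2norm M (f (i + n)))"
    and tailL2: "(\<lambda>x. g x - (\<Sum>i<n. f i x)) \<in> L2 M" for n
  proof -
    have mem: "(\<lambda>x. \<Sum>i<m. f (i + n) x) \<in> L2 M" for m by (intro L2_sum f)
    have lim: "AE x in M. (\<lambda>m. \<Sum>i<m. f (i + n) x) \<longlonglongrightarrow> g x - (\<Sum>i<n. f i x)"
      using AEs
    proof eventually_elim
      fix x assume s: "summable (\<lambda>i. f i x)"
      then have "g x - (\<Sum>i<n. f i x) = (\<Sum>i. f (i + n) x)"
        using suminf_minus_initial_segment[OF s, of n] by (simp add: g_def)
      then show "(\<lambda>m. \<Sum>i<m. f (i + n) x) \<longlonglongrightarrow> g x - (\<Sum>i<n. f i x)"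
        using summable_LIMSEQ[OF summable_ignore_initial_segment[OF s]] by simp
    qed
    have meas: "(\<lambda>x. g x - (\<Sum>i<n. f i x)) \<in> borel_measurable M"
      using gm f by (intro borel_measurable_diff borel_measurable_sum) (auto simp: L2_def)
    have bd: "L2norm M (\<lambda>x. \<Sum>i<m. f (i + n) x) \<le> (\<Sum>i. L2norm M (f (i + n)))" for m
    proof -
      have "L2norm M (\<lambda>x. \<Sum>i<m. f (i + n) x) \<le> (\<Sum>i<m. L2norm M (f (i + n)))"
        by (intro L2norm_sum_le f)
      also have "\<dots> \<le> (\<Sum>i. L2norm M (f (i + n)))"
        by (intro sum_le_suminf summable_ignore_initial_segment[OF sm]) auto
      finally show ?thesis .
    qed
    show "L2norm M (\<lambda>x. g x - (\<Sum>i<n. f i x)) \<le> (\<Sum>i. L2norm M (f (i + n)))"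
      "(\<lambda>x. g x - (\<Sum>i<n. f i x)) \<in> L2 M"
      using L2_Fatou[OF mem lim meas bd tendsto_const] by blast+
  qed
  have "g \<in> L2 M" using tailL2[of 0] by simp
  moreover have "(\<lambda>n. L2norm M (\<lambda>x. (\<Sum>i<n. f i x) - g x)) \<longlonglongrightarrow> 0"
  proof (rule Lim_null_comparison)
    show "\<forall>\<^sub>F n in sequentially. norm (L2norm M (\<lambda>x. (\<Sum>i<n. f i x) - g x)) \<le> (\<Sum>i. L2norm M (f (i + n)))"
      using tail by (simp add: L2norm_diff_commute[of M g])
    show "(\<lambda>n. \<Sum>i. L2norm M (f (i + n))) \<longlonglongrightarrow> 0"
      using suminf_exist_split2[OF sm] .
  qed
  ultimately show ?thesis by (rule that)
qed


section \<open>A bounded operator, its adjoint, and the two products\<close>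

text \<open>The laws are identities of functions, not merely almost everywhere: both operators will
  be integrals, which do not see null sets, and \<open>R_cong\<close> and \<open>S_cong\<close>
  record this. \<open>R_mean_zero\<close> and \<open>S_one\<close> are two faces of one fact under
  \<open>adjoint\<close>: the range of \<open>R\<close> is orthogonal to the constants, and
  \<open>S\<close> annihilates them.\<close>

locale adjoint_pair =
  fixes M M' :: "real measure" and R S :: "(real \<Rightarrow> real) \<Rightarrow> real \<Rightarrow> real" and K :: real
  assumes finite_M: "finite_measure M"
    and nonzero_M: "emeasure M (space M) \<noteq> 0"
    and R_L2: "u \<in> L2 M' \<Longrightarrow> R u \<in> L2 M"
    and S_L2: "h \<in> L2 M \<Longrightarrow> S h \<in> L2 M'"
    and R_add: "u \<in> L2 M' \<Longrightarrow> v \<in> L2 M' \<Longrightarrow> R (\<lambda>x. u x + v x) = (\<lambda>x. R u x + R v x)"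
    and S_add: "h \<in> L2 M \<Longrightarrow> g \<in> L2 M \<Longrightarrow> S (\<lambda>x. h x + g x) = (\<lambda>x. S h x + S g x)"
    and R_scale: "u \<in> L2 M' \<Longrightarrow> R (\<lambda>x. c * u x) = (\<lambda>x. c * R u x)"
    and S_scale: "h \<in> L2 M \<Longrightarrow> S (\<lambda>x. c * h x) = (\<lambda>x. c * S h x)"
    and R_cong: "u \<in> L2 M' \<Longrightarrow> v \<in> L2 M' \<Longrightarrow> AE x in M'. u x = v x \<Longrightarrow> R u = R v"
    and S_cong: "h \<in> L2 M \<Longrightarrow> g \<in> L2 M \<Longrightarrow> AE x in M. h x = g x \<Longrightarrow> S h = S g"
    and R_bound: "u \<in> L2 M' \<Longrightarrow> L2norm M (R u) \<le> K * L2norm M' u"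
    and S_bound: "h \<in> L2 M \<Longrightarrow> L2norm M' (S h) \<le> K * L2norm M h"
    and adjoint: "u \<in> L2 M' \<Longrightarrow> h \<in> L2 M \<Longrightarrow> ip M (R u) h = ip M' u (S h)"
    and R_mean_zero: "u \<in> L2 M' \<Longrightarrow> ip M (R u) (\<lambda>_. 1) = 0"
    and S_one: "S (\<lambda>_. 1) = (\<lambda>_. 0)"
    and K_pos: "0 < K"
begin

definition lower_graph :: "((real \<Rightarrow> real) \<times> (real \<Rightarrow> real)) set" where
  "lower_graph = {(f, h). f \<in> L2 M \<and> h \<in> L2 M \<and> ip M h (\<lambda>_. 1) = 0 \<and>
     (\<exists>m. AE x in M. f x = m + R (S h) x)}"

definition upper_graph :: "((real \<Rightarrow> real) \<times> (real \<Rightarrow> real)) set" where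
  "upper_graph = {(u, k). u \<in> L2 M' \<and> k \<in> L2 M' \<and> (AE x in M'. u x = S (R k) x)}"

lemma const_L2 [simp]: "(\<lambda>_. c) \<in> L2 M"
  by (rule L2_const[OF finite_M])

lemma norm_one_pos: "0 < ip M (\<lambda>_. 1) (\<lambda>_. 1)"
proof -
  interpret finite_measure M by (rule finite_M)
  have "measure M (space M) > 0"
    using nonzero_M by (simp add: emeasure_eq_measure zero_less_measure_iff)
  then show ?thesis by (simp add: ip_def)
qed

lemma not_AE_const: "c \<noteq> 0 \<Longrightarrow> \<not> (AE x in M. c = (0::real))"
  using nonzero_M by (simp add: AE_iff_measurable[OF _ refl])

lemma S_diff: "h \<in> L2 M \<Longrightarrow> g \<in> L2 M \<Longrightarrow> S (\<lambda>x. h x - g x) = (\<lambda>x. S h x - S g x)"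
  using S_add[of h "\<lambda>x. -1 * g x"] S_scale[of g "-1"] L2_scale[of g M "-1"] by simp

lemma R_diff: "h \<in> L2 M' \<Longrightarrow> g \<in> L2 M' \<Longrightarrow> R (\<lambda>x. h x - g x) = (\<lambda>x. R h x - R g x)"
  using R_add[of h "\<lambda>x. -1 * g x"] R_scale[of g "-1"] L2_scale[of g M' "-1"] by simp

lemma S_const: "S (\<lambda>_. c) = (\<lambda>_. 0)"
  using S_scale[of "\<lambda>_. 1" c] by (simp add: S_one)

lemma S_add_const: "h \<in> L2 M \<Longrightarrow> S (\<lambda>x. c + h x) = S h"
  using S_add[of "\<lambda>_. c" h] by (simp add: S_const)

lemma S_sum: "finite B \<Longrightarrow> B \<subseteq> L2 M \<Longrightarrow> S (\<lambda>x. \<Sum>h\<in>B. c h * h x) = (\<lambda>x. \<Sum>h\<in>B. c h * S h x)"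
proof (induction B rule: finite_induct)
  case empty
  then show ?case using S_const[of 0] by simp
next
  case (insert g B)
  have "S (\<lambda>x. c g * g x + (\<Sum>h\<in>B. c h * h x))
      = (\<lambda>x. S (\<lambda>x. c g * g x) x + S (\<lambda>x. \<Sum>h\<in>B. c h * h x) x)"
    using insert by (intro S_add L2_sum L2_scale) auto
  then show ?case using insert by (simp add: S_scale)
qed

lemma R_zero: "R (\<lambda>_. 0) = (\<lambda>_. 0)"
  using R_scale[of "\<lambda>_. 0" 0] by (simp add: L2_zero)

lemma R_sum: "finite B \<Longrightarrow> B \<subseteq> L2 M' \<Longrightarrow> R (\<lambda>x. \<Sum>h\<in>B. c h * h x) = (\<lambda>x. \<Sum>h\<in>B. c h * R h x)"
proof (induction B rule: finite_induct)
  case empty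
  then show ?case using R_zero by simp
next
  case (insert g B)
  have "R (\<lambda>x. c g * g x + (\<Sum>h\<in>B. c h * h x))
      = (\<lambda>x. R (\<lambda>x. c g * g x) x + R (\<lambda>x. \<Sum>h\<in>B. c h * h x) x)"
    using insert by (intro R_add L2_sum L2_scale) auto
  then show ?case using insert by (simp add: R_scale)
qed

section \<open>Graph pairs and their resolvents\<close>

lemma adjoint': "h \<in> L2 M \<Longrightarrow> u \<in> L2 M' \<Longrightarrow> ip M' (S h) u = ip M h (R u)"
  using adjoint[of u h] by (simp add: ip_commute)

text \<open>Pairing with \<open>1\<close> isolates the free constant, because \<open>R (S h)\<close>
  has mean zero and the constant function has positive norm.\<close>

lemma lower_graph_const:
  assumes "f \<in> L2 M" "h \<in> L2 M" "ip M h (\<lambda>_. 1) = 0" "AE x in M. f x = m + R (S h) x"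
    "ip M f (\<lambda>_. 1) = 0"
  shows "m = 0"
proof -
  have L: "R (S h) \<in> L2 M" using assms R_L2 S_L2 by blast
  have "0 = ip M (\<lambda>x. m + R (S h) x) (\<lambda>_. 1)"
    using ip_cong_AE[OF assms(4), of "\<lambda>_. 1" "\<lambda>_. 1"] assms(1,5) L by (simp add: L2_add)
  also have "\<dots> = m * ip M (\<lambda>_. 1) (\<lambda>_. 1)"
    using assms L R_mean_zero[OF S_L2[OF assms(2)]] ip_scale_left[of M m "\<lambda>_. 1" "\<lambda>_. 1"]
    by (simp add: ip_add_left)
  finally show ?thesis using norm_one_pos by simp
qed

text \<open>With h = \<open>R k\<close>, the operator \<open>R\<close> carries the residual k - l u
  to the residual of the pair \<open>(R (S h), h)\<close>, so the lower estimate bounds h and with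
  it u = \<open>S h\<close>. For solvability, some p solves the lower equation with right side
  \<open>R q\<close>, and k = q + l \<open>S p\<close> is then the solution above.\<close>

lemma in_resolvent_upper:
  assumes l: "l \<noteq> 0" and r: "in_resolvent M lower_graph l"
  shows "in_resolvent M' upper_graph l"
proof -
  obtain C0 where C0: "\<And>f g. (f, g) \<in> lower_graph \<Longrightarrow> L2norm M f \<le> C0 * L2norm M (\<lambda>x. g x - l * f x)"
    using r unfolding in_resolvent_def by blast
  \<comment> \<open>The constant in \<open>in_resolvent\<close> may be negative; a nonnegative one
    can be multiplied through inequalities.\<close>
  define C where "C = max 0 C0"
  have "C0 * L2norm M v \<le> C * L2norm M v" for v
    unfolding C_def by (intro mult_right_mono) auto
  then have C: "\<And>f g. (f, g) \<in> lower_graph \<Longrightarrow> L2norm M f \<le> C * L2norm M (\<lambda>x. g x - l * f x)"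
    using C0 order_trans by blast
  have C_nonneg: "0 \<le> C" by (simp add: C_def)
  have "L2norm M' u \<le> K * ((1 + \<bar>l\<bar> * C) * K) * L2norm M' (\<lambda>x. k x - l * u x)"
    if uk: "(u, k) \<in> upper_graph" for u k
  proof -
    have u: "u \<in> L2 M'" and k: "k \<in> L2 M'" and AEu: "AE x in M'. u x = S (R k) x"
      using uk by (auto simp: upper_graph_def)
    define h where "h = R k"
    have h: "h \<in> L2 M" by (simp add: h_def R_L2 k)
    have Sh: "S h \<in> L2 M'" by (simp add: S_L2 h)
    have RSh: "R (S h) \<in> L2 M" by (simp add: R_L2 Sh)
    have "(R (S h), h) \<in> lower_graph"
      using h RSh R_mean_zero[OF k] by (auto simp: lower_graph_def h_def intro!: exI[of _ 0])
    note 1 = C[OF this]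
    have q: "(\<lambda>x. k x - l * u x) \<in> L2 M'" by (intro L2_diff L2_scale u k)
    have "R (\<lambda>x. k x - l * u x) = (\<lambda>x. h x - l * R u x)"
      using R_diff[OF k L2_scale[OF u]] R_scale[OF u] by (simp add: h_def)
    also have "R u = R (S h)" using R_cong[OF u Sh] AEu by (simp add: h_def)
    finally have Rq: "R (\<lambda>x. k x - l * u x) = (\<lambda>x. h x - l * R (S h) x)" .
    have Rq_L2: "(\<lambda>x. h x - l * R (S h) x) \<in> L2 M" by (intro L2_diff L2_scale h RSh)
    have "L2norm M h \<le> L2norm M (\<lambda>x. h x - l * R (S h) x) + L2norm M (\<lambda>x. l * R (S h) x)"
      using L2norm_triangle[OF Rq_L2 L2_scale[OF RSh, of l]] by simp
    also have "\<dots> \<le> L2norm M (\<lambda>x. h x - l * R (S h) x) + \<bar>l\<bar> * (C * L2norm M (\<lambda>x. h x - l * R (S h) x))"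
      using 1 by (simp add: L2norm_scale mult_left_mono)
    also have "\<dots> = (1 + \<bar>l\<bar> * C) * L2norm M (\<lambda>x. h x - l * R (S h) x)"
      by (simp add: algebra_simps)
    also have "\<dots> \<le> (1 + \<bar>l\<bar> * C) * (K * L2norm M' (\<lambda>x. k x - l * u x))"
      using R_bound[OF q] C_nonneg unfolding Rq by (intro mult_left_mono) auto
    finally have 2: "L2norm M h \<le> (1 + \<bar>l\<bar> * C) * (K * L2norm M' (\<lambda>x. k x - l * u x))" .
    have "L2norm M' u = L2norm M' (S h)"
      using L2norm_cong_AE[OF _ u Sh] AEu by (simp add: h_def)
    also have "\<dots> \<le> K * L2norm M h" by (rule S_bound[OF h])
    also have "\<dots> \<le> K * ((1 + \<bar>l\<bar> * C) * (K * L2norm M' (\<lambda>x. k x - l * u x)))"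
      using 2 K_pos by (intro mult_left_mono) auto
    finally show ?thesis by (simp add: mult.assoc)
  qed
  moreover have "\<exists>(u, k)\<in>upper_graph. AE x in M'. k x - l * u x = q x" if q: "q \<in> L2 M'" for q
  proof -
    have Rq: "R q \<in> L2 M" by (rule R_L2[OF q])
    then obtain f p where fp: "(f, p) \<in> lower_graph" and AEp: "AE x in M. p x - l * f x = R q x"
      using r unfolding in_resolvent_def by blast
    then obtain m where f: "f \<in> L2 M" and p: "p \<in> L2 M" and pm: "ip M p (\<lambda>_. 1) = 0"
      and AEf: "AE x in M. f x = m + R (S p) x"
      by (auto simp: lower_graph_def)
    have Sp: "S p \<in> L2 M'" by (rule S_L2[OF p])
    have RSp: "R (S p) \<in> L2 M" by (rule R_L2[OF Sp])
    define k where "k = (\<lambda>x. q x + l * S p x)"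
    have k: "k \<in> L2 M'" unfolding k_def by (intro L2_add L2_scale q Sp)
    have Rk: "R k = (\<lambda>x. R q x + l * R (S p) x)"
      unfolding k_def using R_add[OF q L2_scale[OF Sp]] R_scale[OF Sp] by simp
    \<comment> \<open>The unknown constant m reappears here, and it vanishes on applying
      \<open>S\<close>.\<close>
    have "AE x in M. p x = l * m + R k x"
      using AEp AEf by eventually_elim (auto simp: Rk algebra_simps)
    then have "S p = S (\<lambda>x. l * m + R k x)"
      by (intro S_cong p L2_add R_L2 k const_L2)
    then have "S p = S (R k)" using S_add_const[OF R_L2[OF k]] by simp
    then have "k x - l * S (R k) x = q x" for x by (simp add: k_def)
    moreover have "(S (R k), k) \<in> upper_graph"
      using k by (simp add: upper_graph_def S_L2 R_L2)
    ultimately show ?thesis by (intro bexI[of _ "(S (R k), k)"]) auto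
  qed
  ultimately show ?thesis unfolding in_resolvent_def by blast
qed

text \<open>\<open>R\<close> and \<open>S\<close> exchange roles, but \<open>S\<close> forgets
  constants. The upper estimate, applied to \<open>(S (R k), k)\<close> with k = \<open>S h\<close>,
  therefore controls only the mean-free part of f; the constant part of f and the mean of the right
  side are matched through the factor - l, and this is where l must be nonzero.\<close>

lemma in_resolvent_lower:
  assumes l: "l \<noteq> 0" and r: "in_resolvent M' upper_graph l"
  shows "in_resolvent M lower_graph l"
proof -
  obtain C0 where C0: "\<And>f g. (f, g) \<in> upper_graph \<Longrightarrow> L2norm M' f \<le> C0 * L2norm M' (\<lambda>x. g x - l * f x)"
    using r unfolding in_resolvent_def by blast
  define C where "C = max 0 C0"
  have "C0 * L2norm M' v \<le> C * L2norm M' v" for v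
    unfolding C_def by (intro mult_right_mono) auto
  then have C: "\<And>f g. (f, g) \<in> upper_graph \<Longrightarrow> L2norm M' f \<le> C * L2norm M' (\<lambda>x. g x - l * f x)"
    using C0 order_trans by blast
  have C_nonneg: "0 \<le> C" by (simp add: C_def)
  have "L2norm M f \<le> ((1 + K * ((1 + \<bar>l\<bar> * C) * K) * \<bar>l\<bar>) / \<bar>l\<bar>) * L2norm M (\<lambda>x. h x - l * f x)"
    if fh: "(f, h) \<in> lower_graph" for f h
  proof -
    define q where "q = (\<lambda>x. h x - l * f x)"
    obtain m where f: "f \<in> L2 M" and h: "h \<in> L2 M" and hm: "ip M h (\<lambda>_. 1) = 0"
      and AEf: "AE x in M. f x = m + R (S h) x"
      using fh by (auto simp: lower_graph_def)
    have q: "q \<in> L2 M" unfolding q_def by (intro L2_diff L2_scale f h)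
    define k where "k = S h"
    have k: "k \<in> L2 M'" unfolding k_def by (rule S_L2[OF h])
    have Rk: "R k \<in> L2 M" by (rule R_L2[OF k])
    have SRk: "S (R k) \<in> L2 M'" by (rule S_L2[OF Rk])
    have Sf: "S f = S (R k)"
      using S_cong[OF f L2_add[OF const_L2 Rk]] AEf S_add_const[OF Rk] by (simp add: k_def)
    have Sq: "S q = (\<lambda>x. k x - l * S (R k) x)"
      unfolding q_def using S_diff[OF h L2_scale[OF f]] S_scale[OF f] Sf by (simp add: k_def)
    have "(S (R k), k) \<in> upper_graph" using k SRk by (simp add: upper_graph_def)
    note 1 = C[OF this, folded Sq]
    have "L2norm M' k \<le> L2norm M' (S q) + L2norm M' (\<lambda>x. l * S (R k) x)"
      using L2norm_triangle[OF S_L2[OF q] L2_scale[OF SRk, of l]] by (simp add: Sq)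
    also have "\<dots> \<le> L2norm M' (S q) + \<bar>l\<bar> * (C * L2norm M' (S q))"
      using 1 by (simp add: L2norm_scale mult_left_mono)
    also have "\<dots> = (1 + \<bar>l\<bar> * C) * L2norm M' (S q)"
      by (simp add: algebra_simps)
    also have "\<dots> \<le> (1 + \<bar>l\<bar> * C) * (K * L2norm M q)"
      using S_bound[OF q] C_nonneg by (intro mult_left_mono) auto
    finally have 2: "L2norm M' k \<le> (1 + \<bar>l\<bar> * C) * (K * L2norm M q)" .
    have "L2norm M (R k) \<le> K * L2norm M' k" by (rule R_bound[OF k])
    also have "\<dots> \<le> K * ((1 + \<bar>l\<bar> * C) * (K * L2norm M q))"
      using 2 K_pos by (intro mult_left_mono) auto
    finally have 3: "L2norm M (R k) \<le> K * ((1 + \<bar>l\<bar> * C) * K) * L2norm M q"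
      by (simp add: mult.assoc)
    \<comment> \<open>The mean of \<open>q\<close> is \<open>- l m\<close>, so the mean part of \<open>f\<close> is controlled by Bessel's inequality.\<close>
    define r where "r = (\<lambda>x. h x - l * R k x)"
    define e where "e = - (l * m)"
    have AEq: "AE x in M. q x = r x + e"
      using AEf by eventually_elim (simp add: q_def k_def r_def e_def algebra_simps)
    have r: "r \<in> L2 M" unfolding r_def by (intro L2_diff L2_scale h Rk)
    have r1: "ip M r (\<lambda>_. c) = 0" for c
    proof -
      have "ip M r (\<lambda>_. 1) = 0"
        unfolding r_def using hm R_mean_zero[OF k]
        by (simp add: ip_diff_left[OF h L2_scale[OF Rk]] ip_scale_left)
      then show ?thesis using ip_scale_right[of M r c "\<lambda>_. 1"] by simp
    qed
    have "(L2norm M q)\<^sup>2 = ip M (\<lambda>x. r x + e) (\<lambda>x. r x + e)"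
      unfolding ip_self_eq[symmetric]
      by (intro ip_cong_AE AEq q L2_add[OF r] const_L2)
    also have "\<dots> = ip M r r + ip M (\<lambda>_. e) (\<lambda>_. e)"
      using r by (simp add: ip_add_left ip_add_right L2_add r1 ip_commute[of M "\<lambda>_. c" r for c])
    finally have "(L2norm M (\<lambda>_. e))\<^sup>2 \<le> (L2norm M q)\<^sup>2"
      by (simp add: ip_self_eq)
    then have "L2norm M (\<lambda>_. e) \<le> L2norm M q"
      by (rule power2_le_imp_le) simp
    then have 4: "L2norm M (\<lambda>_. m) \<le> L2norm M q / \<bar>l\<bar>"
      using l L2norm_scale[of M "-l" "\<lambda>_. m"] by (simp add: e_def field_simps)
    have "L2norm M f = L2norm M (\<lambda>x. m + R k x)"
      by (rule L2norm_cong_AE) (use AEf f Rk in \<open>auto simp: k_def intro!: L2_add\<close>)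
    also have "\<dots> \<le> L2norm M q / \<bar>l\<bar> + K * ((1 + \<bar>l\<bar> * C) * K) * L2norm M q"
      using L2norm_triangle[OF const_L2 Rk, of m] 3 4 by linarith
    also have "\<dots> = ((1 + K * ((1 + \<bar>l\<bar> * C) * K) * \<bar>l\<bar>) / \<bar>l\<bar>) * L2norm M q"
      using l by (simp add: field_simps)
    finally show ?thesis unfolding q_def .
  qed
  moreover have "\<exists>(f, h)\<in>lower_graph. AE x in M. h x - l * f x = q x" if q: "q \<in> L2 M" for q
  proof -
    \<comment> \<open>The mean of q is split off: the operator is zero on constants, so
      \<open>- e / l\<close> solves that component, while \<open>S q0\<close> is the right side of
      the upper equation.\<close>
    define e where "e = ip M q (\<lambda>_. 1) / ip M (\<lambda>_. 1) (\<lambda>_. 1)"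
    define q0 where "q0 = (\<lambda>x. q x - e)"
    have q0: "q0 \<in> L2 M" unfolding q0_def by (intro L2_diff q const_L2)
    have q0m: "ip M q0 (\<lambda>_. 1) = 0"
      unfolding q0_def using q norm_one_pos ip_scale_left[of M e "\<lambda>_. 1" "\<lambda>_. 1"]
      by (simp add: ip_diff_left e_def)
    have Sq: "S q0 \<in> L2 M'" by (rule S_L2[OF q0])
    then obtain u k where uk: "(u, k) \<in> upper_graph" and AEk: "AE x in M'. k x - l * u x = S q0 x"
      using r unfolding in_resolvent_def by blast
    then have u: "u \<in> L2 M'" and k: "k \<in> L2 M'" and AEu: "AE x in M'. u x = S (R k) x"
      by (auto simp: upper_graph_def)
    have Rk: "R k \<in> L2 M" by (rule R_L2[OF k])
    define h where "h = (\<lambda>x. q0 x + l * R k x)"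
    have h: "h \<in> L2 M" unfolding h_def by (intro L2_add L2_scale q0 Rk)
    have hm: "ip M h (\<lambda>_. 1) = 0"
      unfolding h_def using q0m R_mean_zero[OF k] by (simp add: ip_add_left[OF q0 L2_scale[OF Rk]] ip_scale_left)
    have Sh: "S h = (\<lambda>x. S q0 x + l * S (R k) x)"
      unfolding h_def using S_add[OF q0 L2_scale[OF Rk]] S_scale[OF Rk] by simp
    have "AE x in M'. S h x = k x"
      using AEk AEu by eventually_elim (auto simp: Sh)
    then have "R (S h) = R k" by (intro R_cong S_L2 h k)
    then have "h x - l * (- e / l + R (S h) x) = q x" for x
      using l by (simp add: h_def q0_def field_simps)
    moreover have "(\<lambda>x. - e / l + R (S h) x, h) \<in> lower_graph"
      using h hm by (auto simp: lower_graph_def intro!: L2_add L2_diff R_L2 S_L2)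
    ultimately show ?thesis by (intro bexI[of _ "(\<lambda>x. - e / l + R (S h) x, h)"]) auto
  qed
  ultimately show ?thesis unfolding in_resolvent_def by blast
qed

section \<open>The point zero in the two spectra\<close>

lemma zero_eigen: "(\<lambda>_. 1, \<lambda>_. 0) \<in> lower_graph"
  using S_const[of 0] by (auto simp: lower_graph_def R_zero ip_def intro!: exI[of _ 1])

lemma zero_in_spec_lower: "0 \<in> spec M lower_graph"
proof -
  have "\<not> in_resolvent M lower_graph 0"
  proof
    assume "in_resolvent M lower_graph 0"
    then obtain C where "\<forall>(f, g)\<in>lower_graph. L2norm M f \<le> C * L2norm M (\<lambda>x. g x - 0 * f x)"
      unfolding in_resolvent_def by blast
    from bspec[OF this zero_eigen] have "L2norm M (\<lambda>_. 1) \<le> C * L2norm M (\<lambda>x. 0)" by simp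
    then have "L2norm M (\<lambda>_. 1) = 0"
      by (simp add: L2norm_def measure_le_0_iff)
    then show False using norm_one_pos by (simp add: ip_self_eq)
  qed
  then show ?thesis by (simp add: spec_def)
qed

text \<open>Neumann series: the bound \<open>K\<close> on each factor makes l S R a contraction.
  Besides the point 0 this covers a whole neighbourhood of it, which isolates 0 in the other
  spectrum.\<close>

lemma small_in_resolvent_upper:
  assumes l: "\<bar>l\<bar> * K\<^sup>2 < 1"
  shows "in_resolvent M' upper_graph l"
proof -
  define T where "T = (\<lambda>k x. l * S (R k) x)"
  define t where "t = \<bar>l\<bar> * K\<^sup>2"
  have t: "0 \<le> t" "t < 1" using l by (auto simp: t_def)
  have SR: "S (R k) \<in> L2 M'" and SRb: "L2norm M' (S (R k)) \<le> K\<^sup>2 * L2norm M' k" if "k \<in> L2 M'" for k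
  proof -
    show "S (R k) \<in> L2 M'" using that by (intro S_L2 R_L2)
    have "L2norm M' (S (R k)) \<le> K * L2norm M (R k)" by (rule S_bound[OF R_L2[OF that]])
    also have "\<dots> \<le> K * (K * L2norm M' k)" using R_bound[OF that] K_pos by (intro mult_left_mono) auto
    finally show "L2norm M' (S (R k)) \<le> K\<^sup>2 * L2norm M' k" by (simp add: power2_eq_square)
  qed
  have T: "T k \<in> L2 M'" and Tb: "L2norm M' (T k) \<le> t * L2norm M' k" if "k \<in> L2 M'" for k
    unfolding T_def t_def using SR[OF that] mult_left_mono[OF SRb[OF that], of "\<bar>l\<bar>"]
    by (auto simp: L2norm_scale mult.assoc intro!: L2_scale)
  have "L2norm M' u \<le> (K\<^sup>2 / (1 - t)) * L2norm M' (\<lambda>x. k x - l * u x)"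
    if uk: "(u, k) \<in> upper_graph" for u k
  proof -
    have u: "u \<in> L2 M'" and k: "k \<in> L2 M'" and AEu: "AE x in M'. u x = S (R k) x"
      using uk by (auto simp: upper_graph_def)
    have "L2norm M' u = L2norm M' (S (R k))" by (rule L2norm_cong_AE[OF AEu u SR[OF k]])
    then have 1: "L2norm M' u \<le> K\<^sup>2 * L2norm M' k" using SRb[OF k] by simp
    have "L2norm M' k \<le> L2norm M' (\<lambda>x. k x - l * u x) + \<bar>l\<bar> * L2norm M' u"
      using L2norm_triangle[OF L2_diff[OF k L2_scale[OF u, of l]] L2_scale[OF u, of l]]
      by (simp add: L2norm_scale)
    also have "\<dots> \<le> L2norm M' (\<lambda>x. k x - l * u x) + \<bar>l\<bar> * (K\<^sup>2 * L2norm M' k)"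
      using 1 by (simp add: mult_left_mono)
    finally have "(1 - t) * L2norm M' k \<le> L2norm M' (\<lambda>x. k x - l * u x)"
      by (simp add: t_def algebra_simps)
    then have "L2norm M' k \<le> L2norm M' (\<lambda>x. k x - l * u x) / (1 - t)"
      using t by (simp add: field_simps)
    then have "K\<^sup>2 * L2norm M' k \<le> K\<^sup>2 * (L2norm M' (\<lambda>x. k x - l * u x) / (1 - t))"
      by (intro mult_left_mono) auto
    then show ?thesis using 1 by simp
  qed
  moreover have "\<exists>(u, k)\<in>upper_graph. AE x in M'. k x - l * u x = q x" if q: "q \<in> L2 M'" for q
  proof -
    define f where "f n = (T ^^ n) q" for n
    have f: "f n \<in> L2 M'" for n by (induction n) (auto simp: f_def q T)
    have fb: "L2norm M' (f n) \<le> t ^ n * L2norm M' q" for n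
    proof (induction n)
      case (Suc n)
      have "L2norm M' (f (Suc n)) \<le> t * L2norm M' (f n)" using Tb[OF f[of n]] by (simp add: f_def)
      also have "\<dots> \<le> t * (t ^ n * L2norm M' q)" using Suc t by (intro mult_left_mono) auto
      finally show ?case by simp
    qed (simp add: f_def)
    have "summable (\<lambda>n. L2norm M' (f n))"
      by (rule summable_comparison_test'[of "\<lambda>n. t ^ n * L2norm M' q" 0])
        (use t fb in \<open>auto intro!: summable_mult2 summable_geometric\<close>)
    then obtain k where k: "k \<in> L2 M'"
      and lim: "(\<lambda>n. L2norm M' (\<lambda>x. (\<Sum>i<n. f i x) - k x)) \<longlonglongrightarrow> 0"
      by (rule L2_series_convergent[OF f])
    define s where "s n = (\<lambda>x. \<Sum>i<n. f i x)" for n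
    have s: "s n \<in> L2 M'" for n unfolding s_def by (intro L2_sum f)
    have T_add: "T (\<lambda>x. u x + v x) = (\<lambda>x. T u x + T v x)" if "u \<in> L2 M'" "v \<in> L2 M'" for u v
      using that by (simp add: T_def R_add S_add R_L2 algebra_simps)
    have T_diff: "T (\<lambda>x. u x - v x) = (\<lambda>x. T u x - T v x)" if "u \<in> L2 M'" "v \<in> L2 M'" for u v
      using that by (simp add: T_def R_diff S_diff R_L2 algebra_simps)
    have Ts: "s (Suc n) x = q x + T (s n) x" for n x
    proof (induction n arbitrary: x)
      case 0
      show ?case by (simp add: s_def f_def T_def R_zero S_const)
    next
      case (Suc n)
      have "s (Suc (Suc n)) x = s (Suc n) x + T (f n) x" by (simp add: s_def f_def)
      also have "\<dots> = q x + (T (s n) x + T (f n) x)" using Suc by simp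
      also have "T (s n) x + T (f n) x = T (\<lambda>x. s n x + f n x) x"
        by (simp add: T_add[OF s f])
      also have "(\<lambda>x. s n x + f n x) = s (Suc n)" by (simp add: s_def fun_eq_iff)
      finally show ?case .
    qed
    have lim': "(\<lambda>n. L2norm M' (\<lambda>x. s n x - k x)) \<longlonglongrightarrow> 0" using lim by (simp add: s_def)
    \<comment> \<open>The partial sums satisfy s (n + 1) = q + T (s n), so the defect of the limit
      is at most the sum of two errors that tend to zero.\<close>
    define d where "d = (\<lambda>x. k x - T k x - q x)"
    have d: "d \<in> L2 M'" unfolding d_def by (intro L2_diff k T q)
    have "L2norm M' d \<le> L2norm M' (\<lambda>x. s (Suc n) x - k x) + t * L2norm M' (\<lambda>x. s n x - k x)" for n
    proof -
      have "d = (\<lambda>x. T (\<lambda>x. s n x - k x) x - (s (Suc n) x - k x))"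
        by (simp add: d_def Ts T_diff[OF s k] fun_eq_iff)
      then have "L2norm M' d \<le> L2norm M' (T (\<lambda>x. s n x - k x)) + L2norm M' (\<lambda>x. s (Suc n) x - k x)"
        using L2norm_triangle_diff[OF T[OF L2_diff[OF s k]] L2_diff[OF s k]] by simp
      then show ?thesis using Tb[OF L2_diff[OF s[of n] k]] by simp
    qed
    moreover have "(\<lambda>n. L2norm M' (\<lambda>x. s (Suc n) x - k x) + t * L2norm M' (\<lambda>x. s n x - k x)) \<longlonglongrightarrow> 0 + t * 0"
      by (intro tendsto_add tendsto_mult tendsto_const lim' LIMSEQ_Suc[OF lim'])
    ultimately have "L2norm M' d \<le> 0 + t * 0"
      by (intro LIMSEQ_le_const[of _ "0 + t * 0" "L2norm M' d"]) auto
    then have "L2norm M' d = 0" using L2norm_nonneg[of M' d] by simp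
    then have "AE x in M'. d x = 0" using L2norm_eq_0_iff[OF d] by blast
    then have "AE x in M'. k x - l * S (R k) x = q x"
      by eventually_elim (simp add: d_def T_def)
    moreover have "(S (R k), k) \<in> upper_graph" using k SR by (simp add: upper_graph_def)
    ultimately show ?thesis by (intro bexI[of _ "(S (R k), k)"]) auto
  qed
  ultimately show ?thesis unfolding in_resolvent_def by blast
qed

text \<open>The exchange of resolvents covers l \<noteq> 0; at 0 the upper graph is regular by the
  Neumann series with l = 0.\<close>

lemma spec_lower_minus_zero: "spec M lower_graph - {0} = spec M' upper_graph"
proof -
  have "in_resolvent M' upper_graph 0" by (rule small_in_resolvent_upper) simp
  then have "l \<in> spec M lower_graph - {0} \<longleftrightarrow> l \<in> spec M' upper_graph" for l
    using in_resolvent_upper[of l] in_resolvent_lower[of l] by (cases "l = 0") (auto simp: spec_def)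
  then show ?thesis by blast
qed

text \<open>A nonzero spectral point l of the lower graph is one of the upper graph, and those
  satisfy |l| \<ge> 1 / K^2.\<close>

lemma zero_not_limpt: "\<not> 0 islimpt spec M lower_graph"
proof
  assume a: "0 islimpt spec M lower_graph"
  have "0 < 1 / K\<^sup>2" using K_pos by simp
  then obtain l where l: "l \<in> spec M lower_graph" "l \<noteq> 0" "\<bar>l\<bar> < 1 / K\<^sup>2"
    using a unfolding islimpt_approachable by (metis dist_real_def diff_zero)
  then have "l \<in> spec M' upper_graph" using spec_lower_minus_zero by blast
  moreover have "in_resolvent M' upper_graph l"
    using l K_pos by (intro small_in_resolvent_upper) (simp add: field_simps)
  ultimately show False by (simp add: spec_def)
qed

text \<open>The kernel consists of the constants: h = 0 almost everywhere forces \<open>S h\<close>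
  = 0 and f = m. As a discrete eigenvalue, 0 is absent from the essential spectrum, so removing it
  from the spectrum leaves no trace there.\<close>

lemma zero_in_spec_disc: "0 \<in> spec_disc M lower_graph"
proof -
  have "is_eigenvalue M lower_graph 0"
    unfolding is_eigenvalue_def eigenspace_def
    using zero_eigen not_AE_const[of 1] by (intro bexI[of _ "\<lambda>_. 1"]) auto
  moreover have "finite_mult M lower_graph 0"
    unfolding finite_mult_def
  proof (intro exI[of _ "{\<lambda>_. 1}"] conjI ballI)
    fix f assume "f \<in> eigenspace M lower_graph 0"
    then obtain h m where h: "h \<in> L2 M" "AE x in M. h x = 0" and f: "AE x in M. f x = m + R (S h) x"
      by (auto simp: eigenspace_def lower_graph_def)
    have "S h = (\<lambda>_. 0)" using S_cong[of h "\<lambda>_. 0"] h S_const[of 0] by simp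
    then have "AE x in M. f x = m" using f by (simp add: R_zero)
    then show "\<exists>c. AE x in M. f x = (\<Sum>h\<in>{\<lambda>_. 1}. c h * h x)"
      by (intro exI[of _ "\<lambda>_. m"]) simp
  qed auto
  ultimately show ?thesis
    using zero_in_spec_lower zero_not_limpt by (simp add: spec_disc_def)
qed

section \<open>Eigenvalues, multiplicities and the essential spectrum\<close>

lemma eigenspace_lowerE:
  assumes "l \<noteq> 0" "f \<in> eigenspace M lower_graph l"
  shows "f \<in> L2 M" "AE x in M. f x = l * R (S f) x" "S f \<in> eigenspace M' upper_graph l"
proof -
  obtain h m where f: "f \<in> L2 M" and h: "h \<in> L2 M" and hm: "ip M h (\<lambda>_. 1) = 0"
    and AEh: "AE x in M. h x = l * f x" and AEf: "AE x in M. f x = m + R (S h) x"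
    using assms(2) by (auto simp: eigenspace_def lower_graph_def)
  \<comment> \<open>Since h = l f has mean zero, dividing by l gives mean zero for f, and this kills
    the constant m.\<close>
  have "ip M h (\<lambda>_. 1) = l * ip M f (\<lambda>_. 1)"
    using ip_cong_AE[OF AEh, of "\<lambda>_. 1" "\<lambda>_. 1"] f h by (simp add: L2_scale ip_scale_left)
  then have "ip M f (\<lambda>_. 1) = 0" using hm assms(1) by simp
  then have m: "m = 0" using lower_graph_const[OF f h hm AEf] by simp
  have Sh: "S h = (\<lambda>x. l * S f x)" using S_cong[OF h L2_scale[OF f] AEh] S_scale[OF f] by simp
  have RSh: "R (S h) = (\<lambda>x. l * R (S f) x)" by (simp add: Sh R_scale S_L2 f)
  show "f \<in> L2 M" by fact
  show AE2: "AE x in M. f x = l * R (S f) x" using AEf by (simp add: m RSh)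
  have "l * S (R (S f)) x = S f x" for x
    by (rule fun_cong[OF trans[OF S_cong[OF f L2_scale[OF R_L2[OF S_L2[OF f]]] AE2]
          S_scale[OF R_L2[OF S_L2[OF f]]]], symmetric])
  then have "(S f, \<lambda>x. l * S f x) \<in> upper_graph"
    using f by (auto simp: upper_graph_def S_L2 L2_scale R_scale S_scale R_L2 intro!: AE_I2)
  then show "S f \<in> eigenspace M' upper_graph l"
    by (auto simp: eigenspace_def)
qed

lemma eigenspace_upperE:
  assumes "u \<in> eigenspace M' upper_graph l"
  shows "u \<in> L2 M'" "AE x in M'. u x = l * S (R u) x" "R u \<in> eigenspace M lower_graph l"
proof -
  obtain k where u: "u \<in> L2 M'" and k: "k \<in> L2 M'"
    and AEk: "AE x in M'. k x = l * u x" and AEu: "AE x in M'. u x = S (R k) x"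
    using assms by (auto simp: eigenspace_def upper_graph_def)
  have Rk: "R k = (\<lambda>x. l * R u x)" using R_cong[OF k L2_scale[OF u] AEk] R_scale[OF u] by simp
  have SRk: "S (R k) = (\<lambda>x. l * S (R u) x)" by (simp add: Rk S_scale R_L2 u)
  show "u \<in> L2 M'" by fact
  show AE2: "AE x in M'. u x = l * S (R u) x" using AEu by (simp add: SRk)
  have Ru: "l * R (S (R u)) x = R u x" for x
    by (rule fun_cong[OF trans[OF R_cong[OF u L2_scale[OF S_L2[OF R_L2[OF u]]] AE2]
          R_scale[OF S_L2[OF R_L2[OF u]]]], symmetric])
  have "(R u, \<lambda>x. l * R u x) \<in> lower_graph"
    using u Ru R_mean_zero[OF u]
    by (auto simp: lower_graph_def S_L2 L2_scale R_scale S_scale R_L2 ip_scale_left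
        intro!: AE_I2 exI[of _ 0])
  then show "R u \<in> eigenspace M lower_graph l"
    by (auto simp: eigenspace_def)
qed

text \<open>On an eigenspace for l \<noteq> 0 the identities f = l \<open>R (S f)\<close> and u = l
  \<open>S (R u)\<close> make \<open>S\<close> and \<open>R\<close> injective, so a nonzero
  eigenfunction has a nonzero image.\<close>

lemma is_eigenvalue_iff:
  assumes l: "l \<noteq> 0"
  shows "is_eigenvalue M lower_graph l \<longleftrightarrow> is_eigenvalue M' upper_graph l"
proof
  assume "is_eigenvalue M lower_graph l"
  then obtain f where f: "f \<in> eigenspace M lower_graph l" and nz: "\<not> (AE x in M. f x = 0)"
    by (auto simp: is_eigenvalue_def)
  note E = eigenspace_lowerE[OF l f]
  have "\<not> (AE x in M'. S f x = 0)"
  proof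
    assume "AE x in M'. S f x = 0"
    then have "R (S f) = (\<lambda>_. 0)" using R_cong[OF S_L2[OF E(1)] L2_zero] R_zero by simp
    then show False using E(2) nz by simp
  qed
  then show "is_eigenvalue M' upper_graph l" using E(3) by (auto simp: is_eigenvalue_def)
next
  assume "is_eigenvalue M' upper_graph l"
  then obtain u where u: "u \<in> eigenspace M' upper_graph l" and nz: "\<not> (AE x in M'. u x = 0)"
    by (auto simp: is_eigenvalue_def)
  note E = eigenspace_upperE[OF u]
  have "\<not> (AE x in M. R u x = 0)"
  proof
    assume "AE x in M. R u x = 0"
    then have "S (R u) = (\<lambda>_. 0)" using S_cong[OF R_L2[OF E(1)] L2_zero] S_const[of 0] by simp
    then show False using E(2) nz by simp
  qed
  then show "is_eigenvalue M lower_graph l" using E(3) by (auto simp: is_eigenvalue_def)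
qed

text \<open>Distinct members of B may have the same image under T; the new coefficients are the sums
  over the fibres.\<close>

lemma sum_over_image:
  fixes T :: "(real \<Rightarrow> real) \<Rightarrow> real \<Rightarrow> real"
  assumes "finite B"
  shows "\<exists>d. \<forall>x. (\<Sum>h\<in>B. c h * T h x) = (\<Sum>g\<in>T ` B. d g * g x)"
proof (intro exI allI)
  fix x
  have "(\<Sum>h\<in>B. c h * T h x) = (\<Sum>g\<in>T ` B. \<Sum>h\<in>{h \<in> B. T h = g}. c h * T h x)"
    using sum.image_gen[OF assms, of "\<lambda>h. c h * T h x" T] .
  also have "\<dots> = (\<Sum>g\<in>T ` B. (\<Sum>h\<in>{h \<in> B. T h = g}. c h) * g x)"
    by (intro sum.cong refl) (auto simp: sum_distrib_right)
  finally show "(\<Sum>h\<in>B. c h * T h x) = (\<Sum>g\<in>T ` B. (\<lambda>g. \<Sum>h\<in>{h \<in> B. T h = g}. c h) g * g x)" .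
qed

text \<open>Since u = l \<open>S (R u)\<close>, a finite family spanning the lower eigenspace is
  carried by \<open>S\<close> to one spanning the upper eigenspace, with coefficients multiplied by
  l; likewise with \<open>R\<close>. As \<open>finite_mult\<close> asks for a spanning family, no
  basis has to be extracted.\<close>

lemma finite_mult_iff:
  assumes l: "l \<noteq> 0"
  shows "finite_mult M lower_graph l \<longleftrightarrow> finite_mult M' upper_graph l"
proof
  assume "finite_mult M lower_graph l"
  then obtain B where B: "finite B" "B \<subseteq> L2 M"
    and sp: "\<And>f. f \<in> eigenspace M lower_graph l \<Longrightarrow> \<exists>c. AE x in M. f x = (\<Sum>h\<in>B. c h * h x)"
    by (auto simp: finite_mult_def)
  show "finite_mult M' upper_graph l"
    unfolding finite_mult_def
  proof (intro exI[of _ "S ` B"] conjI ballI)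
    fix u assume "u \<in> eigenspace M' upper_graph l"
    note E = eigenspace_upperE[OF this]
    obtain c where c: "AE x in M. R u x = (\<Sum>h\<in>B. c h * h x)" using sp[OF E(3)] by blast
    have "S (R u) = S (\<lambda>x. \<Sum>h\<in>B. c h * h x)"
      by (rule S_cong[OF R_L2[OF E(1)] _ c]) (use B in \<open>auto intro!: L2_sum L2_scale\<close>)
    then have "S (R u) = (\<lambda>x. \<Sum>h\<in>B. c h * S h x)" using S_sum[OF B] by simp
    moreover obtain d where "\<And>x. (\<Sum>h\<in>B. (l * c h) * S h x) = (\<Sum>g\<in>S ` B. d g * g x)"
      using sum_over_image[OF B(1), of "\<lambda>h. l * c h" S] by blast
    ultimately have "AE x in M'. u x = (\<Sum>g\<in>S ` B. d g * g x)"
      using E(2) by (simp add: sum_distrib_left mult.assoc)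
    then show "\<exists>c. AE x in M'. u x = (\<Sum>g\<in>S ` B. c g * g x)" by blast
  qed (use B S_L2 in auto)
next
  assume "finite_mult M' upper_graph l"
  then obtain B where B: "finite B" "B \<subseteq> L2 M'"
    and sp: "\<And>f. f \<in> eigenspace M' upper_graph l \<Longrightarrow> \<exists>c. AE x in M'. f x = (\<Sum>h\<in>B. c h * h x)"
    by (auto simp: finite_mult_def)
  show "finite_mult M lower_graph l"
    unfolding finite_mult_def
  proof (intro exI[of _ "R ` B"] conjI ballI)
    fix f assume "f \<in> eigenspace M lower_graph l"
    note E = eigenspace_lowerE[OF l this]
    obtain c where c: "AE x in M'. S f x = (\<Sum>h\<in>B. c h * h x)" using sp[OF E(3)] by blast
    have "R (S f) = R (\<lambda>x. \<Sum>h\<in>B. c h * h x)"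
      by (rule R_cong[OF S_L2[OF E(1)] _ c]) (use B in \<open>auto intro!: L2_sum L2_scale\<close>)
    then have "R (S f) = (\<lambda>x. \<Sum>h\<in>B. c h * R h x)" using R_sum[OF B] by simp
    moreover obtain d where "\<And>x. (\<Sum>h\<in>B. (l * c h) * R h x) = (\<Sum>g\<in>R ` B. d g * g x)"
      using sum_over_image[OF B(1), of "\<lambda>h. l * c h" R] by blast
    ultimately have "AE x in M. f x = (\<Sum>g\<in>R ` B. d g * g x)"
      using E(2) by (simp add: sum_distrib_left mult.assoc)
    then show "\<exists>c. AE x in M. f x = (\<Sum>g\<in>R ` B. c g * g x)" by blast
  qed (use B R_L2 in auto)
qed

lemma islimpt_spec_iff: "l islimpt spec M lower_graph \<longleftrightarrow> l islimpt spec M' upper_graph"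
proof -
  have "spec M lower_graph = insert 0 (spec M' upper_graph)"
    using spec_lower_minus_zero zero_in_spec_lower by blast
  then show ?thesis by (simp add: islimpt_insert)
qed

lemma spec_ess_eq: "spec_ess M lower_graph = spec_ess M' upper_graph"
proof -
  have "l \<in> spec_ess M lower_graph \<longleftrightarrow> l \<in> spec_ess M' upper_graph" for l
  proof (cases "l = 0")
    case True
    then show ?thesis
      using zero_in_spec_disc spec_lower_minus_zero by (auto simp: spec_ess_def)
  next
    case False
    then have "l \<in> spec M lower_graph \<longleftrightarrow> l \<in> spec M' upper_graph"
      using spec_lower_minus_zero by blast
    then show ?thesis
      using False by (simp add: spec_ess_def spec_disc_def islimpt_spec_iff is_eigenvalue_iff finite_mult_iff)
  qed
  then show ?thesis by blast
qed

section \<open>Quadratic forms and max-min values\<close>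

lemma lower_form: 
  assumes "f \<in> L2 M" "h \<in> L2 M" "ip M h (\<lambda>_. 1) = 0" "AE x in M. f x = m + R (S h) x"
  shows "ip M f h = (L2norm M' (S h))\<^sup>2"
proof -
  have L: "R (S h) \<in> L2 M" using assms R_L2 S_L2 by blast
  have "ip M f h = ip M (\<lambda>x. m + R (S h) x) h"
    by (intro ip_cong_AE assms L2_add const_L2 L AE_I2) auto
  also have "\<dots> = m * ip M h (\<lambda>_. 1) + ip M (R (S h)) h"
    using ip_scale_left[of M m "\<lambda>_. 1" h] ip_commute[of M h "\<lambda>_. 1"]
    by (simp add: ip_add_left assms L)
  finally show ?thesis using assms by (simp add: adjoint S_L2 ip_self_eq)
qed

lemma upper_form: 
  assumes "u \<in> L2 M'" "k \<in> L2 M'" "AE x in M'. u x = S (R k) x"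
  shows "ip M' u k = (L2norm M (R k))\<^sup>2"
proof -
  have "ip M' u k = ip M' (S (R k)) k"
    by (intro ip_cong_AE assms S_L2 R_L2 AE_I2) auto
  then show ?thesis using assms by (simp add: adjoint' R_L2 ip_self_eq)
qed

text \<open>In both uses q is the norm of the first component of a given pair, p that of its
  transform, and r that of \<open>R k\<close> or \<open>S h\<close> for the second component;
  \<open>q\<^sup>2 \<le> p * r\<close> comes from Cauchy-Schwarz. The two ratios are the Rayleigh
  quotients of the transformed and of the given pair. Positivity of p shows that the transform is a
  nonzero competitor.\<close>

lemma Rayleigh_compare:
  fixes p q r :: real
  assumes "0 < q" "0 \<le> p" "0 \<le> r" "q\<^sup>2 \<le> p * r"
  shows "0 < p" "0 < r" "q\<^sup>2 / p\<^sup>2 \<le> r\<^sup>2 / q\<^sup>2"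
proof -
  have pr: "0 < p * r" using assms(1,4) zero_less_power[of q 2] by linarith
  then show "0 < p" "0 < r" using assms by (auto simp: zero_less_mult_iff)
  then have "q\<^sup>2 * q\<^sup>2 \<le> (p * r) * (p * r)" using assms by (intro mult_mono) auto
  then show "q\<^sup>2 / p\<^sup>2 \<le> r\<^sup>2 / q\<^sup>2"
    using \<open>0 < p\<close> assms(1) by (simp add: divide_simps power2_eq_square algebra_simps)
qed

text \<open>The kernel of the lower operator absorbs one of the n + 1 constraints. If all of them
  are orthogonal to \<open>1\<close>, the constant is admissible and the infimum is at most 0.
  Otherwise some \<open>gs j\<close> sees constants: the competitor f = \<alpha> +
  \<open>R u\<close> meets this constraint by the choice of \<alpha>, and the other n, reduced
  modulo \<open>gs j\<close> to functions orthogonal to the constants, become constraints on u under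
  \<open>S\<close>.\<close>

lemma maxmin_lower_le: "maxmin M lower_graph (Suc n) \<le> maxmin M' upper_graph n"
  unfolding maxmin_def
proof (rule SUP_least)
  fix gs :: "nat \<Rightarrow> real \<Rightarrow> real"
  assume "gs \<in> {gs. \<forall>i<Suc n. gs i \<in> L2 M}"
  then have gs: "\<And>i. i < Suc n \<Longrightarrow> gs i \<in> L2 M" by blast
  let ?F = "{(f, g). (f, g) \<in> lower_graph \<and> \<not> (AE x in M. f x = 0) \<and> (\<forall>i<Suc n. ip M f (gs i) = 0)}"
  let ?r = "\<lambda>fg. ereal (ip M (fst fg) (snd fg) / ip M (fst fg) (fst fg))"
  let ?r' = "\<lambda>fg. ereal (ip M' (fst fg) (snd fg) / ip M' (fst fg) (fst fg))"
  let ?F' = "\<lambda>ks. {(f, g). (f, g) \<in> upper_graph \<and> \<not> (AE x in M'. f x = 0) \<and> (\<forall>i<n. ip M' f (ks i) = 0)}"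
  have "\<exists>ks\<in>{ks. \<forall>i<n. ks i \<in> L2 M'}. (INF fg\<in>?F. ?r fg) \<le> (INF fg\<in>?F' ks. ?r' fg)"
  proof (cases "\<forall>i<Suc n. ip M (\<lambda>_. 1) (gs i) = 0")
    case True
    have mem: "(\<lambda>_. 1, \<lambda>_. 0) \<in> ?F" using zero_eigen True not_AE_const[of 1] by simp
    have "(INF fg\<in>?F. ?r fg) \<le> ?r (\<lambda>_. 1, \<lambda>_. 0)" by (rule INF_lower[OF mem])
    also have "\<dots> = 0" by (simp add: ip_def zero_ereal_def)
    also have "0 \<le> (INF fg\<in>?F' (\<lambda>_ _. 0). ?r' fg)"
      by (rule INF_greatest) (auto simp: upper_graph_def upper_form ip_self_eq)
    finally show ?thesis by (intro bexI[of _ "\<lambda>_ _. 0"]) (auto intro: L2_zero)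
  next
    case False
    then obtain j where j: "j < Suc n" "ip M (\<lambda>_. 1) (gs j) \<noteq> 0" by blast
    \<comment> \<open>\<open>idx\<close> lists the n indices other than j, and \<open>c i\<close> is
      the coefficient that makes \<open>p i\<close> orthogonal to \<open>1\<close>, so that a
      constant added to a competitor does not change its pairing with \<open>p i\<close>.\<close>
    define idx where "idx i = (if i < j then i else Suc i)" for i
    define c where "c i = ip M (\<lambda>_. 1) (gs (idx i)) / ip M (\<lambda>_. 1) (gs j)" for i
    define p where "p i = (\<lambda>x. gs (idx i) x - c i * gs j x)" for i
    have idx: "idx i < Suc n" if "i < n" for i using that j by (auto simp: idx_def)
    have p: "p i \<in> L2 M" if "i < n" for i
      unfolding p_def using idx[OF that] gs j by (intro L2_diff L2_scale) auto
    have "\<exists>fg\<in>?F. ?r fg \<le> ?r' uk" if uk: "uk \<in> ?F' (\<lambda>i. S (p i))" for uk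
    proof -
      obtain u k where [simp]: "uk = (u, k)" and u: "u \<in> L2 M'" and k: "k \<in> L2 M'"
        and AEu: "AE x in M'. u x = S (R k) x" and nz: "\<not> (AE x in M'. u x = 0)"
        and orth: "\<And>i. i < n \<Longrightarrow> ip M' u (S (p i)) = 0"
        using uk by (auto simp: upper_graph_def)
      have Ru: "R u \<in> L2 M" and Rk: "R k \<in> L2 M" by (auto intro: R_L2 u k)
      define \<alpha> where "\<alpha> = - ip M (R u) (gs j) / ip M (\<lambda>_. 1) (gs j)"
      define f where "f = (\<lambda>x. \<alpha> + R u x)"
      have f: "f \<in> L2 M" unfolding f_def by (intro L2_add const_L2 Ru)
      have fg: "ip M f g = \<alpha> * ip M (\<lambda>_. 1) g + ip M (R u) g" if "g \<in> L2 M" for g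
        unfolding f_def using ip_scale_left[of M \<alpha> "\<lambda>_. 1" g] by (simp add: ip_add_left that Ru)
      have fj: "ip M f (gs j) = 0" using gs[OF j(1)] j(2) by (simp add: fg \<alpha>_def)
      have "ip M f (gs (idx i)) = 0" if i: "i < n" for i
      proof -
        have "ip M (R u) (p i) = 0" using orth[OF i] adjoint[OF u p[OF i]] by simp
        then have 1: "ip M (R u) (gs (idx i)) = c i * ip M (R u) (gs j)"
          unfolding p_def using gs[OF idx[OF i]] gs[OF j(1)]
          by (simp add: ip_diff_right L2_scale Ru ip_scale_right)
        show ?thesis using j(2) by (simp add: fg gs[OF idx[OF i]] 1 \<alpha>_def c_def field_simps)
      qed
      then have orth': "ip M f (gs i) = 0" if "i < Suc n" for i
        using that fj
      proof (cases i j rule: linorder_cases)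
        case less
        then show ?thesis using \<open>\<And>i. i < n \<Longrightarrow> ip M f (gs (idx i)) = 0\<close>[of i] j by (simp add: idx_def)
      next
        case greater
        then show ?thesis using \<open>\<And>i. i < n \<Longrightarrow> ip M f (gs (idx i)) = 0\<close>[of "i - 1"] that
          by (cases i) (auto simp: idx_def)
      qed (use fj in simp)
      have RS: "R u = R (S (R k))" by (rule R_cong[OF u S_L2[OF Rk] AEu])
      have G: "(f, R k) \<in> lower_graph"
        using f Rk R_mean_zero[OF k] by (auto simp: lower_graph_def f_def RS)
      have nu: "0 < L2norm M' u"
        using nz L2norm_eq_0_iff[OF u] L2norm_nonneg[of M' u] by linarith
      have "(L2norm M' u)\<^sup>2 = ip M' u (S (R k))"
        unfolding ip_self_eq[symmetric] by (intro ip_cong_AE u S_L2 Rk AEu) auto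
      also have "\<dots> = ip M (R u) (R k)" by (simp add: adjoint u Rk)
      \<comment> \<open>The constant in f is invisible to \<open>R k\<close>, which has mean zero; f
        may therefore replace \<open>R u\<close> before Cauchy-Schwarz is applied.\<close>
      also have "\<dots> = ip M f (R k)"
        using R_mean_zero[OF k] by (simp add: fg Rk ip_commute[of M "\<lambda>_. 1"])
      also have "\<dots> \<le> L2norm M f * L2norm M (R k)"
        using ip_Cauchy_Schwarz[OF f Rk] by linarith
      finally have cs: "(L2norm M' u)\<^sup>2 \<le> L2norm M f * L2norm M (R k)" .
      note cmp = Rayleigh_compare[OF nu _ _ cs, simplified]
      have "\<not> (AE x in M. f x = 0)" using cmp(1) L2norm_eq_0_iff[OF f] by simp
      then have mem: "(f, R k) \<in> ?F" using G orth' by simp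
      have "ip M f (R k) = (L2norm M' (S (R k)))\<^sup>2"
        by (rule lower_form[of f "R k" \<alpha>]) (use f Rk R_mean_zero[OF k] in \<open>auto simp: f_def RS\<close>)
      also have "L2norm M' (S (R k)) = L2norm M' u"
        by (rule L2norm_cong_AE[symmetric, OF AEu u S_L2[OF Rk]])
      finally have "?r (f, R k) \<le> ?r' uk"
        using cmp(3) by (simp add: ip_self_eq upper_form[OF u k AEu])
      then show ?thesis using mem by blast
    qed
    then have "(INF fg\<in>?F. ?r fg) \<le> (INF fg\<in>?F' (\<lambda>i. S (p i)). ?r' fg)"
      by (rule INF_mono)
    then show ?thesis by (intro bexI[of _ "\<lambda>i. S (p i)"]) (auto intro: S_L2 p)
  qed
  then show "(INF fg\<in>?F. ?r fg) \<le> (SUP ks\<in>{ks. \<forall>i<n. ks i \<in> L2 M'}. INF fg\<in>?F' ks. ?r' fg)"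
    by (meson SUP_upper2)
qed

text \<open>The constraints are passed down as \<open>1\<close> followed by the images
  \<open>R (ks i)\<close>. The extra constraint \<open>1\<close> forces the free constant to vanish,
  which accounts for the shift of the index; the others say by adjointness that \<open>S f\<close>
  is orthogonal to each \<open>ks i\<close>.\<close>

lemma maxmin_upper_le: "maxmin M' upper_graph n \<le> maxmin M lower_graph (Suc n)"
  unfolding maxmin_def
proof (rule SUP_least)
  fix ks :: "nat \<Rightarrow> real \<Rightarrow> real"
  assume "ks \<in> {ks. \<forall>i<n. ks i \<in> L2 M'}"
  then have ks: "\<And>i. i < n \<Longrightarrow> ks i \<in> L2 M'" by blast
  let ?F = "\<lambda>gs. {(f, g). (f, g) \<in> lower_graph \<and> \<not> (AE x in M. f x = 0) \<and> (\<forall>i<Suc n. ip M f (gs i) = 0)}"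
  let ?r = "\<lambda>fg. ereal (ip M (fst fg) (snd fg) / ip M (fst fg) (fst fg))"
  let ?r' = "\<lambda>fg. ereal (ip M' (fst fg) (snd fg) / ip M' (fst fg) (fst fg))"
  let ?F' = "{(f, g). (f, g) \<in> upper_graph \<and> \<not> (AE x in M'. f x = 0) \<and> (\<forall>i<n. ip M' f (ks i) = 0)}"
  define gs where "gs i = (case i of 0 \<Rightarrow> (\<lambda>_. 1) | Suc i \<Rightarrow> R (ks i))" for i
  have gs: "gs \<in> {gs. \<forall>i<Suc n. gs i \<in> L2 M}"
    by (auto simp: gs_def R_L2 ks split: nat.split)
  have "\<exists>uk\<in>?F'. ?r' uk \<le> ?r fh" if fh: "fh \<in> ?F gs" for fh
  proof -
    obtain f h m where [simp]: "fh = (f, h)" and f: "f \<in> L2 M" and h: "h \<in> L2 M"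
      and hm: "ip M h (\<lambda>_. 1) = 0" and AEf: "AE x in M. f x = m + R (S h) x"
      and nz: "\<not> (AE x in M. f x = 0)" and orth: "\<And>i. i < Suc n \<Longrightarrow> ip M f (gs i) = 0"
      using fh by (auto simp: lower_graph_def)
    have m: "m = 0"
      using lower_graph_const[OF f h hm AEf] orth[of 0] by (simp add: gs_def)
    have Sf: "S f \<in> L2 M'" and Sh: "S h \<in> L2 M'" by (auto intro: S_L2 f h)
    have AEf': "AE x in M. f x = R (S h) x" using AEf by (simp add: m)
    have SR: "S f = S (R (S h))" by (rule S_cong[OF f R_L2[OF Sh] AEf'])
    have G: "(S f, S h) \<in> upper_graph" using Sf Sh by (simp add: upper_graph_def SR)
    have orth': "ip M' (S f) (ks i) = 0" if "i < n" for i
      using orth[of "Suc i"] that by (simp add: gs_def adjoint' f ks)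
    have nf: "0 < L2norm M f"
      using nz L2norm_eq_0_iff[OF f] L2norm_nonneg[of M f] by linarith
    have "(L2norm M f)\<^sup>2 = ip M f (R (S h))"
      unfolding ip_self_eq[symmetric] by (intro ip_cong_AE f R_L2 Sh AEf') auto
    also have "\<dots> = ip M' (S f) (S h)" by (simp add: adjoint' f Sh)
    also have "\<dots> \<le> L2norm M' (S f) * L2norm M' (S h)"
      using ip_Cauchy_Schwarz[OF Sf Sh] by linarith
    finally have cs: "(L2norm M f)\<^sup>2 \<le> L2norm M' (S f) * L2norm M' (S h)" .
    note cmp = Rayleigh_compare[OF nf _ _ cs, simplified]
    have "\<not> (AE x in M'. S f x = 0)" using cmp(1) L2norm_eq_0_iff[OF Sf] by simp
    then have mem: "(S f, S h) \<in> ?F'" using G orth' by simp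
    have "ip M' (S f) (S h) = (L2norm M (R (S h)))\<^sup>2"
      by (rule upper_form[OF Sf Sh]) (simp add: SR)
    also have "L2norm M (R (S h)) = L2norm M f"
      by (rule L2norm_cong_AE[symmetric, OF AEf' f R_L2[OF Sh]])
    finally have "?r' (S f, S h) \<le> ?r fh"
      using cmp(3) by (simp add: ip_self_eq lower_form[OF f h hm AEf])
    then show ?thesis using mem by blast
  qed
  then have "(INF fg\<in>?F'. ?r' fg) \<le> (INF fg\<in>?F gs. ?r fg)"
    by (rule INF_mono)
  also have "\<dots> \<le> (SUP gs\<in>{gs. \<forall>i<Suc n. gs i \<in> L2 M}. INF fg\<in>?F gs. ?r fg)"
    by (rule SUP_upper[OF gs])
  finally show "(INF fg\<in>?F'. ?r' fg) \<le> (SUP gs\<in>{gs. \<forall>i<Suc n. gs i \<in> L2 M}. INF fg\<in>?F gs. ?r fg)" .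
qed

lemma maxmin_eq: "1 \<le> n \<Longrightarrow> maxmin M lower_graph n = maxmin M' upper_graph (n - 1)"
  using maxmin_lower_le[of "n - 1"] maxmin_upper_le[of "n - 1"] by simp

end

section \<open>Smooth functions and cut-offs\<close>

text \<open>All iterated derivatives of f stay in X, so a class of differentiable functions closed
  under \<open>deriv\<close> replaces any formula for higher derivatives.\<close>

lemma smooth_coinduct:
  assumes "f \<in> X" and step: "\<And>f. f \<in> X \<Longrightarrow> (\<forall>x. f differentiable (at x)) \<and> deriv f \<in> X"
  shows "smooth f"
proof -
  have "(deriv ^^ k) f \<in> X" for k
    by (induction k) (use assms in auto)
  then show ?thesis using step by (auto simp: smooth_def)
qed

lemma smooth_differentiable: "smooth f \<Longrightarrow> f differentiable (at x)"
  unfolding smooth_def by (metis funpow_0)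

lemma smooth_deriv: "smooth f \<Longrightarrow> smooth (deriv f)"
  unfolding smooth_def by (metis comp_apply funpow_Suc_right)

lemma smooth_has_deriv: "smooth f \<Longrightarrow> (f has_real_derivative deriv f x) (at x)"
  using smooth_differentiable[of f x] by (simp add: DERIV_deriv_iff_real_differentiable)

lemma smooth_isCont: "smooth f \<Longrightarrow> isCont f x"
  using DERIV_isCont smooth_has_deriv by blast

lemma smooth_continuous_on: "smooth f \<Longrightarrow> continuous_on A f"
  by (simp add: continuous_at_imp_continuous_on smooth_isCont)

lemma smooth_measurable: "smooth f \<Longrightarrow> f \<in> borel_measurable borel"
  by (intro borel_measurable_continuous_onI smooth_continuous_on)

lemma smooth_antideriv:
  assumes "\<And>x. (f has_real_derivative g x) (at x)" "smooth g"
  shows "smooth f"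
proof -
  have d: "deriv f = g" using assms(1) DERIV_imp_deriv by blast
  show ?thesis
    by (rule smooth_coinduct[of f "{f} \<union> {g. smooth g}"])
      (use assms d in \<open>auto simp: smooth_deriv smooth_differentiable intro: real_differentiable_def[THEN iffD2]\<close>)
qed

text \<open>Derivatives of reciprocals, exponentials and logarithms mix the operations, so each is
  awkward to iterate on its own. The closure under all of them at once is stable under
  differentiation, which makes it a class for \<open>smooth_coinduct\<close> and yields every rule
  simultaneously.\<close>

inductive_set smooth_closure :: "(real \<Rightarrow> real) set" where
  base: "smooth f \<Longrightarrow> f \<in> smooth_closure"
| add: "f \<in> smooth_closure \<Longrightarrow> g \<in> smooth_closure \<Longrightarrow> (\<lambda>x. f x + g x) \<in> smooth_closure"
| mult: "f \<in> smooth_closure \<Longrightarrow> g \<in> smooth_closure \<Longrightarrow> (\<lambda>x. f x * g x) \<in> smooth_closure"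
| inverse: "f \<in> smooth_closure \<Longrightarrow> (\<And>x. f x \<noteq> 0) \<Longrightarrow> (\<lambda>x. inverse (f x)) \<in> smooth_closure"
| exp: "f \<in> smooth_closure \<Longrightarrow> (\<lambda>x. exp (f x)) \<in> smooth_closure"
| ln: "f \<in> smooth_closure \<Longrightarrow> (\<And>x. 0 < f x) \<Longrightarrow> (\<lambda>x. ln (f x)) \<in> smooth_closure"
| affine: "f \<in> smooth_closure \<Longrightarrow> (\<lambda>x. f (c * x + d)) \<in> smooth_closure"

lemma smooth_const: "smooth (\<lambda>_. c)"
  by (rule smooth_coinduct[of _ "range (\<lambda>c _. c)"]) auto

lemma smooth_closure_deriv:
  "f \<in> smooth_closure \<Longrightarrow> \<exists>f'. f' \<in> smooth_closure \<and> (\<forall>x. (f has_real_derivative f' x) (at x))"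
proof (induction rule: smooth_closure.induct)
  case (base f)
  then show ?case
    by (intro exI[of _ "deriv f"]) (auto intro: smooth_closure.base smooth_deriv smooth_has_deriv)
next
  case (add f g)
  then obtain f' g' where "f' \<in> smooth_closure" "\<And>x. (f has_real_derivative f' x) (at x)"
    "g' \<in> smooth_closure" "\<And>x. (g has_real_derivative g' x) (at x)" by blast
  then show ?case
    by (intro exI[of _ "\<lambda>x. f' x + g' x"]) (auto intro: smooth_closure.add DERIV_add)
next
  case (mult f g)
  then obtain f' g' where "f' \<in> smooth_closure" "\<And>x. (f has_real_derivative f' x) (at x)"
    "g' \<in> smooth_closure" "\<And>x. (g has_real_derivative g' x) (at x)" by blast
  then show ?case using mult
    by (intro exI[of _ "\<lambda>x. f' x * g x + g' x * f x"])
      (auto intro!: smooth_closure.add smooth_closure.mult DERIV_mult)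
next
  case (inverse f)
  then obtain f' where "f' \<in> smooth_closure" "\<And>x. (f has_real_derivative f' x) (at x)" by blast
  then show ?case using inverse
    by (intro exI[of _ "\<lambda>x. (- 1) * ((inverse (f x) * f' x) * inverse (f x))"] conjI allI
        smooth_closure.mult smooth_closure.inverse smooth_closure.base[OF smooth_const])
      (auto intro!: derivative_eq_intros)
next
  case (exp f)
  then obtain f' where "f' \<in> smooth_closure" "\<And>x. (f has_real_derivative f' x) (at x)" by blast
  then show ?case using exp
    by (intro exI[of _ "\<lambda>x. exp (f x) * f' x"])
      (auto intro!: smooth_closure.mult smooth_closure.exp DERIV_fun_exp)
next
  case (ln f)
  then obtain f' where "f' \<in> smooth_closure" "\<And>x. (f has_real_derivative f' x) (at x)" by blast
  moreover have "\<And>x. f x \<noteq> 0" using ln by (metis less_irrefl)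
  ultimately show ?case using ln
    by (intro exI[of _ "\<lambda>x. inverse (f x) * f' x"] conjI allI)
      (auto intro!: smooth_closure.mult smooth_closure.inverse derivative_eq_intros simp: divide_inverse)
next
  case (affine f c d)
  then obtain f' where f': "f' \<in> smooth_closure" "\<And>x. (f has_real_derivative f' x) (at x)" by blast
  have "((\<lambda>x. f (c * x + d)) has_real_derivative (f' (c * x + d) * c)) (at x)" for x
    by (rule DERIV_chain2[OF f'(2)]) (auto intro!: derivative_eq_intros)
  then show ?case using f'
    by (intro exI[of _ "\<lambda>x. f' (c * x + d) * c"] conjI allI
        smooth_closure.mult[OF smooth_closure.affine[OF f'(1)] smooth_closure.base[OF smooth_const]])
qed

lemma smooth_closure_smooth: "f \<in> smooth_closure \<Longrightarrow> smooth f"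
proof (erule smooth_coinduct)
  fix f assume "f \<in> smooth_closure"
  then obtain f' where f': "f' \<in> smooth_closure" "\<And>x. (f has_real_derivative f' x) (at x)"
    using smooth_closure_deriv by blast
  then have "deriv f = f'" using DERIV_imp_deriv by blast
  then show "(\<forall>x. f differentiable (at x)) \<and> deriv f \<in> smooth_closure"
    using f' by (auto intro: real_differentiable_def[THEN iffD2])
qed

lemma smooth_add: "smooth f \<Longrightarrow> smooth g \<Longrightarrow> smooth (\<lambda>x. f x + g x)"
  by (rule smooth_closure_smooth[OF smooth_closure.add[OF smooth_closure.base smooth_closure.base]])

lemma smooth_mult: "smooth f \<Longrightarrow> smooth g \<Longrightarrow> smooth (\<lambda>x. f x * g x)"
  by (rule smooth_closure_smooth[OF smooth_closure.mult[OF smooth_closure.base smooth_closure.base]])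

lemma smooth_scale: "smooth f \<Longrightarrow> smooth (\<lambda>x. c * f x)"
  by (intro smooth_mult smooth_const)

lemma smooth_uminus: "smooth f \<Longrightarrow> smooth (\<lambda>x. - f x)"
  using smooth_scale[of f "-1"] by simp

lemma smooth_diff: "smooth f \<Longrightarrow> smooth g \<Longrightarrow> smooth (\<lambda>x. f x - g x)"
  using smooth_add[of f "\<lambda>x. - g x"] smooth_uminus[of g] by simp

lemma smooth_inverse: "smooth f \<Longrightarrow> (\<And>x. f x \<noteq> 0) \<Longrightarrow> smooth (\<lambda>x. inverse (f x))"
  by (rule smooth_closure_smooth[OF smooth_closure.inverse[OF smooth_closure.base]])

lemma smooth_divide: "smooth f \<Longrightarrow> smooth g \<Longrightarrow> (\<And>x. g x \<noteq> 0) \<Longrightarrow> smooth (\<lambda>x. f x / g x)"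
  unfolding divide_inverse by (intro smooth_mult smooth_inverse)

lemma smooth_exp: "smooth f \<Longrightarrow> smooth (\<lambda>x. exp (f x))"
  by (rule smooth_closure_smooth[OF smooth_closure.exp[OF smooth_closure.base]])

lemma smooth_ln: "smooth f \<Longrightarrow> (\<And>x. 0 < f x) \<Longrightarrow> smooth (\<lambda>x. ln (f x))"
  by (rule smooth_closure_smooth[OF smooth_closure.ln[OF smooth_closure.base]])

lemma smooth_affine: "smooth f \<Longrightarrow> smooth (\<lambda>x. f (c * x + d))"
  by (rule smooth_closure_smooth[OF smooth_closure.affine[OF smooth_closure.base]])

section \<open>Flat functions and the smooth step\<close>

lemma has_real_derivative_transform_at:
  assumes "(f has_real_derivative D) (at x)" "eventually (\<lambda>y. f y = g y) (nhds x)"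
  shows "(g has_real_derivative D) (at x)"
  using assms DERIV_cong_ev[OF refl _ refl, of f g x D] by simp

text \<open>The powers of 1 / x accompany the classical exp (- 1 / x) because the derivative of
  \<open>flat n\<close> is a combination of \<open>flat (n + 2)\<close> and
  \<open>flat (n + 1)\<close>: the linear span of the family is closed under
  differentiation.\<close>

definition flat :: "nat \<Rightarrow> real \<Rightarrow> real" where
  "flat n x = (if x \<le> 0 then 0 else (1 / x) ^ n * exp (- (1 / x)))"

lemma flat_pos_deriv:
  assumes "0 < x"
  shows "(flat n has_real_derivative (flat (n + 2) x - real n * flat (n + 1) x)) (at x)"
proof (rule has_real_derivative_transform_at)
  show "((\<lambda>x. (1 / x) ^ n * exp (- (1 / x))) has_real_derivative
      (flat (n + 2) x - real n * flat (n + 1) x)) (at x)"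
    using assms
    by (auto intro!: derivative_eq_intros simp: flat_def power2_eq_square field_simps)
      (cases n; simp add: field_simps)
  show "\<forall>\<^sub>F y in nhds x. (1 / y) ^ n * exp (- (1 / y)) = flat n y"
    using eventually_nhds_in_open[of "{0<..}" x] assms
    by (auto simp: flat_def elim: eventually_mono)
qed

text \<open>This is the difference quotient at 0. From the right, t = 1 / x turns it into t^(n + 1)
  / exp t, which tends to 0; from the left it is identically 0.\<close>

lemma flat_div_tendsto: "((\<lambda>x. flat n x / x) \<longlongrightarrow> 0) (at 0)"
proof -
  have r: "((\<lambda>x. flat n x / x) \<longlongrightarrow> 0) (at_right 0)"
  proof (rule tendsto_cong[THEN iffD1])
    have "((\<lambda>t::real. t ^ Suc n / exp t) \<longlongrightarrow> 0) at_top" by (rule tendsto_power_div_exp_0)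
    then have "((\<lambda>x::real. (inverse x) ^ Suc n / exp (inverse x)) \<longlongrightarrow> 0) (at_right 0)"
      by (rule filterlim_compose[OF _ filterlim_inverse_at_top_right])
    then show "((\<lambda>x::real. (inverse x) ^ Suc n / exp (inverse x)) \<longlongrightarrow> 0) (at_right 0)" .
    show "\<forall>\<^sub>F x in at_right 0. (inverse x) ^ Suc n / exp (inverse x) = flat n x / x"
      using eventually_at_right_less[of "0::real"]
      by eventually_elim (simp add: flat_def divide_inverse exp_minus mult_ac)
  qed
  have l: "((\<lambda>x. flat n x / x) \<longlongrightarrow> 0) (at_left 0)"
  proof (rule tendsto_cong[THEN iffD1])
    show "((\<lambda>x::real. 0::real) \<longlongrightarrow> 0) (at_left 0)" by simp
    have "\<forall>\<^sub>F x::real in at_left 0. x < 0" by (simp add: eventually_at_filter)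
    then show "\<forall>\<^sub>F x in at_left 0. 0 = flat n x / x"
      by eventually_elim (simp add: flat_def)
  qed
  show ?thesis using l r by (simp add: filterlim_split_at_real)
qed

lemma flat_deriv: "(flat n has_real_derivative (flat (n + 2) x - real n * flat (n + 1) x)) (at x)"
proof -
  consider "x > 0" | "x < 0" | "x = 0" by linarith
  then show ?thesis
  proof cases
    case 1
    then show ?thesis by (rule flat_pos_deriv)
  next
    case 2
    have "((\<lambda>_. 0) has_real_derivative 0) (at x)" by simp
    moreover have "\<forall>\<^sub>F y in nhds x. 0 = flat n y"
      using eventually_nhds_in_open[of "{..<0}" x] 2
      by (auto simp: flat_def elim!: eventually_mono)
    ultimately have "(flat n has_real_derivative 0) (at x)"
      by (rule has_real_derivative_transform_at)
    then show ?thesis using 2 by (simp add: flat_def)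
  next
    case 3
    then show ?thesis using flat_div_tendsto[of n]
      by (simp add: has_field_derivative_iff flat_def)
  qed
qed

lemma smooth_flat: "smooth (flat n)"
proof (rule smooth_coinduct)
  let ?X = "{f. \<exists>N c. f = (\<lambda>x. \<Sum>i<N. c i * flat i x)}"
  show "flat n \<in> ?X"
    by (intro CollectI exI[of _ "Suc n"] exI[of _ "\<lambda>i. if i = n then 1 else 0"]) (simp add: fun_eq_iff)
  fix f assume "f \<in> ?X"
  then obtain N c where f: "f = (\<lambda>x. \<Sum>i<N. c i * flat i x)" by blast
  have d: "(f has_real_derivative (\<Sum>i<N. c i * (flat (i + 2) x - real i * flat (i + 1) x))) (at x)" for x
    unfolding f by (intro DERIV_sum DERIV_cmult flat_deriv)
  have "\<exists>M e. \<forall>x. (\<Sum>i<N. c i * (flat (i + 2) x - real i * flat (i + 1) x)) = (\<Sum>i<M. e i * flat i x)"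
  proof (induction N)
    case (Suc N)
    then obtain M e where e: "\<And>x. (\<Sum>i<N. c i * (flat (i + 2) x - real i * flat (i + 1) x)) = (\<Sum>i<M. e i * flat i x)"
      by blast
    define L where "L = max M (N + 3)"
    \<comment> \<open>The old coefficients plus the two contributions of differentiating the N-th
      summand; \<open>L\<close> exceeds every index that occurs.\<close>
    define e' where "e' i = (if i < M then e i else 0) + (if i = N + 2 then c N else 0)
      + (if i = N + 1 then - c N * real N else 0)" for i
    have "(\<Sum>i<L. (if i < M then e i else 0) * flat i x) = (\<Sum>i<M. e i * flat i x)" for x
      by (rule sum.mono_neutral_cong_right) (auto simp: L_def)
    moreover have "(\<Sum>i<L. (if i = j then t else 0) * flat i x) = t * flat j x" if "j < L" for j t x
      using that by (simp add: if_distrib[of "\<lambda>t. t * _"] cong: if_cong)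
    moreover have "N + 2 < L" "N + 1 < L" by (auto simp: L_def)
    ultimately have "(\<Sum>i<L. e' i * flat i x) = (\<Sum>i<M. e i * flat i x) + c N * flat (N + 2) x + (- c N * real N) * flat (N + 1) x" for x
      unfolding e'_def distrib_right sum.distrib by presburger
    then have "\<forall>x. (\<Sum>i<Suc N. c i * (flat (i + 2) x - real i * flat (i + 1) x)) = (\<Sum>i<L. e' i * flat i x)"
      using e by (simp add: algebra_simps)
    then show ?case by blast
  qed (auto intro!: exI[of _ 0])
  then show "(\<forall>x. f differentiable (at x)) \<and> deriv f \<in> ?X"
    using d DERIV_imp_deriv[OF d]
    by (auto simp: fun_eq_iff intro: real_differentiable_def[THEN iffD2])
qed

text \<open>A smooth transition, 0 to the left of 0 and 1 to the right of 1. The denominator is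
  positive because x and 1 - x are never both nonpositive.\<close>

definition step :: "real \<Rightarrow> real" where
  "step x = flat 0 x / (flat 0 x + flat 0 (1 - x))"

lemma flat_nonneg: "0 \<le> flat n x"
  by (simp add: flat_def)

lemma flat_pos: "0 < x \<Longrightarrow> 0 < flat n x"
  by (simp add: flat_def)

lemma step_denominator_pos: "0 < flat 0 x + flat 0 (1 - x)"
proof (cases "x > 0")
  case True
  then show ?thesis using flat_pos[of x 0] flat_nonneg[of 0 "1 - x"] by linarith
next
  case False
  then show ?thesis using flat_pos[of "1 - x" 0] flat_nonneg[of 0 x] by linarith
qed

lemma smooth_step: "smooth step"
proof -
  have "smooth (\<lambda>x. flat 0 (1 - x))" using smooth_affine[OF smooth_flat[of 0], of "-1" 1] by simp
  then have "smooth (\<lambda>x. flat 0 x / (flat 0 x + flat 0 (1 - x)))"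
    using step_denominator_pos by (intro smooth_divide smooth_add smooth_flat) (auto simp: less_imp_neq[symmetric])
  moreover have "step = (\<lambda>x. flat 0 x / (flat 0 x + flat 0 (1 - x)))" by (simp add: step_def fun_eq_iff)
  ultimately show ?thesis by simp
qed

lemma step_eq_0: "x \<le> 0 \<Longrightarrow> step x = 0" and step_eq_1: "1 \<le> x \<Longrightarrow> step x = 1"
  by (auto simp: step_def flat_def)

lemma step_nonneg: "0 \<le> step x" and step_le_1: "step x \<le> 1"
  using step_denominator_pos[of x] flat_nonneg[of 0 x] flat_nonneg[of 0 "1 - x"]
  by (auto simp: step_def)

lemma deriv_eq_0_if_locally_const:
  assumes "open U" "x \<in> U" "\<And>y. y \<in> U \<Longrightarrow> f y = c"
  shows "deriv f x = (0::real)"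
proof -
  have "((\<lambda>_. c) has_real_derivative 0) (at x)" by simp
  moreover have "\<forall>\<^sub>F y in nhds x. c = f y"
    using eventually_nhds_in_open[OF assms(1,2)] assms(3) by (auto elim!: eventually_mono)
  ultimately show ?thesis by (rule DERIV_imp_deriv[OF has_real_derivative_transform_at])
qed

lemma step_deriv_bounded: obtains C where "0 < C" "\<And>x. \<bar>deriv step x\<bar> \<le> C"
proof -
  have "compact (deriv step ` {0..1})"
    by (intro compact_continuous_image smooth_continuous_on smooth_deriv smooth_step) auto
  then obtain C where C: "\<And>x. x \<in> {0..1} \<Longrightarrow> \<bar>deriv step x\<bar> \<le> C"
    unfolding compact_eq_bounded_closed bounded_iff by (metis image_eqI real_norm_def)
  have "deriv step x = 0" if "x \<notin> {0..1}" for x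
  proof (cases "x < 0")
    case True
    then show ?thesis by (intro deriv_eq_0_if_locally_const[of "{..<0}" x step 0]) (auto simp: step_eq_0)
  next
    case False
    then show ?thesis using that
      by (intro deriv_eq_0_if_locally_const[of "{1<..}" x step 1]) (auto simp: step_eq_1)
  qed
  then have "\<bar>deriv step x\<bar> \<le> max C 1" for x
    using C[of x] by (cases "x \<in> {0..1}") auto
  then show ?thesis using that[of "max C 1"] by simp
qed

section \<open>Test functions, cut-offs and plateaus\<close>

lemma test_fun_smooth: "test_fun f \<Longrightarrow> smooth f"
  by (simp add: test_fun_def)

lemma test_funI:
  assumes "smooth f" "\<And>x. x \<notin> {a..b} \<Longrightarrow> f x = 0"
  shows "test_fun f"
proof -
  have "closure {x. f x \<noteq> 0} \<subseteq> {a..b}"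
    by (rule closure_minimal) (use assms(2) in force)+
  then show ?thesis
    using assms(1) bounded_subset[OF bounded_closed_interval[of a b]]
    by (auto simp: test_fun_def compact_eq_bounded_closed)
qed

lemma test_funE:
  assumes "test_fun f"
  obtains T where "0 < T" "\<And>x. T \<le> \<bar>x\<bar> \<Longrightarrow> f x = 0"
proof -
  have "bounded {x. f x \<noteq> 0}"
    by (rule bounded_subset[OF compact_imp_bounded closure_subset]) (use assms in \<open>simp add: test_fun_def\<close>)
  then obtain B where B: "\<And>x. f x \<noteq> 0 \<Longrightarrow> \<bar>x\<bar> \<le> B" by (auto simp: bounded_iff)
  show ?thesis
    by (rule that[of "max B 0 + 1"]) (use B in force)+
qed

lemma test_funI':
  assumes "smooth f" "\<And>x. T \<le> \<bar>x\<bar> \<Longrightarrow> f x = 0"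
  shows "test_fun f"
  by (rule test_funI[of f "-T" T]) (use assms in auto)

lemma test_fun_deriv:
  assumes "test_fun f" shows "test_fun (deriv f)"
proof -
  obtain T where T: "\<And>x. T \<le> \<bar>x\<bar> \<Longrightarrow> f x = 0" using test_funE[OF assms] by metis
  show ?thesis
  proof (rule test_funI')
    fix x assume "T + 1 \<le> \<bar>x\<bar>"
    then show "deriv f x = 0"
      by (intro deriv_eq_0_if_locally_const[of "{y. T < \<bar>y\<bar>}" x f 0])
        (auto simp: T intro!: open_Collect_less continuous_intros)
  qed (use assms test_fun_smooth smooth_deriv in blast)
qed

lemma test_fun_mult_smooth:
  assumes "test_fun f" "smooth g" shows "test_fun (\<lambda>x. g x * f x)"
proof -
  obtain T where T: "\<And>x. T \<le> \<bar>x\<bar> \<Longrightarrow> f x = 0" using test_funE[OF assms(1)] by metis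
  show ?thesis
    by (rule test_funI'[of _ T]) (use assms T in \<open>auto intro: smooth_mult test_fun_smooth\<close>)
qed

lemma test_fun_scale: "test_fun f \<Longrightarrow> test_fun (\<lambda>x. c * f x)"
  by (rule test_fun_mult_smooth[OF _ smooth_const])

lemma test_fun_add:
  assumes "test_fun f" "test_fun g" shows "test_fun (\<lambda>x. f x + g x)"
proof -
  obtain T where T: "\<And>x. T \<le> \<bar>x\<bar> \<Longrightarrow> f x = 0" using test_funE[OF assms(1)] by metis
  obtain T' where T': "\<And>x. T' \<le> \<bar>x\<bar> \<Longrightarrow> g x = 0" using test_funE[OF assms(2)] by metis
  show ?thesis
    by (rule test_funI'[of _ "max T T'"]) (use assms T T' in \<open>auto intro: smooth_add test_fun_smooth\<close>)
qed

lemma test_fun_uminus: "test_fun f \<Longrightarrow> test_fun (\<lambda>x. - f x)"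
  using test_fun_scale[of f "-1"] by simp

lemma test_fun_diff: "test_fun f \<Longrightarrow> test_fun g \<Longrightarrow> test_fun (\<lambda>x. f x - g x)"
  using test_fun_add[of f "\<lambda>x. - g x"] test_fun_uminus[of g] by simp

lemma test_fun_zero: "test_fun (\<lambda>_. 0)"
  by (rule test_funI'[OF smooth_const]) simp

lemma test_fun_bounded:
  assumes "test_fun f" obtains B where "0 < B" "\<And>x. \<bar>f x\<bar> \<le> B"
proof -
  obtain T where T: "\<And>x. T \<le> \<bar>x\<bar> \<Longrightarrow> f x = 0" using test_funE[OF assms] by metis
  have "compact (f ` {-T..T})"
    by (intro compact_continuous_image smooth_continuous_on test_fun_smooth assms) auto
  then obtain C where C: "\<And>x. x \<in> {-T..T} \<Longrightarrow> \<bar>f x\<bar> \<le> C"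
    unfolding compact_eq_bounded_closed bounded_iff by (metis image_eqI real_norm_def)
  have "\<bar>f x\<bar> \<le> max C 1" for x
    using C[of x] T[of x] by (cases "x \<in> {-T..T}") auto
  then show ?thesis using that[of "max C 1"] by simp
qed

text \<open>Equal to 1 for |x| \<le> n + 1 and to 0 for |x| \<ge> 2 (n + 1). Stretching with n,
  instead of shifting a fixed edge, makes the derivative of order 1 / n. The successor avoids a
  division by zero.\<close>

definition cutoff :: "nat \<Rightarrow> real \<Rightarrow> real" where
  "cutoff n x = step (2 - x / real (Suc n)) * step (2 + x / real (Suc n))"

lemma smooth_cutoff: "smooth (cutoff n)"
proof -
  have "smooth (\<lambda>x. step ((- 1 / real (Suc n)) * x + 2) * step ((1 / real (Suc n)) * x + 2))"
    by (intro smooth_mult smooth_affine smooth_step)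
  moreover have "cutoff n = (\<lambda>x. step ((- 1 / real (Suc n)) * x + 2) * step ((1 / real (Suc n)) * x + 2))"
    by (simp add: cutoff_def fun_eq_iff algebra_simps)
  ultimately show ?thesis by simp
qed

lemma cutoff_nonneg: "0 \<le> cutoff n x" and cutoff_le_1: "cutoff n x \<le> 1"
  by (simp_all add: cutoff_def step_nonneg step_le_1 mult_le_one)

lemma cutoff_eq_1: "\<bar>x\<bar> \<le> real (Suc n) \<Longrightarrow> cutoff n x = 1"
  by (auto simp: cutoff_def abs_le_iff field_simps intro!: mult_eq_1_iff[THEN iffD2] simp flip: of_nat_Suc)
     (subst step_eq_1, auto simp: field_simps)+

lemma cutoff_eq_0: 
  assumes "2 * real (Suc n) \<le> \<bar>x\<bar>" shows "cutoff n x = 0"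
proof (cases "0 \<le> x")
  case True
  then have "2 - x / real (Suc n) \<le> 0" using assms by (simp add: field_simps)
  then show ?thesis by (simp add: cutoff_def step_eq_0)
next
  case False
  then have "2 + x / real (Suc n) \<le> 0" using assms by (simp add: field_simps)
  then show ?thesis by (simp add: cutoff_def step_eq_0)
qed

lemma test_fun_cutoff: "test_fun (cutoff n)"
  by (rule test_funI'[OF smooth_cutoff cutoff_eq_0])

lemma cutoff_tendsto: "(\<lambda>n. cutoff n x) \<longlonglongrightarrow> 1"
proof (rule tendsto_eventually)
  obtain N where "\<bar>x\<bar> \<le> real N" using real_arch_simple by blast
  then have "cutoff n x = 1" if "N \<le> n" for n using that by (intro cutoff_eq_1) simp
  then show "\<forall>\<^sub>F n in sequentially. cutoff n x = 1" by (rule eventually_sequentiallyI)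
qed

lemma cutoff_deriv_bound:
  obtains C where "0 < C" "\<And>n x. \<bar>deriv (cutoff n) x\<bar> \<le> C / real (Suc n)"
proof -
  obtain C where C: "0 < C" "\<And>x. \<bar>deriv step x\<bar> \<le> C" by (rule step_deriv_bounded) blast
  have "\<bar>deriv (cutoff n) x\<bar> \<le> (2 * C) / real (Suc n)" for n x
  proof -
    define N where "N = real (Suc n)"
    have N: "0 < N" by (simp add: N_def)
    let ?p = "2 - x / N" and ?q = "2 + x / N"
    have "((\<lambda>x. step (2 - x / N)) has_real_derivative (deriv step ?p * (- (1 / N)))) (at x)"
      by (rule DERIV_chain2[OF smooth_has_deriv[OF smooth_step]])
        (use N in \<open>auto intro!: derivative_eq_intros\<close>)
    moreover have "((\<lambda>x. step (2 + x / N)) has_real_derivative (deriv step ?q * (1 / N))) (at x)"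
      by (rule DERIV_chain2[OF smooth_has_deriv[OF smooth_step]])
        (use N in \<open>auto intro!: derivative_eq_intros\<close>)
    ultimately have "((\<lambda>x. step (2 - x / N) * step (2 + x / N)) has_real_derivative
       (deriv step ?p * (- (1 / N)) * step ?q + deriv step ?q * (1 / N) * step ?p)) (at x)"
      by (rule DERIV_mult)
    moreover have "cutoff n = (\<lambda>x. step (2 - x / N) * step (2 + x / N))"
      by (simp add: cutoff_def N_def fun_eq_iff)
    ultimately have "deriv (cutoff n) x = deriv step ?p * (- (1 / N)) * step ?q + deriv step ?q * (1 / N) * step ?p"
      using DERIV_imp_deriv by simp
    also have "\<dots> = (deriv step ?q * step ?p - deriv step ?p * step ?q) / N"
      by (simp add: diff_divide_distrib mult_ac)
    finally have "\<bar>deriv (cutoff n) x\<bar> = \<bar>deriv step ?q * step ?p - deriv step ?p * step ?q\<bar> / N"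
      using N by simp
    moreover have b: "\<bar>deriv step y * step z\<bar> \<le> C" for y z
      using mult_mono[OF C(2)[of y], of "\<bar>step z\<bar>" 1] C(1) step_nonneg[of z] step_le_1[of z]
      by (simp add: abs_mult)
    have "\<bar>deriv step ?q * step ?p - deriv step ?p * step ?q\<bar> \<le> 2 * C"
      using abs_triangle_ineq4[of "deriv step ?q * step ?p" "deriv step ?p * step ?q"]
        b[of ?q ?p] b[of ?p ?q] by linarith
    ultimately show ?thesis
      unfolding N_def[symmetric] using N by (simp add: divide_right_mono)
  qed
  then show ?thesis using that[of "2 * C"] C(1) by simp
qed

text \<open>The edges outside [a, b] have width 1 / (n + 1), so the sequence tends pointwise to the
  indicator of the closed interval; with n = 0 it also serves as a single bump with edges of width
  one.\<close>

definition plateau :: "real \<Rightarrow> real \<Rightarrow> nat \<Rightarrow> real \<Rightarrow> real" where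
  "plateau a b n x = step (real (Suc n) * (x - a) + 1) * step (real (Suc n) * (b - x) + 1)"

lemma test_fun_plateau: "test_fun (plateau a b n)"
proof (rule test_funI[of _ "a - 1" "b + 1"])
  have "smooth (\<lambda>x. step (real (Suc n) * x + (1 - real (Suc n) * a)) * step ((- real (Suc n)) * x + (1 + real (Suc n) * b)))"
    by (intro smooth_mult smooth_affine smooth_step)
  moreover have "plateau a b n = (\<lambda>x. step (real (Suc n) * x + (1 - real (Suc n) * a)) * step ((- real (Suc n)) * x + (1 + real (Suc n) * b)))"
    by (simp add: plateau_def fun_eq_iff algebra_simps)
  ultimately show "smooth (plateau a b n)" by simp
  fix x assume "x \<notin> {a - 1..b + 1}"
  then consider "x < a - 1" | "x > b + 1" by fastforce
  then show "plateau a b n x = 0"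
  proof cases
    case 1
    have "real (Suc n) * (x - a) + 1 \<le> 0"
      using mult_left_mono[of "x - a" "-1" "real (Suc n)"] 1 by simp
    then show ?thesis by (simp add: plateau_def step_eq_0)
  next
    case 2
    have "real (Suc n) * (b - x) + 1 \<le> 0"
      using mult_left_mono[of "b - x" "-1" "real (Suc n)"] 2 by simp
    then show ?thesis by (simp add: plateau_def step_eq_0)
  qed
qed

lemma plateau_nonneg: "0 \<le> plateau a b n x" and plateau_le_1: "plateau a b n x \<le> 1"
  by (simp_all add: plateau_def step_nonneg step_le_1 mult_le_one)

lemma plateau_eq_1: "x \<in> {a..b} \<Longrightarrow> plateau a b n x = 1"
  by (simp add: plateau_def step_eq_1)

lemma plateau_eq_0_left: 
  assumes "x \<le> a - 1 / real (Suc n)" shows "plateau a b n x = 0"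
proof -
  have "real (Suc n) * (x - a) + 1 \<le> 0" using assms by (simp add: field_simps)
  then show ?thesis by (simp add: plateau_def step_eq_0)
qed

lemma plateau_eq_0_right: 
  assumes "b + 1 / real (Suc n) \<le> x" shows "plateau a b n x = 0"
proof -
  have "real (Suc n) * (b - x) + 1 \<le> 0" using assms by (simp add: field_simps)
  then show ?thesis by (simp add: plateau_def step_eq_0)
qed

lemma plateau_tendsto: "(\<lambda>n. plateau a b n x) \<longlonglongrightarrow> indicat_real {a..b} x"
proof (cases "x \<in> {a..b}")
  case True
  then show ?thesis by (simp add: plateau_eq_1)
next
  case False
  define d where "d = max (a - x) (x - b)"
  have d: "0 < d" using False by (auto simp: d_def)
  have "(\<lambda>n. 1 / real (Suc n)) \<longlonglongrightarrow> 0" using LIMSEQ_inverse_real_of_nat by (simp add: inverse_eq_divide)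
  then have "\<forall>\<^sub>F n in sequentially. 1 / real (Suc n) < d" using d by (rule order_tendstoD(2))
  then have "\<forall>\<^sub>F n in sequentially. plateau a b n x = 0"
  proof eventually_elim
    fix n assume n: "1 / real (Suc n) < d"
    show "plateau a b n x = 0"
    proof (cases "1 / real (Suc n) < a - x")
      case True
      then show ?thesis by (intro plateau_eq_0_left) simp
    next
      case False
      then have "1 / real (Suc n) < x - b" using n by (simp add: d_def)
      then show ?thesis by (intro plateau_eq_0_right) simp
    qed
  qed
  then show ?thesis using False by (simp add: tendsto_eventually)
qed

section \<open>Density of test functions\<close>

text \<open>The limit is bounded by the same d, hence the squared difference by (2 d)^2, and
  dominated convergence applies to the squares.\<close>

lemma L2_dominated_convergence:
  assumes f: "\<And>n. f n \<in> borel_measurable M" and g: "g \<in> borel_measurable M" and d: "d \<in> L2 M"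
    and lim: "AE x in M. (\<lambda>n. f n x) \<longlonglongrightarrow> g x" and bd: "\<And>n. AE x in M. \<bar>f n x\<bar> \<le> d x"
  shows "g \<in> L2 M" "\<And>n. f n \<in> L2 M" "(\<lambda>n. L2norm M (\<lambda>x. f n x - g x)) \<longlonglongrightarrow> 0"
proof -
  have bd': "AE x in M. \<forall>n. \<bar>f n x\<bar> \<le> d x" using bd by (simp add: AE_all_countable)
  have gd: "AE x in M. \<bar>g x\<bar> \<le> d x"
    using lim bd'
  proof eventually_elim
    fix x assume "(\<lambda>n. f n x) \<longlonglongrightarrow> g x" and *: "\<forall>n. \<bar>f n x\<bar> \<le> d x"
    then have "(\<lambda>n. \<bar>f n x\<bar>) \<longlonglongrightarrow> \<bar>g x\<bar>" by (intro tendsto_rabs)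
    then show "\<bar>g x\<bar> \<le> d x" using * by (intro LIMSEQ_le_const2) auto
  qed
  show gL: "g \<in> L2 M" by (rule L2_bounded_by[OF d g]) (use gd in eventually_elim, auto)
  show fL: "f n \<in> L2 M" for n by (rule L2_bounded_by[OF d f]) (use bd[of n] in eventually_elim, auto)
  have "(\<lambda>n. \<integral>x. (f n x - g x)\<^sup>2 \<partial>M) \<longlonglongrightarrow> (\<integral>x. 0 \<partial>M)"
  proof (rule integral_dominated_convergence)
    show "integrable M (\<lambda>x. (2 * d x)\<^sup>2)" by (intro L2_square_integrable L2_scale d)
    show "AE x in M. (\<lambda>n. (f n x - g x)\<^sup>2) \<longlonglongrightarrow> 0"
      using lim
    proof eventually_elim
      fix x assume "(\<lambda>n. f n x) \<longlonglongrightarrow> g x"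
      then have "(\<lambda>n. (f n x - g x)\<^sup>2) \<longlonglongrightarrow> (g x - g x)\<^sup>2" by (intro tendsto_intros)
      then show "(\<lambda>n. (f n x - g x)\<^sup>2) \<longlonglongrightarrow> 0" by simp
    qed
    show "AE x in M. norm ((f n x - g x)\<^sup>2) \<le> (2 * d x)\<^sup>2" for n
      using bd[of n] gd
    proof eventually_elim
      fix x assume "\<bar>f n x\<bar> \<le> d x" "\<bar>g x\<bar> \<le> d x"
      then have "\<bar>f n x - g x\<bar> \<le> \<bar>2 * d x\<bar>" by linarith
      then show "norm ((f n x - g x)\<^sup>2) \<le> (2 * d x)\<^sup>2" by (simp add: abs_le_square_iff)
    qed
  qed (use f g in measurable)
  then have "(\<lambda>n. sqrt (\<integral>x. (f n x - g x)\<^sup>2 \<partial>M)) \<longlonglongrightarrow> sqrt 0"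
    by (intro tendsto_real_sqrt) simp
  then show "(\<lambda>n. L2norm M (\<lambda>x. f n x - g x)) \<longlonglongrightarrow> 0" by (simp add: L2norm_def)
qed

lemma L2_bounded:
  assumes "finite_measure M" "f \<in> borel_measurable M" "\<And>x. \<bar>f x\<bar> \<le> B"
  shows "f \<in> L2 M"
  by (rule L2_bounded_by[OF L2_const[OF assms(1), of B] assms(2)]) (use assms(3) in \<open>auto intro!: AE_I2 order_trans[OF _ abs_ge_self]\<close>)

lemma L2norm_bounded:
  assumes fin: "finite_measure M" and f: "f \<in> borel_measurable M" and B: "\<And>x. \<bar>f x\<bar> \<le> B"
  shows "L2norm M f \<le> B * sqrt (measure M (space M))"
proof -
  have B0: "0 \<le> B" using B[of undefined] abs_ge_zero order_trans by blast
  have "L2norm M f \<le> L2norm M (\<lambda>_. B)"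
    by (rule L2norm_mono[OF L2_const[OF fin] L2_bounded[OF fin f B]])
      (use B in \<open>auto intro!: AE_I2 order_trans[OF _ abs_ge_self]\<close>)
  also have "\<dots> = B * sqrt (measure M (space M))"
    using B0 by (simp add: L2norm_def real_sqrt_mult)
  finally show ?thesis .
qed

text \<open>The closure of the test functions in L2, stated with \<epsilon> so that sums, multiples
  and limits compose without diagonal sequences.\<close>

definition test_limit :: "real measure \<Rightarrow> (real \<Rightarrow> real) \<Rightarrow> bool" where
  "test_limit M f \<longleftrightarrow> f \<in> L2 M \<and> (\<forall>\<epsilon>>0. \<exists>\<phi>. test_fun \<phi> \<and> L2norm M (\<lambda>x. \<phi> x - f x) < \<epsilon>)"

context
  fixes M :: "real measure"
  assumes fin: "finite_measure M" and sets_M: "sets M = sets borel"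
begin

lemma test_fun_measurable_M: "test_fun f \<Longrightarrow> f \<in> borel_measurable M"
  using smooth_measurable[OF test_fun_smooth] measurable_cong_sets[OF sets_M refl] by blast

lemma test_fun_L2: "test_fun f \<Longrightarrow> f \<in> L2 M"
  by (metis test_fun_bounded L2_bounded[OF fin] test_fun_measurable_M)

lemma test_limit_add:
  assumes "test_limit M f" "test_limit M g"
  shows "test_limit M (\<lambda>x. f x + g x)"
  unfolding test_limit_def
proof (intro conjI allI impI)
  have f: "f \<in> L2 M" and g: "g \<in> L2 M" using assms by (auto simp: test_limit_def)
  then show "(\<lambda>x. f x + g x) \<in> L2 M" by (rule L2_add)
  fix \<epsilon> :: real assume "0 < \<epsilon>"
  then have "0 < \<epsilon> / 2" by simp
  then obtain \<phi> \<psi> where p: "test_fun \<phi>" "L2norm M (\<lambda>x. \<phi> x - f x) < \<epsilon> / 2"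
    "test_fun \<psi>" "L2norm M (\<lambda>x. \<psi> x - g x) < \<epsilon> / 2"
    using assms unfolding test_limit_def by metis
  have "L2norm M (\<lambda>x. (\<phi> x - f x) + (\<psi> x - g x)) < \<epsilon>"
    using L2norm_triangle[OF L2_diff[OF test_fun_L2[OF p(1)] f] L2_diff[OF test_fun_L2[OF p(3)] g]] p
    by linarith
  then show "\<exists>\<phi>. test_fun \<phi> \<and> L2norm M (\<lambda>x. \<phi> x - (f x + g x)) < \<epsilon>"
    using p by (intro exI[of _ "\<lambda>x. \<phi> x + \<psi> x"]) (auto simp: algebra_simps intro: test_fun_add)
qed

lemma test_limit_zero: "test_limit M (\<lambda>_. 0)"
  unfolding test_limit_def
  by (auto simp: L2_zero L2norm_def intro!: exI[of _ "\<lambda>_. 0"] test_fun_zero)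

lemma test_limit_scale:
  assumes "test_limit M f"
  shows "test_limit M (\<lambda>x. c * f x)"
proof (cases "c = 0")
  case True
  then show ?thesis using test_limit_zero by simp
next
  case False
  have f: "f \<in> L2 M" using assms by (auto simp: test_limit_def)
  show ?thesis
    unfolding test_limit_def
  proof (intro conjI allI impI)
    show "(\<lambda>x. c * f x) \<in> L2 M" using f by (rule L2_scale)
    fix \<epsilon> :: real assume "0 < \<epsilon>"
    then have "0 < \<epsilon> / \<bar>c\<bar>" using False by simp
    then obtain \<phi> where p: "test_fun \<phi>" "L2norm M (\<lambda>x. \<phi> x - f x) < \<epsilon> / \<bar>c\<bar>"
      using assms unfolding test_limit_def by metis
    have "L2norm M (\<lambda>x. c * \<phi> x - c * f x) = \<bar>c\<bar> * L2norm M (\<lambda>x. \<phi> x - f x)"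
      using L2norm_scale[of M c "\<lambda>x. \<phi> x - f x"] by (simp add: right_diff_distrib)
    also have "\<dots> < \<epsilon>" using p(2) False by (simp add: field_simps)
    finally show "\<exists>\<phi>. test_fun \<phi> \<and> L2norm M (\<lambda>x. \<phi> x - c * f x) < \<epsilon>"
      using p by (intro exI[of _ "\<lambda>x. c * \<phi> x"]) (auto intro: test_fun_scale)
  qed
qed

lemma test_limit_sum:
  "(\<And>i. i \<in> I \<Longrightarrow> test_limit M (f i)) \<Longrightarrow> test_limit M (\<lambda>x. \<Sum>i\<in>I. f i x)"
  by (induction I rule: infinite_finite_induct) (auto intro: test_limit_add test_limit_zero)

lemma test_limit_diff: "test_limit M f \<Longrightarrow> test_limit M g \<Longrightarrow> test_limit M (\<lambda>x. f x - g x)"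
  using test_limit_add[of f "\<lambda>x. -1 * g x"] test_limit_scale[of g "-1"] by simp

lemma test_limit_LIMSEQ:
  assumes f: "\<And>n. test_limit M (f n)" and g: "g \<in> L2 M"
    and lim: "(\<lambda>n. L2norm M (\<lambda>x. f n x - g x)) \<longlonglongrightarrow> 0"
  shows "test_limit M g"
  unfolding test_limit_def
proof (intro conjI allI impI)
  fix \<epsilon> :: real assume e: "0 < \<epsilon>"
  then have "\<forall>\<^sub>F n in sequentially. L2norm M (\<lambda>x. f n x - g x) < \<epsilon> / 2"
    using order_tendstoD(2)[OF lim, of "\<epsilon> / 2"] by simp
  then obtain n where n: "L2norm M (\<lambda>x. f n x - g x) < \<epsilon> / 2"
    using eventually_happens'[OF sequentially_bot] by blast
  have "0 < \<epsilon> / 2" using e by simp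
  then obtain \<phi> where p: "test_fun \<phi>" "L2norm M (\<lambda>x. \<phi> x - f n x) < \<epsilon> / 2"
    using f[of n] unfolding test_limit_def by metis
  have fn: "f n \<in> L2 M" using f by (simp add: test_limit_def)
  have "L2norm M (\<lambda>x. \<phi> x - g x) < \<epsilon>"
    using L2norm_triangle_mid[OF test_fun_L2[OF p(1)] fn g] p n by linarith
  then show "\<exists>\<phi>. test_fun \<phi> \<and> L2norm M (\<lambda>x. \<phi> x - g x) < \<epsilon>" using p by blast
qed (rule g)

lemma test_limit_test_fun: "test_fun f \<Longrightarrow> test_limit M f"
  unfolding test_limit_def by (auto simp: test_fun_L2 L2norm_def intro!: exI[of _ f])

lemma test_limit_pointwise:
  assumes "\<And>n. test_limit M (f n)" "g \<in> borel_measurable M" "\<And>x. (\<lambda>n. f n x) \<longlonglongrightarrow> g x"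
    "\<And>n x. \<bar>f n x\<bar> \<le> B"
  shows "test_limit M g"
proof -
  have fm: "f n \<in> borel_measurable M" for n using assms(1) L2_measurable by (auto simp: test_limit_def)
  note D = L2_dominated_convergence[of f, OF fm assms(2) L2_const[OF fin, of B]]
  show ?thesis
    by (rule test_limit_LIMSEQ[OF assms(1) D(1) D(3)]) (use assms in auto)
qed

text \<open>Dynkin's argument with the closed intervals as stable generator. Intervals are limits of
  \<open>plateau\<close>, complements use that the constant 1 is a limit of cut-offs, and disjoint
  unions are bounded limits of finite sums of indicators.\<close>

lemma test_limit_indicator:
  assumes "A \<in> sets borel"
  shows "test_limit M (indicat_real A)"
proof -
  let ?G = "range (\<lambda>(a, b). {a..b::real})"
  have borel: "sets borel = sigma_sets UNIV ?G"
    by (subst borel_eq_atLeastAtMost) simp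
  have one: "test_limit M (\<lambda>_. 1)"
    by (rule test_limit_pointwise[OF test_limit_test_fun[OF test_fun_cutoff] _ cutoff_tendsto, of 1])
      (auto simp: cutoff_nonneg cutoff_le_1 abs_of_nonneg)
  have "Int_stable ?G"
    by (auto simp: Int_stable_def)
  moreover have "?G \<subseteq> Pow UNIV" by simp
  moreover have "A \<in> sigma_sets UNIV ?G" using assms borel by simp
  ultimately show ?thesis
  proof (induction rule: sigma_sets_induct_disjoint)
    case (basic A)
    then obtain a b where A: "A = {a..b}" by auto
    show ?case unfolding A
      by (rule test_limit_pointwise[OF test_limit_test_fun[OF test_fun_plateau] _ plateau_tendsto, of _ _ 1])
        (auto simp: plateau_nonneg plateau_le_1 abs_of_nonneg sets_M intro!: borel_measurable_indicator)
  next
    case empty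
    then show ?case using test_limit_zero by simp
  next
    case (compl A)
    have "indicat_real (UNIV - A) = (\<lambda>x. 1 - indicat_real A x)"
      by (auto simp: fun_eq_iff indicator_def)
    then show ?case using test_limit_diff[OF one compl(2)] by simp
  next
    case (union A)
    have A: "A i \<in> sets M" for i using union(2) borel sets_M by auto
    have eq: "(\<Sum>i<n. indicat_real (A i) x) = indicat_real (\<Union>i<n. A i) x" for n x
      using union(1) by (subst indicator_UN_disjoint) (auto simp: disjoint_family_on_def)
    show ?case
    proof (rule test_limit_pointwise[where B=1])
      show "test_limit M (\<lambda>x. \<Sum>i<n. indicat_real (A i) x)" for n
        using union(3) by (intro test_limit_sum)
      show "indicat_real (\<Union>i. A i) \<in> borel_measurable M"
        using A by (intro borel_measurable_indicator) auto
      show "\<bar>\<Sum>i<n. indicat_real (A i) x\<bar> \<le> 1" for n x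
        unfolding eq by (simp add: indicator_def)
      show "(\<lambda>n. \<Sum>i<n. indicat_real (A i) x) \<longlonglongrightarrow> indicat_real (\<Union>i. A i) x" for x
        unfolding eq by (rule LIMSEQ_indicator_UN)
    qed
  qed
qed

text \<open>Simple functions reduce density to indicators; the approximating sequence satisfies |F
  i| \<le> 2 |f|, which supplies the dominating function.\<close>

lemma test_fun_dense:
  assumes f: "f \<in> L2 M" and e: "0 < \<epsilon>"
  obtains \<phi> where "test_fun \<phi>" "L2norm M (\<lambda>x. \<phi> x - f x) < \<epsilon>"
proof -
  obtain F where F: "\<And>i. simple_function M (F i)"
    and lim: "\<And>x. x \<in> space M \<Longrightarrow> (\<lambda>i. F i x) \<longlonglongrightarrow> f x"
    and bd: "\<And>i x. x \<in> space M \<Longrightarrow> dist (F i x) 0 \<le> 2 * dist (f x) 0"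
    using borel_measurable_implies_sequence_metric[OF L2_measurable[OF f], of 0] by blast
  have Fm: "F i \<in> borel_measurable M" for i using F by (rule borel_measurable_simple_function)
  have space: "space M = UNIV" using sets_eq_imp_space_eq[OF sets_M] by simp
  have "test_limit M (F i)" for i
  proof -
    have fin_im: "finite (F i ` UNIV)" using simple_functionD(1)[OF F[of i]] by (simp add: space)
    have set: "F i -` {y} \<in> sets borel" for y
      using simple_functionD(2)[OF F[of i], of "{y}"] by (simp add: space sets_M)
    have "F i = (\<lambda>x. \<Sum>y\<in>F i ` UNIV. y * indicat_real (F i -` {y}) x)"
    proof
      fix x
      have "(\<Sum>y\<in>F i ` UNIV. y * indicat_real (F i -` {y}) x) = (\<Sum>y\<in>F i ` UNIV. if y = F i x then y else 0)"
        by (intro sum.cong) (auto simp: indicator_def)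
      then show "F i x = (\<Sum>y\<in>F i ` UNIV. y * indicat_real (F i -` {y}) x)"
        using fin_im by simp
    qed
    then show ?thesis
      using test_limit_sum[of "F i ` UNIV" "\<lambda>y x. y * indicat_real (F i -` {y}) x"]
        test_limit_scale[OF test_limit_indicator[OF set]] by simp
  qed
  moreover note D = L2_dominated_convergence[OF Fm L2_measurable[OF f] L2_scale[OF L2_abs[OF f], of 2]]
  have "(\<lambda>n. L2norm M (\<lambda>x. F n x - f x)) \<longlonglongrightarrow> 0"
    by (rule D(3)) (use lim bd in \<open>auto simp: space\<close>)
  ultimately have "test_limit M f" by (rule test_limit_LIMSEQ[OF _ f])
  then show ?thesis using e that unfolding test_limit_def by blast
qed

lemma test_fun_dense_sequence:
  assumes f: "f \<in> L2 M"
  obtains \<phi> where "\<And>k. test_fun (\<phi> k)" "(\<lambda>k. L2norm M (\<lambda>x. \<phi> k x - f x)) \<longlonglongrightarrow> 0"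
proof -
  have "\<exists>\<phi>. test_fun \<phi> \<and> L2norm M (\<lambda>x. \<phi> x - f x) < 1 / real (Suc k)" for k
    by (rule test_fun_dense[OF f, of "1 / real (Suc k)"]) auto
  then obtain \<phi> where p: "\<And>k. test_fun (\<phi> k)" "\<And>k. L2norm M (\<lambda>x. \<phi> k x - f x) < 1 / real (Suc k)"
    by metis
  have "(\<lambda>k. 1 / real (Suc k)) \<longlonglongrightarrow> 0" using LIMSEQ_inverse_real_of_nat by (simp add: inverse_eq_divide)
  then have "(\<lambda>k. L2norm M (\<lambda>x. \<phi> k x - f x)) \<longlonglongrightarrow> 0"
    by (rule Lim_null_comparison[rotated]) (use p(2) in \<open>auto intro!: always_eventually less_imp_le\<close>)
  then show ?thesis using that p(1) by blast
qed

end

section \<open>The derivative and its formal adjoint on a weighted line\<close>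

lemma smooth_antiderivative_exists:
  assumes "smooth f"
  obtains F where "smooth F" "\<And>x. (F has_real_derivative f x) (at x)"
proof -
  have "\<exists>F. \<forall>x::real. -\<infinity> < ereal x \<longrightarrow> ereal x < \<infinity> \<longrightarrow> (F has_vector_derivative f x) (at x)"
    by (rule einterval_antiderivative) (use assms smooth_isCont in auto)
  then obtain F where F: "\<And>x. (F has_real_derivative f x) (at x)"
    by (auto simp: has_real_derivative_iff_has_vector_derivative)
  then show ?thesis using that smooth_antideriv[OF F assms] by blast
qed

lemma integral_deriv_Iic:
  fixes g g' :: "real \<Rightarrow> real"
  assumes d: "\<And>x. (g has_real_derivative g' x) (at x)" and c: "\<And>x. isCont g' x"
    and z: "\<And>x. T \<le> \<bar>x\<bar> \<Longrightarrow> g x = 0" "\<And>x. T \<le> \<bar>x\<bar> \<Longrightarrow> g' x = 0"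
  shows "(\<integral>y. indicator {..x} y * g' y \<partial>lborel) = g x"
\<comment> \<open>\<open>T\<close> may have either sign; \<open>-\<bar>T\<bar>\<close> is a point
  from which g is known to vanish to the left.\<close>
proof (cases "-\<bar>T\<bar> \<le> x")
  case True
  have "(\<integral>y. indicator {..x} y * g' y \<partial>lborel) = (\<integral>y. g' y * indicator {-\<bar>T\<bar>..x} y \<partial>lborel)"
    by (rule Bochner_Integration.integral_cong) (use z(2) in \<open>auto simp: indicator_def\<close>)
  also have "\<dots> = g x - g (-\<bar>T\<bar>)"
    by (rule integral_FTC_Icc_real[OF True]) (use d c in auto)
  finally show ?thesis using z(1)[of "-\<bar>T\<bar>"] by simp
next
  case False
  then have zero: "g' y = 0" if "y \<le> x" for y using z(2)[of y] that by linarith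
  have "(\<integral>y. indicator {..x} y * g' y \<partial>lborel) = (\<integral>y. 0 \<partial>(lborel :: real measure))"
    by (rule Bochner_Integration.integral_cong) (auto simp: indicator_def zero)
  then show ?thesis using z(1)[of x] False by simp
qed

lemma integral_deriv_UNIV:
  fixes g g' :: "real \<Rightarrow> real"
  assumes d: "\<And>x. (g has_real_derivative g' x) (at x)" and c: "\<And>x. isCont g' x"
    and z: "\<And>x. T \<le> \<bar>x\<bar> \<Longrightarrow> g x = 0" "\<And>x. T \<le> \<bar>x\<bar> \<Longrightarrow> g' x = 0"
  shows "(\<integral>y. g' y \<partial>lborel) = 0"
proof -
  have "(\<integral>y. g' y \<partial>lborel) = (\<integral>y. indicator {..\<bar>T\<bar>} y * g' y \<partial>lborel)"
    by (rule Bochner_Integration.integral_cong) (use z(2) in \<open>auto simp: indicator_def\<close>)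
  also have "\<dots> = g \<bar>T\<bar>" by (rule integral_deriv_Iic[OF d c z])
  finally show ?thesis using z(1)[of "\<bar>T\<bar>"] by simp
qed

lemma test_fun_deriv_zero_bound:
  assumes "test_fun f"
  obtains T where "0 < T" "\<And>x. T \<le> \<bar>x\<bar> \<Longrightarrow> f x = 0" "\<And>x. T \<le> \<bar>x\<bar> \<Longrightarrow> deriv f x = 0"
proof -
  obtain T where T: "0 < T" "\<And>x. T \<le> \<bar>x\<bar> \<Longrightarrow> f x = 0" by (rule test_funE[OF assms]) blast
  obtain T' where T': "0 < T'" "\<And>x. T' \<le> \<bar>x\<bar> \<Longrightarrow> deriv f x = 0"
    by (rule test_funE[OF test_fun_deriv[OF assms]]) blast
  show ?thesis by (rule that[of "max T T'"]) (use T T' in auto)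
qed

lemma integral_test_deriv: "test_fun f \<Longrightarrow> (\<integral>y. deriv f y \<partial>lborel) = 0"
  by (rule test_fun_deriv_zero_bound, assumption)
    (rule integral_deriv_UNIV[of f], auto intro: smooth_has_deriv smooth_isCont smooth_deriv test_fun_smooth)

lemma integral_Iic_test_deriv: "test_fun f \<Longrightarrow> (\<integral>y. indicator {..x} y * deriv f y \<partial>lborel) = f x"
  by (rule test_fun_deriv_zero_bound, assumption)
    (rule integral_deriv_Iic[of f], auto intro: smooth_has_deriv smooth_isCont smooth_deriv test_fun_smooth)

lemma test_fun_integrable:
  assumes "test_fun f" shows "integrable lborel f"
proof -
  obtain T where T: "0 < T" "\<And>x. T \<le> \<bar>x\<bar> \<Longrightarrow> f x = 0" by (rule test_funE[OF assms]) blast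
  have "set_integrable lborel {-T..T} f"
    by (intro borel_integrable_atLeastAtMost' smooth_continuous_on test_fun_smooth assms)
  moreover have "(\<lambda>x. indicat_real {-T..T} x *\<^sub>R f x) = f"
  proof
    fix x show "indicat_real {-T..T} x *\<^sub>R f x = f x"
      using T(2)[of x] by (cases "T \<le> \<bar>x\<bar>") (auto simp: indicator_def)
  qed
  ultimately show ?thesis by (simp add: set_integrable_def)
qed

text \<open>Integral zero is exactly the condition for the primitive from the left end to vanish
  beyond the right end as well. The last two clauses say that no support is gained on either side;
  they keep later constructions inside a half-line.\<close>

lemma test_fun_antiderivative:
  assumes u: "test_fun u" and int: "(\<integral>x. u x \<partial>lborel) = 0"
  obtains g where "test_fun g" "deriv g = u" "\<And>x. (g has_real_derivative u x) (at x)"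
    "\<And>c x. (\<And>y. y \<le> c \<Longrightarrow> u y = 0) \<Longrightarrow> x \<le> c \<Longrightarrow> g x = 0"
    "\<And>c x. (\<And>y. c \<le> y \<Longrightarrow> u y = 0) \<Longrightarrow> c \<le> x \<Longrightarrow> g x = 0"
proof -
  obtain F where F: "smooth F" "\<And>x. (F has_real_derivative u x) (at x)"
    by (rule smooth_antiderivative_exists[OF test_fun_smooth[OF u]]) blast
  obtain T where T: "0 < T" "\<And>x. T \<le> \<bar>x\<bar> \<Longrightarrow> u x = 0" by (rule test_funE[OF u]) blast
  define g where "g = (\<lambda>x. F x - F (- T))"
  have g: "smooth g" unfolding g_def by (intro smooth_diff F(1) smooth_const)
  have d: "(g has_real_derivative u x) (at x)" for x
    unfolding g_def using F(2)[of x] by (auto intro!: derivative_eq_intros)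
  have const: "g p = g q" if "p \<le> q" "\<And>y. p \<le> y \<Longrightarrow> y \<le> q \<Longrightarrow> u y = 0" for p q
  proof (cases "p = q")
    case False
    then have pq: "p < q" using that by simp
    obtain z where "p < z" "z < q" "g q - g p = (q - p) * u z"
      using MVT2[OF pq, of g u] d by blast
    then show ?thesis using that(2)[of z] by simp
  qed simp
  have left: "g x = 0" if "x \<le> - T" for x
    using const[of x "- T"] that T(2) by (simp add: g_def)
  have "(\<integral>y. u y * indicator {-T..T} y \<partial>lborel) = g T - g (- T)"
    by (rule integral_FTC_Icc_real) (use d smooth_isCont[OF test_fun_smooth[OF u]] T(1) in auto)
  moreover have "(\<integral>y. u y * indicator {-T..T} y \<partial>lborel) = (\<integral>y. u y \<partial>lborel)"
  proof (rule Bochner_Integration.integral_cong)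
    show "u y * indicator {-T..T} y = u y" for y
      using T(2)[of y] by (cases "T \<le> \<bar>y\<bar>") (auto simp: indicator_def)
  qed simp
  ultimately have "g T = 0" using int by (simp add: g_def)
  then have right: "g x = 0" if "T \<le> x" for x
    using const[of T x] that T by simp
  show ?thesis
  proof (rule that)
    show "test_fun g" by (rule test_funI'[OF g, of T]) (use left right in \<open>auto simp: abs_if split: if_splits\<close>)
    show "deriv g = u" using d DERIV_imp_deriv by blast
    show "(g has_real_derivative u x) (at x)" for x by (rule d)
    show "g x = 0" if "\<And>y. y \<le> c \<Longrightarrow> u y = 0" "x \<le> c" for c x
    proof (cases "x \<le> - T")
      case False
      then have "g (- T) = g x" using that by (intro const) auto
      then show ?thesis using left[of "- T"] by simp
    qed (use left in simp)
    show "g x = 0" if "\<And>y. c \<le> y \<Longrightarrow> u y = 0" "c \<le> x" for c x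
    proof (cases "T \<le> x")
      case False
      then have "g x = g T" using that by (intro const) auto
      then show ?thesis using right[of T] by simp
    qed (use right in simp)
  qed
qed

locale weighted_line =
  fixes v :: "real \<Rightarrow> real"
  assumes smooth_v: "smooth v" and integrable_weight: "integrable lborel (\<lambda>x. exp (- v x))"
begin

definition w :: "real \<Rightarrow> real" where "w x = exp (- v x)"

definition M :: "real measure" where "M = density lborel (\<lambda>x. ennreal (w x))"

definition adj :: "(real \<Rightarrow> real) \<Rightarrow> real \<Rightarrow> real" where
  "adj u x = deriv v x * u x - deriv u x"

lemma w_pos [simp]: "0 < w x" and w_nz [simp]: "w x \<noteq> 0"
  by (simp_all add: w_def)

lemma smooth_w: "smooth w"
  unfolding w_def[abs_def] by (intro smooth_exp smooth_uminus smooth_v)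

lemma w_measurable [measurable]: "w \<in> borel_measurable borel"
  by (rule smooth_measurable[OF smooth_w])

lemma w_deriv: "(w has_real_derivative (- deriv v x * w x)) (at x)"
  unfolding w_def[abs_def] using smooth_has_deriv[OF smooth_v, of x]
  by (auto intro!: derivative_eq_intros)

lemma sets_M [measurable_cong]: "sets M = sets borel"
  by (simp add: M_def)

lemma space_M [simp]: "space M = UNIV"
  by (simp add: M_def)

lemma finite_M: "finite_measure M"
proof
  have "emeasure M (space M) = (\<integral>\<^sup>+x. ennreal (w x) \<partial>lborel)"
    by (simp add: M_def emeasure_density)
  also have "\<dots> = ennreal (\<integral>x. w x \<partial>lborel)"
    using integrable_weight by (intro nn_integral_eq_integral) (auto simp: w_def)
  finally show "emeasure M (space M) \<noteq> \<infinity>" by simp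
qed

lemma AE_M: "(AE x in M. P x) \<longleftrightarrow> (AE x in lborel. P x)"
  unfolding M_def by (subst AE_density) auto

lemma integral_M: "f \<in> borel_measurable borel \<Longrightarrow> (\<integral>x. f x \<partial>M) = (\<integral>x. w x * f x \<partial>lborel)"
  unfolding M_def by (subst integral_density) (auto simp: less_imp_le)

lemma integrable_M: "f \<in> borel_measurable borel \<Longrightarrow> integrable M f \<longleftrightarrow> integrable lborel (\<lambda>x. w x * f x)"
  unfolding M_def by (subst integrable_density) (auto simp: less_imp_le)

lemma measure_M_Icc_pos: "a < b \<Longrightarrow> 0 < measure M {a..b}"
proof -
  assume ab: "a < b"
  interpret finite_measure M by (rule finite_M)
  have "\<not> (AE x in lborel. x \<notin> {a..b})"
    using ab by (subst AE_iff_measurable[of "{a..b}"]) (auto simp: ennreal_eq_0_iff)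
  then have "\<not> (AE x in M. x \<notin> {a..b})" by (simp add: AE_M)
  then have "emeasure M {a..b} \<noteq> 0" by (subst (asm) AE_iff_measurable[of "{a..b}"]) (auto simp: sets_M)
  then show ?thesis by (simp add: emeasure_eq_measure zero_less_measure_iff)
qed

section \<open>Total mass and mean\<close>

definition mass :: real where "mass = measure M UNIV"

lemma mass_pos: "0 < mass"
proof -
  interpret finite_measure M by (rule finite_M)
  have "measure M {0..1} \<le> mass" unfolding mass_def by (rule finite_measure_mono) (auto simp: sets_M)
  then show ?thesis using measure_M_Icc_pos[of 0 1] by simp
qed

lemmas const_L2 [simp] = L2_const[OF finite_M]
lemmas test_L2 = test_fun_L2[OF finite_M sets_M]

definition mean :: "(real \<Rightarrow> real) \<Rightarrow> real" where "mean f = ip M f (\<lambda>_. 1) / mass"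

lemma ip_one_one: "ip M (\<lambda>_. 1) (\<lambda>_. 1) = mass"
  by (simp add: ip_def mass_def)

lemma ip_const_left: "ip M (\<lambda>_. c) f = c * ip M f (\<lambda>_. 1)"
  using ip_scale_left[of M c "\<lambda>_. 1" f] ip_commute[of M f "\<lambda>_. 1"] by simp

lemma ip_const_right: "ip M f (\<lambda>_. c) = c * ip M f (\<lambda>_. 1)"
  using ip_const_left[of c f] ip_commute[of M f "\<lambda>_. c"] by simp

lemma mean_const: "mean (\<lambda>_. c) = c"
  using mass_pos ip_const_left[of c "\<lambda>_. 1"] by (simp add: mean_def ip_one_one)

lemma mean_add: "f \<in> L2 M \<Longrightarrow> g \<in> L2 M \<Longrightarrow> mean (\<lambda>x. f x + g x) = mean f + mean g"
  by (simp add: mean_def ip_add_left add_divide_distrib)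

lemma mean_diff: "f \<in> L2 M \<Longrightarrow> g \<in> L2 M \<Longrightarrow> mean (\<lambda>x. f x - g x) = mean f - mean g"
  by (simp add: mean_def ip_diff_left diff_divide_distrib)

lemma mean_scale: "mean (\<lambda>x. c * f x) = c * mean f"
  by (simp add: mean_def ip_scale_left)

lemma mean_zero_iff: "mean f = 0 \<longleftrightarrow> ip M f (\<lambda>_. 1) = 0"
  using mass_pos by (simp add: mean_def)

lemma mean_cong_AE: "AE x in M. f x = g x \<Longrightarrow> f \<in> L2 M \<Longrightarrow> g \<in> L2 M \<Longrightarrow> mean f = mean g"
  unfolding mean_def by (subst ip_cong_AE[where g="\<lambda>_. 1" and g'="\<lambda>_. 1"]) auto

text \<open>The mean is the orthogonal projection onto the constants, so Pythagoras applies. This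
  turns a bound with some unspecified constant into one with the mean.\<close>

lemma L2norm_minus_mean_le:
  assumes f: "f \<in> L2 M"
  shows "L2norm M (\<lambda>x. f x - mean f) \<le> L2norm M (\<lambda>x. f x - c)"
proof -
  define f0 where "f0 = (\<lambda>x. f x - mean f)"
  define d where "d = mean f - c"
  have f0: "f0 \<in> L2 M" unfolding f0_def by (intro L2_diff f const_L2)
  have "mean f0 = 0" unfolding f0_def using f by (simp add: mean_diff mean_const)
  then have z: "ip M f0 (\<lambda>_. d) = 0" using ip_const_right[of f0 d] by (simp add: mean_zero_iff)
  have "(\<lambda>x. f x - c) = (\<lambda>x. f0 x + d)" by (simp add: f0_def d_def)
  then have "(L2norm M (\<lambda>x. f x - c))\<^sup>2 = ip M (\<lambda>x. f0 x + d) (\<lambda>x. f0 x + d)"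
    by (simp add: ip_self_eq)
  also have "\<dots> = ip M f0 f0 + ip M (\<lambda>_. d) (\<lambda>_. d)"
    using z ip_commute[of M f0 "\<lambda>_. d"]
    by (simp add: ip_add_left[OF f0 const_L2 L2_add[OF f0 const_L2]] ip_add_right[OF f0 const_L2 f0]
        ip_add_right[OF f0 const_L2 const_L2])
  finally have "(L2norm M f0)\<^sup>2 \<le> (L2norm M (\<lambda>x. f x - c))\<^sup>2" by (simp add: ip_self_eq)
  then have "L2norm M f0 \<le> L2norm M (\<lambda>x. f x - c)" by (rule power2_le_imp_le) simp
  then show ?thesis by (simp add: f0_def)
qed

lemma L2norm_minus_mean_le': "f \<in> L2 M \<Longrightarrow> L2norm M (\<lambda>x. f x - mean f) \<le> L2norm M f"
  using L2norm_minus_mean_le[of f 0] by simp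

section \<open>Integration by parts for the formal adjoint\<close>

lemma test_fun_adj: "test_fun u \<Longrightarrow> test_fun (adj u)"
  unfolding adj_def[abs_def]
  by (intro test_fun_diff test_fun_mult_smooth smooth_deriv smooth_v test_fun_deriv)

text \<open>The divergence form of \<open>adj\<close>. Through it, facts about \<open>adj\<close>
  reduce to the fundamental theorem of calculus for the product of w and u.\<close>

lemma w_times_deriv:
  "smooth u \<Longrightarrow> ((\<lambda>x. w x * u x) has_real_derivative (- (w x * adj u x))) (at x)"
  using w_deriv[of x] smooth_has_deriv[of u x]
  by (auto intro!: derivative_eq_intros simp: adj_def algebra_simps)

lemma deriv_w_times: "smooth u \<Longrightarrow> deriv (\<lambda>x. w x * u x) = (\<lambda>x. - (w x * adj u x))"
  using w_times_deriv DERIV_imp_deriv by blast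

lemma adj_mean_zero: assumes u: "test_fun u" shows "ip M (adj u) (\<lambda>_. 1) = 0"
proof -
  have "ip M (adj u) (\<lambda>_. 1) = (\<integral>x. w x * adj u x \<partial>lborel)"
    unfolding ip_def
    by (subst integral_M) (auto intro: smooth_measurable test_fun_smooth test_fun_adj u)
  also have "\<dots> = - (\<integral>x. deriv (\<lambda>x. w x * u x) x \<partial>lborel)"
    using u by (simp add: deriv_w_times test_fun_smooth)
  finally show ?thesis
    by (simp add: integral_test_deriv test_fun_mult_smooth[OF u smooth_w])
qed

text \<open>The compact support of u is enough for the boundary terms to vanish, so f may be a
  function that is not square integrable, such as the scale function.\<close>

lemma ip_adj_by_parts:
  assumes u: "test_fun u" and f: "smooth f"
  shows "ip M f (adj u) = ip M (deriv f) u"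
proof -
  define g where "g = (\<lambda>x. f x * (w x * u x))"
  have wu: "test_fun (\<lambda>x. w x * u x)" by (rule test_fun_mult_smooth[OF u smooth_w])
  have g: "test_fun g" unfolding g_def by (rule test_fun_mult_smooth[OF wu f])
  have fm: "f \<in> borel_measurable borel" "deriv f \<in> borel_measurable borel"
    and um: "u \<in> borel_measurable borel" "adj u \<in> borel_measurable borel"
    using f test_fun_smooth[OF u] test_fun_smooth[OF test_fun_adj[OF u]]
    by (auto intro!: smooth_measurable smooth_deriv)
  have d: "deriv g x = w x * (deriv f x * u x) - w x * (f x * adj u x)" for x
    unfolding g_def
    using DERIV_imp_deriv[OF DERIV_mult[OF smooth_has_deriv[OF f, of x]
          w_times_deriv[OF test_fun_smooth[OF u], of x]]]
    by (simp add: algebra_simps)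
  have i1: "integrable lborel (\<lambda>x. w x * (deriv f x * u x))"
    by (intro test_fun_integrable test_fun_mult_smooth smooth_w smooth_deriv f u)
  have i2: "integrable lborel (\<lambda>x. w x * (f x * adj u x))"
    by (intro test_fun_integrable test_fun_mult_smooth smooth_w f test_fun_adj u)
  have "0 = (\<integral>x. deriv g x \<partial>lborel)" by (simp add: integral_test_deriv g)
  also have "\<dots> = (\<integral>x. w x * (deriv f x * u x) \<partial>lborel) - (\<integral>x. w x * (f x * adj u x) \<partial>lborel)"
    unfolding d using i1 i2 by simp
  finally show ?thesis
    unfolding ip_def using fm um by (simp add: integral_M)
qed

text \<open>By the divergence form the equation reads (w u)' = - w q, and mean zero of q is the
  condition for w u to have compact support. Multiplying by w or its inverse preserves supports, so
  the one-sided support clauses are inherited from the primitive.\<close>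

lemma adj_preimage:
  assumes q: "test_fun q" and m: "ip M q (\<lambda>_. 1) = 0"
  obtains u where "test_fun u" "adj u = q"
    "\<And>c x. (\<And>y. y \<le> c \<Longrightarrow> q y = 0) \<Longrightarrow> x \<le> c \<Longrightarrow> u x = 0"
    "\<And>c x. (\<And>y. c \<le> y \<Longrightarrow> q y = 0) \<Longrightarrow> c \<le> x \<Longrightarrow> u x = 0"
proof -
  define k where "k = (\<lambda>x. - w x * q x)"
  have k: "test_fun k" unfolding k_def by (intro test_fun_mult_smooth q smooth_uminus smooth_w)
  have qm: "q \<in> borel_measurable borel" by (intro smooth_measurable test_fun_smooth q)
  have "(\<integral>x. k x \<partial>lborel) = - (\<integral>x. w x * q x \<partial>lborel)" by (simp add: k_def)
  also have "\<dots> = - ip M q (\<lambda>_. 1)" using qm by (simp add: ip_def integral_M)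
  finally have int: "(\<integral>x. k x \<partial>lborel) = 0" using m by simp
  obtain g where g: "test_fun g" "deriv g = k" "\<And>x. (g has_real_derivative k x) (at x)"
    "\<And>c x. (\<And>y. y \<le> c \<Longrightarrow> k y = 0) \<Longrightarrow> x \<le> c \<Longrightarrow> g x = 0"
    "\<And>c x. (\<And>y. c \<le> y \<Longrightarrow> k y = 0) \<Longrightarrow> c \<le> x \<Longrightarrow> g x = 0"
    by (rule test_fun_antiderivative[OF k int]) blast
  define u where "u = (\<lambda>x. inverse (w x) * g x)"
  have u: "test_fun u" unfolding u_def by (intro test_fun_mult_smooth g(1) smooth_inverse smooth_w) simp
  have "(\<lambda>x. w x * u x) = g" by (simp add: u_def fun_eq_iff)
  then have "k = (\<lambda>x. - (w x * adj u x))"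
    using deriv_w_times[OF test_fun_smooth[OF u]] g(2) by simp
  then have "w x * q x = w x * adj u x" for x by (metis k_def minus_mult_left neg_equal_iff_equal)
  then have "adj u = q" by (simp add: fun_eq_iff)
  then show ?thesis
  proof (rule that[OF u])
    show "u x = 0" if "\<And>y. y \<le> c \<Longrightarrow> q y = 0" "x \<le> c" for c x
      using g(4)[of c x] that by (simp add: u_def k_def)
    show "u x = 0" if "\<And>y. c \<le> y \<Longrightarrow> q y = 0" "c \<le> x" for c x
      using g(5)[of c x] that by (simp add: u_def k_def)
  qed
qed

section \<open>The scale function and correctors with small adjoint derivative\<close>

lemma scale_function_exists:
  obtains y where "smooth y" "\<And>x. (y has_real_derivative 1 / w x) (at x)"
    "\<And>x. 0 < x \<Longrightarrow> 0 < y x" "\<And>x. x < 0 \<Longrightarrow> y x < 0"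
proof -
  have "smooth (\<lambda>x. 1 / w x)" by (intro smooth_divide smooth_const smooth_w) simp
  then obtain F where F: "smooth F" "\<And>x. (F has_real_derivative 1 / w x) (at x)"
    by (rule smooth_antiderivative_exists) blast
  define y where "y = (\<lambda>x. F x - F 0)"
  have y: "smooth y" unfolding y_def by (intro smooth_diff F(1) smooth_const)
  have d: "(y has_real_derivative 1 / w x) (at x)" for x
    unfolding y_def using F(2)[of x] by (auto intro!: derivative_eq_intros)
  have inc: "F p < F q" if "p < q" for p q
    by (rule DERIV_pos_imp_increasing[OF that]) (use F(2) w_pos in \<open>blast intro: divide_pos_pos zero_less_one\<close>)
  show ?thesis by (rule that[of y]) (use y d inc in \<open>auto simp: y_def\<close>)
qed

text \<open>Quantifies that the scale function is not square integrable at either end. With t = y^2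
  w the inequality 2 - 1 / t \<le> t holds pointwise, and 1 / (y^2 w) is the derivative of - 1 / y,
  so its left side integrates to 2 (q - p) plus boundary terms. The plateau turns the indicator of
  [p, q] into a test function.\<close>

lemma energy_lower_bound:
  assumes y: "smooth y" "\<And>x. (y has_real_derivative 1 / w x) (at x)"
    and pq: "p \<le> q" and nz: "\<And>x. x \<in> {p..q} \<Longrightarrow> y x \<noteq> 0"
  shows "2 * (q - p) + 1 / y q - 1 / y p \<le> ip M (\<lambda>x. plateau p q 0 x * y x) y"
proof -
  let ?\<rho> = "plateau p q 0"
  have \<rho>: "test_fun ?\<rho>" by (rule test_fun_plateau)
  have ym: "y \<in> borel_measurable borel" and \<rho>m: "?\<rho> \<in> borel_measurable borel"
    by (auto intro!: smooth_measurable y test_fun_smooth \<rho>)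
  have d: "((\<lambda>x. 2 * x + 1 / y x) has_real_derivative (2 - 1 / ((y x)\<^sup>2 * w x))) (at x)" if "x \<in> {p..q}" for x
    using y(2)[of x] nz[OF that]
    by (auto intro!: derivative_eq_intros simp: field_simps power2_eq_square)
  have c: "isCont (\<lambda>x. 2 - 1 / ((y x)\<^sup>2 * w x)) x" if "x \<in> {p..q}" for x
    using nz[OF that] smooth_isCont[OF y(1), of x] smooth_isCont[OF smooth_w, of x]
    by (auto intro!: continuous_intros)
  have le: "(2 - 1 / ((y x)\<^sup>2 * w x)) * indicator {p..q} x \<le> w x * (?\<rho> x * y x * y x)" for x
  proof (cases "x \<in> {p..q}")
    case True
    define t where "t = (y x)\<^sup>2 * w x"
    have t: "0 < t" using nz[OF True] by (simp add: t_def)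
    have "0 \<le> (t - 1)\<^sup>2 / t" using t by simp
    also have "\<dots> = t - (2 - 1 / t)" using t by (simp add: power2_eq_square field_simps)
    finally show ?thesis using True by (simp add: plateau_eq_1 t_def power2_eq_square mult_ac)
  qed (simp add: plateau_nonneg mult.assoc less_imp_le)
  have "2 * (q - p) + 1 / y q - 1 / y p = (2 * q + 1 / y q) - (2 * p + 1 / y p)" by simp
  also have "\<dots> = (\<integral>x. (2 - 1 / ((y x)\<^sup>2 * w x)) * indicator {p..q} x \<partial>lborel)"
    by (rule integral_FTC_Icc_real[symmetric, OF pq]) (use d c in auto)
  also have "\<dots> \<le> (\<integral>x. w x * (?\<rho> x * y x * y x) \<partial>lborel)"
  proof (rule integral_mono)
    show "integrable lborel (\<lambda>x. (2 - 1 / ((y x)\<^sup>2 * w x)) * indicator {p..q} x)"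
      by (rule borel_integrable_atLeastAtMost) (use c in auto)
    have "test_fun (\<lambda>x. (w x * y x * y x) * ?\<rho> x)"
      by (intro test_fun_mult_smooth \<rho> smooth_mult smooth_w y(1))
    then have "integrable lborel (\<lambda>x. (w x * y x * y x) * ?\<rho> x)" by (rule test_fun_integrable)
    then show "integrable lborel (\<lambda>x. w x * (?\<rho> x * y x * y x))" by (simp add: mult_ac)
  qed (rule le)
  also have "\<dots> = ip M (\<lambda>x. ?\<rho> x * y x) y"
    using ym \<rho>m by (simp add: ip_def integral_M)
  finally show ?thesis .
qed

lemma integrable_test_mult_smooth:
  assumes f: "test_fun f" and g: "smooth g"
  shows "integrable M (\<lambda>x. f x * g x)"
proof -
  have "integrable lborel (\<lambda>x. w x * (g x * f x))"
    by (intro test_fun_integrable test_fun_mult_smooth smooth_w f g)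
  moreover have "(\<lambda>x. g x * f x) \<in> borel_measurable borel"
    by (intro smooth_measurable test_fun_smooth test_fun_mult_smooth f g)
  ultimately have "integrable M (\<lambda>x. g x * f x)" by (simp add: integrable_M)
  then show ?thesis by (simp add: mult.commute)
qed

text \<open>By parts, the Lebesgue integral of u is the inner product of y with
  \<open>adj u\<close>. If \<open>adj u\<close> were \<rho> y, this product would be Q and the norm
  at most sqrt Q, so normalising to integral 1 would leave a norm of order 1 / sqrt Q. But
  \<open>adj u\<close> must have mean zero, so a multiple of the bump \<theta> is subtracted from
  \<rho> y; the effect of this correction is controlled relative to sqrt Q.\<close>

lemma small_adj_unit_integral_aux:
  fixes J :: "real set"
  assumes J: "J = {1<..} \<or> J = {..< -1}" and \<epsilon>: "0 < \<epsilon>"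
    and y: "smooth y" "\<And>x. (y has_real_derivative 1 / w x) (at x)"
    and \<theta>: "test_fun \<theta>" "ip M \<theta> (\<lambda>_. 1) = 1" "\<And>x. x \<notin> J \<Longrightarrow> \<theta> x = 0"
    and large: "\<And>B. \<exists>\<rho>. test_fun \<rho> \<and> (\<forall>x. 0 \<le> \<rho> x \<and> \<rho> x \<le> 1) \<and> (\<forall>x. x \<notin> J \<longrightarrow> \<rho> x = 0)
      \<and> B \<le> ip M (\<lambda>x. \<rho> x * y x) y"
  obtains u where "test_fun u" "\<And>x. x \<notin> J \<Longrightarrow> u x = 0" "(\<integral>x. u x \<partial>lborel) = 1" "L2norm M (adj u) < \<epsilon>"
proof -
  \<comment> \<open>With s = sqrt Q, the norm will be at most s \<open>E1\<close> and the integral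
    at least s (s - \<open>E2\<close>). Their quotient is below \<epsilon> once s >
    \<open>E2\<close> + \<open>E1\<close> / \<epsilon>; \<open>s0\<close> adds a margin of
    one.\<close>
  define E1 where "E1 = 1 + sqrt mass * L2norm M \<theta>"
  define E2 where "E2 = sqrt mass * \<bar>ip M \<theta> y\<bar>"
  define s0 where "s0 = E2 + E1 / \<epsilon> + 1"
  have E: "0 < E1" "0 \<le> E2" using mass_pos by (auto simp: E1_def E2_def intro!: add_pos_nonneg)
  have s0: "0 < s0" using E \<epsilon> by (auto simp: s0_def intro!: add_nonneg_pos)
  obtain \<rho> where \<rho>: "test_fun \<rho>" "\<And>x. 0 \<le> \<rho> x" "\<And>x. \<rho> x \<le> 1" "\<And>x. x \<notin> J \<Longrightarrow> \<rho> x = 0"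
    and B: "s0\<^sup>2 \<le> ip M (\<lambda>x. \<rho> x * y x) y"
    using large[of "s0\<^sup>2"] by blast
  define Q where "Q = ip M (\<lambda>x. \<rho> x * y x) y"
  define s where "s = sqrt Q"
  have s: "s0 \<le> s" unfolding s_def Q_def by (rule real_le_rsqrt[OF B])
  have Q: "Q = s\<^sup>2" using B by (simp add: s_def Q_def order_trans[OF zero_le_power2])
  define f where "f = (\<lambda>x. \<rho> x * y x)"
  have f: "test_fun f" unfolding f_def using test_fun_mult_smooth[OF \<rho>(1) y(1)] by (simp add: mult.commute)
  have fL: "f \<in> L2 M" and \<theta>L: "\<theta> \<in> L2 M" by (auto intro: test_L2 f \<theta>(1))
  have ym: "y \<in> borel_measurable borel" by (rule smooth_measurable[OF y(1)])
  have fyi: "integrable M (\<lambda>x. f x * y x)" "integrable M (\<lambda>x. \<theta> x * y x)"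
    by (auto intro: integrable_test_mult_smooth f \<theta>(1) y(1))
  \<comment> \<open>Here 0 \<le> \<rho> \<le> 1 enters: \<rho>^2 y^2 \<le> \<rho> y^2
    pointwise.\<close>
  have "(L2norm M f)\<^sup>2 \<le> Q"
    unfolding ip_self_eq[symmetric] Q_def ip_def f_def[symmetric]
  proof (rule integral_mono)
    show "f x * f x \<le> f x * y x" for x
      using mult_right_mono[OF \<rho>(3)[of x], of "\<rho> x * (y x * y x)"] \<rho>(2)[of x]
      by (simp add: f_def mult_ac)
  qed (use fL fyi in \<open>auto intro: L2_mult_integrable\<close>)
  then have fs: "L2norm M f \<le> s" unfolding Q by (rule power2_le_imp_le) (use s s0 in linarith)
  define m where "m = ip M f (\<lambda>_. 1)"
  have "\<bar>m\<bar> \<le> L2norm M f * L2norm M (\<lambda>_. 1)" unfolding m_def by (rule ip_Cauchy_Schwarz[OF fL const_L2])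
  also have "L2norm M (\<lambda>_. 1) = sqrt mass" by (simp add: L2norm_def mass_def)
  also have "L2norm M f * sqrt mass \<le> s * sqrt mass"
    using mass_pos by (intro mult_right_mono fs) simp
  finally have ms: "\<bar>m\<bar> \<le> s * sqrt mass" .
  define \<zeta> where "\<zeta> = (\<lambda>x. f x - m * \<theta> x)"
  have \<zeta>: "test_fun \<zeta>" unfolding \<zeta>_def by (intro test_fun_diff f test_fun_scale \<theta>)
  have \<zeta>m: "ip M \<zeta> (\<lambda>_. 1) = 0"
    unfolding \<zeta>_def by (simp add: ip_diff_left fL L2_scale[OF \<theta>L] ip_scale_left \<theta>(2) m_def)
  obtain u0 where u0: "test_fun u0" "adj u0 = \<zeta>"
    "\<And>c x. (\<And>y. y \<le> c \<Longrightarrow> \<zeta> y = 0) \<Longrightarrow> x \<le> c \<Longrightarrow> u0 x = 0"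
    "\<And>c x. (\<And>y. c \<le> y \<Longrightarrow> \<zeta> y = 0) \<Longrightarrow> c \<le> x \<Longrightarrow> u0 x = 0"
    by (rule adj_preimage[OF \<zeta> \<zeta>m]) blast
  have \<zeta>J: "\<zeta> x = 0" if "x \<notin> J" for x using that \<rho>(4) \<theta>(3) by (simp add: \<zeta>_def f_def)
  have u0J: "u0 x = 0" if "x \<notin> J" for x
    using J
  proof
    assume J: "J = {1<..}"
    show ?thesis by (rule u0(3)[of 1]) (use \<zeta>J that J in auto)
  next
    assume J: "J = {..< -1}"
    show ?thesis by (rule u0(4)[of "-1"]) (use \<zeta>J that J in auto)
  qed
  have dy: "deriv y = (\<lambda>x. 1 / w x)" using y(2) DERIV_imp_deriv by blast
  define I where "I = (\<integral>x. u0 x \<partial>lborel)"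
  \<comment> \<open>The factor 1 / w in y' cancels the weight, so the weighted inner product is a
    plain Lebesgue integral.\<close>
  have "I = ip M (deriv y) u0"
    unfolding ip_def dy I_def using smooth_measurable[OF test_fun_smooth[OF u0(1)]]
    by (subst integral_M) auto
  also have "\<dots> = ip M y \<zeta>" using ip_adj_by_parts[OF u0(1) y(1)] u0(2) by simp
  also have "\<dots> = Q - m * ip M \<theta> y"
  proof -
    have "ip M y \<zeta> = (\<integral>x. f x * y x - m * (\<theta> x * y x) \<partial>M)"
      unfolding ip_def \<zeta>_def by (rule Bochner_Integration.integral_cong) (auto simp: algebra_simps)
    also have "\<dots> = (\<integral>x. f x * y x \<partial>M) - m * (\<integral>x. \<theta> x * y x \<partial>M)" using fyi by simp
    finally show ?thesis by (simp add: Q_def ip_def f_def)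
  qed
  finally have I: "I = Q - m * ip M \<theta> y" .
  have "\<bar>m * ip M \<theta> y\<bar> \<le> s * E2"
    using mult_right_mono[OF ms, of "\<bar>ip M \<theta> y\<bar>"] by (simp add: abs_mult E2_def mult_ac)
  then have I_lower: "s * (s - E2) \<le> I" unfolding I Q by (simp add: power2_eq_square algebra_simps)
  have sE: "E1 / \<epsilon> < s - E2" using s by (simp add: s0_def)
  moreover have "0 < E1 / \<epsilon>" using E \<epsilon> by simp
  ultimately have sE0: "0 < s - E2" by linarith
  have sp: "0 < s" using s s0 by linarith
  have Ip: "0 < I" using I_lower mult_pos_pos[OF sp sE0] by linarith
  have "L2norm M \<zeta> \<le> L2norm M f + L2norm M (\<lambda>x. m * \<theta> x)"
    unfolding \<zeta>_def by (rule L2norm_triangle_diff[OF fL L2_scale[OF \<theta>L]])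
  also have "\<dots> \<le> s + s * sqrt mass * L2norm M \<theta>"
    unfolding L2norm_scale using fs mult_right_mono[OF ms, of "L2norm M \<theta>"] by simp
  also have "\<dots> = s * E1" by (simp add: E1_def algebra_simps)
  finally have \<zeta>n: "L2norm M \<zeta> \<le> s * E1" .
  have "s * E1 < \<epsilon> * (s * (s - E2))"
    using mult_strict_left_mono[OF sE, of "\<epsilon> * s"] sp \<epsilon> by (simp add: mult_ac)
  also have "\<dots> \<le> \<epsilon> * I" using I_lower \<epsilon> by (intro mult_left_mono) auto
  finally have small: "L2norm M \<zeta> < \<epsilon> * I" using \<zeta>n by linarith
  define u where "u = (\<lambda>x. (1 / I) * u0 x)"
  have u: "test_fun u" unfolding u_def by (rule test_fun_scale[OF u0(1)])
  have "adj u = (\<lambda>x. (1 / I) * \<zeta> x)"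
  proof
    fix x
    have "deriv u x = (1 / I) * deriv u0 x"
      unfolding u_def using smooth_has_deriv[OF test_fun_smooth[OF u0(1)], of x]
      by (intro DERIV_imp_deriv DERIV_cmult)
    then show "adj u x = (1 / I) * \<zeta> x"
      unfolding u0(2)[symmetric] by (simp add: adj_def u_def algebra_simps)
  qed
  then have "L2norm M (adj u) = \<bar>1 / I\<bar> * L2norm M \<zeta>" by (simp only: L2norm_scale)
  also have "\<dots> < \<epsilon>" using small Ip by (simp add: field_simps)
  finally have "L2norm M (adj u) < \<epsilon>" .
  moreover have "(\<integral>x. u x \<partial>lborel) = 1" using Ip by (simp add: u_def I_def)
  moreover have "u x = 0" if "x \<notin> J" for x using u0J[OF that] by (simp add: u_def)
  ultimately show ?thesis using that u by blast
qed

text \<open>Supplies correctors: a multiple of u changes a Lebesgue integral by any prescribed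
  amount at negligible cost in \<open>adj\<close>. Allowing either half-line gives two correctors
  with disjoint supports and room for a plateau in between.\<close>

lemma small_adj_unit_integral:
  fixes J :: "real set"
  assumes J: "J = {1<..} \<or> J = {..< -1}" and \<epsilon>: "0 < \<epsilon>"
  obtains u where "test_fun u" "\<And>x. x \<notin> J \<Longrightarrow> u x = 0" "(\<integral>x. u x \<partial>lborel) = 1" "L2norm M (adj u) < \<epsilon>"
proof -
  obtain y where y: "smooth y" "\<And>x. (y has_real_derivative 1 / w x) (at x)"
    "\<And>x. 0 < x \<Longrightarrow> 0 < y x" "\<And>x. x < 0 \<Longrightarrow> y x < 0" by (rule scale_function_exists) blast
  \<comment> \<open>An interval of length t that starts at distance 3 from the origin and grows
    outwards. The unit edges of its plateau stay at distance at least 2 from the origin, hence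
    inside \<open>J\<close>.\<close>
  define p q :: "real \<Rightarrow> real" where "p t = (if J = {1<..} then 3 else - 3 - t)"
    and "q t = (if J = {1<..} then 3 + t else - 3)" for t
  have J': "J = {1<..} \<and> (\<forall>t. p t = 3 \<and> q t = 3 + t) \<or> J = {..< -1} \<and> (\<forall>t. p t = - 3 - t \<and> q t = - 3)"
  proof -
    \<comment> \<open>The definitions branch on \<open>J\<close>, so the two half-lines must be seen
      to be different sets.\<close>
    have "2 \<in> {1::real<..}" "2 \<notin> {..< - 1 :: real}" by auto
    then have "{..< - 1} \<noteq> {1::real<..}" by metis
    then show ?thesis using J by (auto simp: p_def q_def)
  qed
  have out: "plateau (p t) (q t) 0 x = 0" if "x \<notin> J" for t x
    using J'
  proof
    assume "J = {1<..} \<and> (\<forall>t. p t = 3 \<and> q t = 3 + t)"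
    then show ?thesis using that by (intro plateau_eq_0_left) auto
  next
    assume "J = {..< -1} \<and> (\<forall>t. p t = - 3 - t \<and> q t = - 3)"
    then show ?thesis using that by (intro plateau_eq_0_right) auto
  qed
  have pq: "q t - p t = t" for t using J' by auto
  \<comment> \<open>The moving endpoint contributes with a favourable sign and the other one is
    fixed, so the boundary terms are bounded below uniformly in t. Adding both reciprocals gives one
    formula for the two cases.\<close>
  have sgn: "(\<forall>x\<in>{p t..q t}. y x \<noteq> 0) \<and> - (1 / \<bar>y 3\<bar> + 1 / \<bar>y (-3)\<bar>) \<le> 1 / y (q t) - 1 / y (p t)" if "0 \<le> t" for t
    using J'
  proof
    assume *: "J = {1<..} \<and> (\<forall>t. p t = 3 \<and> q t = 3 + t)"
    have "0 < 1 / y (3 + t)" using y(3)[of "3 + t"] that by simp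
    moreover have "0 \<le> 1 / \<bar>y (-3)\<bar>" by simp
    moreover have "\<bar>y 3\<bar> = y 3" using y(3)[of 3] by simp
    ultimately have "- (1 / \<bar>y 3\<bar> + 1 / \<bar>y (-3)\<bar>) \<le> 1 / y (3 + t) - 1 / y 3" by linarith
    moreover have "y x \<noteq> 0" if "x \<in> {3..3 + t}" for x using y(3)[of x] that by auto
    ultimately show ?thesis using * by auto
  next
    assume *: "J = {..< -1} \<and> (\<forall>t. p t = - 3 - t \<and> q t = - 3)"
    have "1 / y (- 3 - t) < 0" using y(4)[of "- 3 - t"] that by simp
    moreover have "0 \<le> 1 / \<bar>y 3\<bar>" by simp
    moreover have "1 / \<bar>y (-3)\<bar> = - (1 / y (- 3))" using y(4)[of "-3"] by simp
    ultimately have "- (1 / \<bar>y 3\<bar> + 1 / \<bar>y (-3)\<bar>) \<le> 1 / y (- 3) - 1 / y (- 3 - t)" by linarith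
    moreover have "y x \<noteq> 0" if "x \<in> {- 3 - t..- 3}" for x using y(4)[of x] that by auto
    ultimately show ?thesis using * by auto
  qed
  let ?\<theta> = "plateau (p 1) (q 1) 0"
  define c where "c = ip M ?\<theta> (\<lambda>_. 1)"
  have \<theta>m: "?\<theta> \<in> borel_measurable M" by (rule L2_measurable[OF test_L2[OF test_fun_plateau]])
  have "measure M {p 1..q 1} \<le> c"
  proof -
    interpret finite_measure M by (rule finite_M)
    have "measure M {p 1..q 1} = (\<integral>x. indicator {p 1..q 1} x \<partial>M)" by simp
    also have "\<dots> \<le> (\<integral>x. ?\<theta> x * 1 \<partial>M)"
    proof (rule integral_mono)
      show "integrable M (\<lambda>x. ?\<theta> x * 1)" by (intro L2_mult_integrable test_L2 test_fun_plateau const_L2)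
      show "indicat_real {p 1..q 1} x \<le> ?\<theta> x * 1" for x
        by (cases "x \<in> {p 1..q 1}") (simp_all add: plateau_eq_1 plateau_nonneg)
    qed (auto simp: sets_M emeasure_eq_measure intro!: integrable_real_indicator)
    finally show ?thesis by (simp add: c_def ip_def)
  qed
  moreover have "0 < measure M {p 1..q 1}" using pq[of 1] by (intro measure_M_Icc_pos) simp
  ultimately have c: "0 < c" by linarith
  show ?thesis
  proof (rule small_adj_unit_integral_aux[OF J \<epsilon> y(1,2)])
    show "test_fun (\<lambda>x. (1 / c) * ?\<theta> x)" by (rule test_fun_scale[OF test_fun_plateau])
    show "ip M (\<lambda>x. (1 / c) * ?\<theta> x) (\<lambda>_. 1) = 1" unfolding ip_scale_left using c by (simp add: c_def)
    show "(1 / c) * ?\<theta> x = 0" if "x \<notin> J" for x using out[OF that] by simp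
    show "\<exists>\<rho>. test_fun \<rho> \<and> (\<forall>x. 0 \<le> \<rho> x \<and> \<rho> x \<le> 1) \<and> (\<forall>x. x \<notin> J \<longrightarrow> \<rho> x = 0) \<and> B \<le> ip M (\<lambda>x. \<rho> x * y x) y" for B
    proof -
      define t where "t = max 0 (B + (1 / \<bar>y 3\<bar> + 1 / \<bar>y (-3)\<bar>))"
      have t: "0 \<le> t" by (simp add: t_def)
      have "2 * (q t - p t) + 1 / y (q t) - 1 / y (p t) \<le> ip M (\<lambda>x. plateau (p t) (q t) 0 x * y x) y"
        by (rule energy_lower_bound[OF y(1,2)]) (use pq[of t] t sgn[OF t] in auto)
      moreover have "B \<le> 2 * (q t - p t) + 1 / y (q t) - 1 / y (p t)"
      proof -
        have "B + (1 / \<bar>y 3\<bar> + 1 / \<bar>y (-3)\<bar>) \<le> t" by (simp add: t_def)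
        moreover have "B \<le> 2 * D + X - Y" if "B + K \<le> t" "- K \<le> X - Y" "D = t" for K X Y D :: real
          using that t by linarith
        ultimately show ?thesis using conjunct2[OF sgn[OF t]] pq[of t] by blast
      qed
      ultimately show ?thesis
        using out by (intro exI[of _ "plateau (p t) (q t) 0"]) (auto simp: test_fun_plateau plateau_nonneg plateau_le_1)
    qed
  qed (use that in blast)
qed

end

section \<open>Integral operators inverting the derivative and its adjoint\<close>

context weighted_line
begin

text \<open>The signed kernel of integration from 0 to x. As a kernel on the whole line it treats
  both signs of x in one formula and is ready for Fubini.\<close>

definition kern :: "real \<Rightarrow> real \<Rightarrow> real" where
  "kern x y = (if 0 \<le> y \<and> y \<le> x then 1 else 0) - (if x \<le> y \<and> y \<le> 0 then 1 else 0)"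

definition prim :: "(real \<Rightarrow> real) \<Rightarrow> real \<Rightarrow> real" where
  "prim u x = (\<integral>y. kern x y * u y \<partial>lborel)"

definition R :: "(real \<Rightarrow> real) \<Rightarrow> real \<Rightarrow> real" where
  "R u x = prim u x - mean (prim u)"

text \<open>The solution of (w \<open>S h\<close>)' = - w (h - \<open>mean h\<close>) that starts
  from the left end. Subtracting the mean makes w \<open>S h\<close> tend to 0 at the right end too,
  and makes \<open>S\<close> vanish on constants.\<close>

definition S :: "(real \<Rightarrow> real) \<Rightarrow> real \<Rightarrow> real" where
  "S h x = - ip M (indicator {..x}) (\<lambda>y. h y - mean h) / w x"

lemma L2_borel: "f \<in> L2 M \<Longrightarrow> f \<in> borel_measurable borel"
  using L2_measurable[of f M] measurable_cong_sets[OF sets_M refl] by blast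

lemma borel_M: "f \<in> borel_measurable borel \<Longrightarrow> f \<in> borel_measurable M"
  using measurable_cong_sets[OF sets_M refl] by blast

lemma L2_M_bounded: "f \<in> borel_measurable borel \<Longrightarrow> (\<And>x. \<bar>f x\<bar> \<le> B) \<Longrightarrow> f \<in> L2 M"
  by (rule L2_bounded[OF finite_M borel_M])

lemma kern_measurable [measurable]: "kern x \<in> borel_measurable borel"
  unfolding kern_def[abs_def] by measurable

lemma kern_abs_le: "\<bar>kern x y\<bar> \<le> 1"
  by (simp add: kern_def)

lemma inverse_weight_bounded: obtains B where "0 < B" "\<And>x. \<bar>x\<bar> \<le> T \<Longrightarrow> 1 / w x \<le> B"
proof -
  have "compact ((\<lambda>x. 1 / w x) ` {-T..T})"
    by (intro compact_continuous_image smooth_continuous_on smooth_divide smooth_const smooth_w) auto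
  then obtain B where "\<And>x. x \<in> {-T..T} \<Longrightarrow> \<bar>1 / w x\<bar> \<le> B"
    unfolding compact_eq_bounded_closed bounded_iff by (metis image_eqI real_norm_def)
  then have "1 / w x \<le> max B 1" if "\<bar>x\<bar> \<le> T" for x using that by (smt (verit) atLeastAtMost_iff)
  then show ?thesis using that[of "max B 1"] by simp
qed

text \<open>Since 1 / w is bounded on compact sets, \<open>prim u x\<close> is the inner product of
  u with a fixed square integrable function. Evaluating a primitive at a point is therefore
  continuous in the L2 norm.\<close>

lemma kern_weight_L2: "(\<lambda>y. kern x y / w y) \<in> L2 M"
proof -
  obtain B where B: "0 < B" "\<And>y. \<bar>y\<bar> \<le> \<bar>x\<bar> \<Longrightarrow> 1 / w y \<le> B"
    by (rule inverse_weight_bounded) blast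
  have "\<bar>kern x y / w y\<bar> \<le> B" for y
  proof (cases "\<bar>y\<bar> \<le> \<bar>x\<bar>")
    case True
    have "\<bar>kern x y / w y\<bar> = \<bar>kern x y\<bar> * (1 / w y)" by (simp add: abs_of_pos[OF w_pos])
    also have "\<dots> \<le> 1 * B" using B True kern_abs_le by (intro mult_mono) (auto simp: less_imp_le)
    finally show ?thesis by simp
  next
    case False
    then have "kern x y = 0" by (auto simp: kern_def)
    then show ?thesis using B by simp
  qed
  then show ?thesis by (intro L2_M_bounded[of _ B]) measurable
qed

lemma prim_eq_ip: "u \<in> L2 M \<Longrightarrow> prim u x = ip M (\<lambda>y. kern x y / w y) u"
  using L2_borel[of u] by (simp add: prim_def ip_def integral_M)

lemma prim_add: "u \<in> L2 M \<Longrightarrow> u' \<in> L2 M \<Longrightarrow> prim (\<lambda>x. u x + u' x) = (\<lambda>x. prim u x + prim u' x)"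
  by (simp add: prim_eq_ip L2_add ip_add_right kern_weight_L2 fun_eq_iff)

lemma prim_scale: "prim (\<lambda>x. c * u x) = (\<lambda>x. c * prim u x)"
  by (simp add: prim_def fun_eq_iff mult.left_commute)

lemma prim_cong_AE:
  assumes "AE x in M. u x = u' x" "u \<in> L2 M" "u' \<in> L2 M"
  shows "prim u = prim u'"
proof
  fix x
  show "prim u x = prim u' x"
    unfolding prim_eq_ip[OF assms(2)] prim_eq_ip[OF assms(3)]
    by (rule ip_cong_AE[OF _ assms(1) kern_weight_L2 kern_weight_L2 assms(2,3)]) simp
qed

lemma prim_measurable: "u \<in> borel_measurable borel \<Longrightarrow> prim u \<in> borel_measurable borel"
proof -
  assume [measurable]: "u \<in> borel_measurable borel"
  have "(\<lambda>x. \<integral>y. kern x y * u y \<partial>lborel) \<in> borel_measurable borel"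
    unfolding kern_def by measurable
  then show ?thesis by (simp add: prim_def[abs_def])
qed

lemma prim_abs_le:
  assumes "integrable lborel u"
  shows "\<bar>prim u x\<bar> \<le> (\<integral>y. \<bar>u y\<bar> \<partial>lborel)"
proof -
  have "\<bar>prim u x\<bar> \<le> (\<integral>y. norm (kern x y * u y) \<partial>lborel)"
    unfolding prim_def using integral_norm_bound[of lborel "\<lambda>y. kern x y * u y"] by simp
  also have "\<dots> \<le> (\<integral>y. \<bar>u y\<bar> \<partial>lborel)"
  proof (rule integral_mono)
    have "integrable lborel (\<lambda>y. kern x y * u y)"
      by (rule Bochner_Integration.integrable_bound[OF assms])
        (use assms kern_abs_le in \<open>auto simp: abs_mult mult_left_le_one_le intro!: AE_I2\<close>)
    then show "integrable lborel (\<lambda>y. norm (kern x y * u y))" by simp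
    show "norm (kern x y * u y) \<le> \<bar>u y\<bar>" for y
      using kern_abs_le[of x y] by (simp add: abs_mult mult_left_le_one_le)
  qed (use assms in simp)
  finally show ?thesis .
qed

lemma prim_deriv:
  fixes g g' :: "real \<Rightarrow> real"
  assumes d: "\<And>x. (g has_real_derivative g' x) (at x)" and c: "\<And>x. isCont g' x"
  shows "prim g' x = g x - g 0"
proof -
  consider "x > 0" | "x < 0" | "x = 0" by linarith
  then show ?thesis
  proof cases
    case 1
    have "prim g' x = (\<integral>y. g' y * indicator {0..x} y \<partial>lborel)"
      unfolding prim_def by (rule Bochner_Integration.integral_cong) (use 1 in \<open>auto simp: kern_def indicator_def\<close>)
    also have "\<dots> = g x - g 0" by (rule integral_FTC_Icc_real) (use 1 d c in auto)
    finally show ?thesis .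
  next
    case 2
    have "prim g' x = (\<integral>y. - (g' y * indicator {x..0} y) \<partial>lborel)"
      unfolding prim_def by (rule Bochner_Integration.integral_cong) (use 2 in \<open>auto simp: kern_def indicator_def\<close>)
    also have "\<dots> = - (g 0 - g x)"
      unfolding integral_minus by (rule arg_cong[where f=uminus], rule integral_FTC_Icc_real) (use 2 d c in auto)
    finally show ?thesis by simp
  next
    case 3
    have "kern 0 y = 0" for y by (auto simp: kern_def)
    then show ?thesis using 3 by (simp add: prim_def)
  qed
qed

lemma prim_smooth:
  assumes u: "smooth u" shows "smooth (prim u)" "(prim u has_real_derivative u x) (at x)"
proof -
  obtain F where F: "smooth F" "\<And>x. (F has_real_derivative u x) (at x)"
    by (rule smooth_antiderivative_exists[OF u]) blast
  have eq: "prim u = (\<lambda>x. F x - F 0)"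
    using prim_deriv[OF F(2) smooth_isCont[OF u]] by (simp add: fun_eq_iff)
  show "smooth (prim u)" unfolding eq by (intro smooth_diff F(1) smooth_const)
  show "(prim u has_real_derivative u x) (at x)"
    unfolding eq using F(2)[of x] by (auto intro!: derivative_eq_intros)
qed

lemma indicator_Iic_L2: "indicat_real {..x} \<in> L2 M"
  by (rule L2_M_bounded[of _ 1]) auto

lemma S_measurable: assumes "h \<in> L2 M" shows "S h \<in> borel_measurable borel"
proof -
  interpret finite_measure M by (rule finite_M)
  have [measurable]: "h \<in> borel_measurable borel" by (rule L2_borel[OF assms])
  have "(\<lambda>x. \<integral>y. (if y \<le> x then 1 else 0) * (h y - mean h) \<partial>M) \<in> borel_measurable borel"
    by measurable
  moreover have "(\<lambda>x. \<integral>y. (if y \<le> x then 1 else 0) * (h y - mean h) \<partial>M)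
      = (\<lambda>x. ip M (indicator {..x}) (\<lambda>y. h y - mean h))"
    unfolding ip_def by (intro ext Bochner_Integration.integral_cong) (auto simp: indicator_def)
  ultimately have [measurable]: "(\<lambda>x. ip M (indicator {..x}) (\<lambda>y. h y - mean h)) \<in> borel_measurable borel"
    by simp
  show ?thesis unfolding S_def[abs_def] by measurable
qed

lemma S_adj:
  assumes u: "test_fun u" shows "S (adj u) = u"
proof
  fix x
  have wu: "test_fun (\<lambda>x. w x * u x)" by (rule test_fun_mult_smooth[OF u smooth_w])
  have am: "adj u \<in> borel_measurable borel" by (intro smooth_measurable test_fun_smooth test_fun_adj u)
  have m: "mean (adj u) = 0" using adj_mean_zero[OF u] by (simp add: mean_zero_iff)
  have "ip M (indicator {..x}) (adj u) = (\<integral>y. - (indicator {..x} y * deriv (\<lambda>x. w x * u x) y) \<partial>lborel)"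
    unfolding ip_def deriv_w_times[OF test_fun_smooth[OF u]]
    using am by (subst integral_M) (auto intro!: Bochner_Integration.integral_cong)
  also have "\<dots> = - (w x * u x)" unfolding integral_minus integral_Iic_test_deriv[OF wu] ..
  finally show "S (adj u) x = u x" by (simp add: S_def m)
qed

text \<open>Fubini, with the Lebesgue integrability of u giving absolute convergence on the product.
  The inner integral of the kernel against the mean-free \<open>h0\<close> runs over x \<ge> y if y
  > 0 and, with a minus sign, over x \<le> y if y < 0; mean zero makes both expressions equal to w
  \<open>S h\<close>.\<close>

lemma prim_adjoint:
  assumes u: "integrable lborel u" and h: "h \<in> L2 M"
  shows "ip M (prim u) (\<lambda>x. h x - mean h) = ip M u (S h)"
proof -
  interpret fM: finite_measure M by (rule finite_M)
  interpret P: pair_sigma_finite M lborel ..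
  define h0 where "h0 = (\<lambda>x. h x - mean h)"
  have h0: "h0 \<in> L2 M" unfolding h0_def by (intro L2_diff h const_L2)
  have h0m: "ip M h0 (\<lambda>_. 1) = 0"
    using h by (simp add: mean_zero_iff[symmetric] h0_def mean_diff mean_const)
  have h0i: "integrable M h0" using L2_mult_integrable[OF h0 const_L2[of 1]] by simp
  have [measurable]: "h0 \<in> borel_measurable borel" "u \<in> borel_measurable borel" "S h \<in> borel_measurable borel"
    using L2_borel[OF h0] u S_measurable[OF h] by auto
  have g: "integrable (M \<Otimes>\<^sub>M lborel) (\<lambda>(x, y). \<bar>h0 x\<bar> * \<bar>u y\<bar>)"
  proof (rule P.Fubini_integrable)
    show "integrable M (\<lambda>x. \<integral>y. norm (case (x, y) of (x, y) \<Rightarrow> \<bar>h0 x\<bar> * \<bar>u y\<bar>) \<partial>lborel)"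
      using h0i by (simp add: abs_mult)
    show "AE x in M. integrable lborel (\<lambda>y. case (x, y) of (x, y) \<Rightarrow> \<bar>h0 x\<bar> * \<bar>u y\<bar>)"
      using u by simp
  qed measurable
  have f: "integrable (M \<Otimes>\<^sub>M lborel) (\<lambda>(x, y). kern x y * u y * h0 x)"
  proof (rule Bochner_Integration.integrable_bound[OF g])
    show "(\<lambda>(x, y). kern x y * u y * h0 x) \<in> borel_measurable (M \<Otimes>\<^sub>M lborel)"
      unfolding kern_def by measurable
    have "\<bar>kern x y * u y * h0 x\<bar> \<le> \<bar>h0 x\<bar> * \<bar>u y\<bar>" for x y
      using mult_right_mono[OF kern_abs_le[of x y], of "\<bar>h0 x\<bar> * \<bar>u y\<bar>"] by (simp add: abs_mult mult_ac)
    then show "AE z in M \<Otimes>\<^sub>M lborel. norm (case z of (x, y) \<Rightarrow> kern x y * u y * h0 x)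
        \<le> norm (case z of (x, y) \<Rightarrow> \<bar>h0 x\<bar> * \<bar>u y\<bar>)"
      by (auto intro!: AE_I2)
  qed
  have inner: "(\<integral>x. kern x y * h0 x \<partial>M) = w y * S h y" if "y \<noteq> 0" for y
  proof -
    have ii: "integrable M (\<lambda>x. indicator {..y} x * h0 x)"
      by (intro L2_mult_integrable indicator_Iic_L2 h0)
    have Sh: "w y * S h y = - (\<integral>x. indicator {..y} x * h0 x \<partial>M)"
      by (simp add: S_def ip_def h0_def)
    show ?thesis
    proof (cases "y > 0")
      case True
      have "AE x in M. x \<noteq> y" unfolding AE_M by (rule AE_lborel_singleton)
      then have "AE x in M. kern x y * h0 x = h0 x - indicator {..y} x * h0 x"
        by eventually_elim (use True in \<open>auto simp: kern_def indicator_def\<close>)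
      then have "(\<integral>x. kern x y * h0 x \<partial>M) = (\<integral>x. h0 x - indicator {..y} x * h0 x \<partial>M)"
        unfolding kern_def by (intro integral_cong_AE) measurable
      also have "\<dots> = (\<integral>x. h0 x \<partial>M) - (\<integral>x. indicator {..y} x * h0 x \<partial>M)"
        by (rule Bochner_Integration.integral_diff[OF h0i ii])
      also have "(\<integral>x. h0 x \<partial>M) = 0" using h0m by (simp add: ip_def)
      finally show ?thesis by (simp add: Sh)
    next
      case False
      have "(\<integral>x. kern x y * h0 x \<partial>M) = (\<integral>x. - (indicator {..y} x * h0 x) \<partial>M)"
        by (rule Bochner_Integration.integral_cong) (use False that in \<open>auto simp: kern_def indicator_def\<close>)
      then show ?thesis by (simp add: Sh)
    qed
  qed
  have "ip M (prim u) h0 = (\<integral>x. (\<integral>y. kern x y * u y * h0 x \<partial>lborel) \<partial>M)"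
    unfolding ip_def prim_def by simp
  also have "\<dots> = (\<integral>y. (\<integral>x. kern x y * u y * h0 x \<partial>M) \<partial>lborel)"
    by (rule P.Fubini_integral[OF f, symmetric])
  also have "\<dots> = (\<integral>y. u y * (\<integral>x. kern x y * h0 x \<partial>M) \<partial>lborel)"
    by (subst integral_mult_right_zero[symmetric]) (simp add: mult_ac)
  also have "\<dots> = (\<integral>y. u y * (w y * S h y) \<partial>lborel)"
  proof (rule integral_cong_AE)
    have "AE y in lborel. y \<noteq> (0::real)" by (rule AE_lborel_singleton)
    then show "AE y in lborel. u y * (\<integral>x. kern x y * h0 x \<partial>M) = u y * (w y * S h y)"
      by eventually_elim (simp add: inner)
  qed (unfold kern_def, measurable)
  also have "\<dots> = ip M u (S h)" by (simp add: ip_def integral_M mult_ac)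
  finally show ?thesis by (simp add: h0_def)
qed

section \<open>From the gap to a Poincare inequality\<close>

lemma cutoff_L2_tendsto: "(\<lambda>n. L2norm M (\<lambda>x. cutoff n x - 1)) \<longlonglongrightarrow> 0"
  by (rule L2_dominated_convergence(3)[where d="\<lambda>_. 1"])
    (auto simp: cutoff_tendsto cutoff_nonneg cutoff_le_1 abs_of_nonneg intro!: borel_M smooth_measurable smooth_cutoff)

lemma cutoff_deriv_L2_tendsto: "(\<lambda>n. L2norm M (deriv (cutoff n))) \<longlonglongrightarrow> 0"
proof -
  obtain C where C: "0 < C" "\<And>n x. \<bar>deriv (cutoff n) x\<bar> \<le> C / real (Suc n)" by (rule cutoff_deriv_bound) blast
  have "L2norm M (deriv (cutoff n)) \<le> C / real (Suc n) * sqrt mass" for n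
    using L2norm_bounded[OF finite_M borel_M[OF smooth_measurable[OF smooth_deriv[OF smooth_cutoff]]] C(2)]
    by (simp add: mass_def)
  moreover have "(\<lambda>n. C / real (Suc n) * sqrt mass) \<longlonglongrightarrow> 0 * sqrt mass"
    by (intro tendsto_mult tendsto_const)
      (use tendsto_mult[OF tendsto_const[of C] LIMSEQ_inverse_real_of_nat] in \<open>simp add: divide_inverse\<close>)
  ultimately show ?thesis
    by (intro Lim_null_comparison[of "\<lambda>n. L2norm M (deriv (cutoff n))" "\<lambda>n. C / real (Suc n) * sqrt mass"]) auto
qed

lemma L2norm_const: "L2norm M (\<lambda>_. c) = \<bar>c\<bar> * sqrt mass"
  by (simp add: L2norm_def mass_def real_sqrt_mult)

lemma deriv_diff_scale:
  assumes "smooth f" "smooth g"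
  shows "deriv (\<lambda>x. f x - c * g x) = (\<lambda>x. deriv f x - c * deriv g x)"
proof
  fix x
  show "deriv (\<lambda>x. f x - c * g x) x = deriv f x - c * deriv g x"
    by (intro DERIV_imp_deriv DERIV_diff DERIV_cmult smooth_has_deriv assms)
qed

lemma adj_diff_scale:
  assumes "smooth f" "smooth g"
  shows "adj (\<lambda>x. f x - c * g x) = (\<lambda>x. adj f x - c * adj g x)"
  by (simp add: adj_def fun_eq_iff deriv_diff_scale[OF assms] algebra_simps)

text \<open>A cut-off tends to 1 while its derivative tends to 0, so subtracting a multiple of it
  restores orthogonality to g0 at no cost in the Dirichlet form. In the limit \<phi> is corrected by
  a constant \<alpha>, and the mean approximates \<phi> at least as well as \<alpha>.\<close>

lemma Poincare_from_constraint:
  assumes g0: "g0 \<in> L2 M" and c: "0 < c"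
    and ineq: "\<And>\<phi>. test_fun \<phi> \<Longrightarrow> ip M \<phi> g0 = 0 \<Longrightarrow> c * (L2norm M \<phi>)\<^sup>2 \<le> (L2norm M (deriv \<phi>))\<^sup>2"
    and \<phi>: "test_fun \<phi>"
  shows "L2norm M (\<lambda>x. \<phi> x - mean \<phi>) \<le> (1 / sqrt c) * L2norm M (deriv \<phi>)"
proof -
  define a where "a n = ip M (cutoff n) g0" for n
  define A where "A = ip M (\<lambda>_. 1) g0"
  define d where "d n = L2norm M (deriv (cutoff n))" for n
  define r where "r n = L2norm M (\<lambda>x. cutoff n x - 1)" for n
  have cL: "cutoff n \<in> L2 M" and dcL: "deriv (cutoff n) \<in> L2 M" for n
    by (auto intro: test_L2 test_fun_cutoff test_fun_deriv)
  have d0: "d \<longlonglongrightarrow> 0" and r0: "r \<longlonglongrightarrow> 0"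
    unfolding d_def[abs_def] r_def[abs_def] by (rule cutoff_deriv_L2_tendsto cutoff_L2_tendsto)+
  have aA: "a \<longlonglongrightarrow> A"
    unfolding a_def[abs_def] A_def by (rule ip_tendsto_left[OF cL const_L2 g0 cutoff_L2_tendsto])
  have main: "c * (L2norm M (\<lambda>x. f x - \<alpha>))\<^sup>2 \<le> (L2norm M (deriv f))\<^sup>2"
    if f: "test_fun f" and t: "t \<longlonglongrightarrow> \<alpha>"
      and orth: "\<forall>\<^sub>F n in sequentially. ip M (\<lambda>x. f x - t n * cutoff n x) g0 = 0" for f t \<alpha>
  proof -
    have fL: "f \<in> L2 M" and dfL: "deriv f \<in> L2 M" by (auto intro: test_L2 f test_fun_deriv)
    define F where "F n = (\<lambda>x. f x - t n * cutoff n x)" for n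
    have F: "test_fun (F n)" for n unfolding F_def by (intro test_fun_diff f test_fun_scale test_fun_cutoff)
    have dF: "deriv (F n) = (\<lambda>x. deriv f x - t n * deriv (cutoff n) x)" for n
      unfolding F_def by (rule deriv_diff_scale[OF test_fun_smooth[OF f] smooth_cutoff])
    have FL: "F n \<in> L2 M" and dFL: "deriv (F n) \<in> L2 M" for n by (auto intro: test_L2 F test_fun_deriv)
    have "L2norm M (\<lambda>x. F n x - (f x - \<alpha>)) \<le> \<bar>t n\<bar> * r n + \<bar>\<alpha> - t n\<bar> * sqrt mass" for n
    proof -
      have "(\<lambda>x. F n x - (f x - \<alpha>)) = (\<lambda>x. (- t n) * (cutoff n x - 1) + (\<alpha> - t n))"
        by (simp add: F_def fun_eq_iff algebra_simps)
      then have "L2norm M (\<lambda>x. F n x - (f x - \<alpha>))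
          \<le> L2norm M (\<lambda>x. (- t n) * (cutoff n x - 1)) + L2norm M (\<lambda>_. \<alpha> - t n)"
        using L2norm_triangle[OF L2_scale[OF L2_diff[OF cL[of n] const_L2[of 1]], of "- t n"] const_L2[of "\<alpha> - t n"]]
        by simp
      then show ?thesis unfolding L2norm_scale L2norm_const r_def by simp
    qed
    moreover have "(\<lambda>n. \<bar>t n\<bar> * r n + \<bar>\<alpha> - t n\<bar> * sqrt mass) \<longlonglongrightarrow> \<bar>\<alpha>\<bar> * 0 + \<bar>\<alpha> - \<alpha>\<bar> * sqrt mass"
      by (intro tendsto_intros t r0)
    ultimately have "(\<lambda>n. L2norm M (\<lambda>x. F n x - (f x - \<alpha>))) \<longlonglongrightarrow> 0"
      by (intro Lim_null_comparison[of "\<lambda>n. L2norm M (\<lambda>x. F n x - (f x - \<alpha>))"]) auto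
    then have 1: "(\<lambda>n. L2norm M (F n)) \<longlonglongrightarrow> L2norm M (\<lambda>x. f x - \<alpha>)"
      by (rule L2norm_tendsto[OF FL L2_diff[OF fL const_L2]])
    have "(\<lambda>n. L2norm M (\<lambda>x. deriv (F n) x - deriv f x)) \<longlonglongrightarrow> 0"
    proof -
      have "(\<lambda>x. deriv (F n) x - deriv f x) = (\<lambda>x. (- t n) * deriv (cutoff n) x)" for n
        by (simp add: dF fun_eq_iff)
      then have "(\<lambda>n. L2norm M (\<lambda>x. deriv (F n) x - deriv f x)) = (\<lambda>n. \<bar>t n\<bar> * d n)"
        unfolding d_def by (simp only: L2norm_scale abs_minus_cancel)
      moreover have "(\<lambda>n. \<bar>t n\<bar> * d n) \<longlonglongrightarrow> \<bar>\<alpha>\<bar> * 0" by (intro tendsto_intros t d0)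
      ultimately show ?thesis by simp
    qed
    then have 2: "(\<lambda>n. L2norm M (deriv (F n))) \<longlonglongrightarrow> L2norm M (deriv f)"
      by (rule L2norm_tendsto[OF dFL dfL])
    show ?thesis
    proof (rule tendsto_le[OF sequentially_bot])
      show "(\<lambda>n. c * (L2norm M (F n))\<^sup>2) \<longlonglongrightarrow> c * (L2norm M (\<lambda>x. f x - \<alpha>))\<^sup>2"
        by (intro tendsto_intros 1)
      show "(\<lambda>n. (L2norm M (deriv (F n)))\<^sup>2) \<longlonglongrightarrow> (L2norm M (deriv f))\<^sup>2"
        by (intro tendsto_intros 2)
      show "\<forall>\<^sub>F n in sequentially. c * (L2norm M (F n))\<^sup>2 \<le> (L2norm M (deriv (F n)))\<^sup>2"
        using orth by eventually_elim (rule ineq[OF F], simp add: F_def)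
    qed
  qed
  have ip_F: "ip M (\<lambda>x. f x - t * cutoff n x) g0 = ip M f g0 - t * a n" if "test_fun f" for f t n
    using that by (simp add: ip_diff_left test_L2 L2_scale cL g0 ip_scale_left a_def)
  \<comment> \<open>Solving for the multiple requires that constants are not orthogonal to g0. If
    they were, 1 itself would be a limit of admissible functions whose derivatives tend to 0,
    against c > 0.\<close>
  have A: "A \<noteq> 0"
  proof
    assume A0: "A = 0"
    \<comment> \<open>Take \<open>t\<^sub>n\<close> so that \<open>cutoff\<^sub>n - t\<^sub>n cutoff\<^sub>m\<close> is orthogonal to \<open>g0\<close>; division by zero gives the right value if every \<open>a\<^sub>n\<close> vanishes.\<close>
    obtain m where m: "a m \<noteq> 0 \<or> (\<forall>n. a n = 0)" by blast
    define t where "t n = a n / a m" for n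
    define G where "G n = (\<lambda>x. cutoff n x - t n * cutoff m x)" for n
    have G: "test_fun (G n)" for n unfolding G_def by (intro test_fun_diff test_fun_scale test_fun_cutoff)
    have "ip M (G n) g0 = 0" for n unfolding G_def ip_F[OF test_fun_cutoff] using m by (auto simp: t_def a_def[symmetric])
    then have Gin: "c * (L2norm M (G n))\<^sup>2 \<le> (L2norm M (deriv (G n)))\<^sup>2" for n by (rule ineq[OF G])
    have t0: "t \<longlonglongrightarrow> 0" unfolding t_def[abs_def] using tendsto_divide_zero[OF aA[unfolded A0]] .
    have "L2norm M (\<lambda>x. G n x - 1) \<le> r n + \<bar>t n\<bar> * L2norm M (cutoff m)" for n
    proof -
      have "(\<lambda>x. G n x - 1) = (\<lambda>x. (cutoff n x - 1) - t n * cutoff m x)" by (simp add: G_def fun_eq_iff)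
      then show ?thesis
        using L2norm_triangle_diff[OF L2_diff[OF cL[of n] const_L2[of 1]] L2_scale[OF cL[of m], of "t n"]]
        by (simp add: r_def L2norm_scale)
    qed
    moreover have "(\<lambda>n. r n + \<bar>t n\<bar> * L2norm M (cutoff m)) \<longlonglongrightarrow> 0 + \<bar>0\<bar> * L2norm M (cutoff m)"
      by (intro tendsto_intros t0 r0)
    ultimately have "(\<lambda>n. L2norm M (\<lambda>x. G n x - 1)) \<longlonglongrightarrow> 0"
      by (intro Lim_null_comparison[of "\<lambda>n. L2norm M (\<lambda>x. G n x - 1)"]) auto
    then have 1: "(\<lambda>n. L2norm M (G n)) \<longlonglongrightarrow> L2norm M (\<lambda>_. 1)"
      by (rule L2norm_tendsto[OF test_L2[OF G] const_L2])
    have "L2norm M (deriv (G n)) \<le> d n + \<bar>t n\<bar> * d m" for n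
      unfolding G_def deriv_diff_scale[OF smooth_cutoff smooth_cutoff]
      using L2norm_triangle_diff[OF dcL[of n] L2_scale[OF dcL[of m], of "t n"]] by (simp add: d_def L2norm_scale)
    moreover have "(\<lambda>n. d n + \<bar>t n\<bar> * d m) \<longlonglongrightarrow> 0 + \<bar>0\<bar> * d m" by (intro tendsto_intros t0 d0)
    ultimately have 2: "(\<lambda>n. L2norm M (deriv (G n))) \<longlonglongrightarrow> 0"
      by (intro Lim_null_comparison[of "\<lambda>n. L2norm M (deriv (G n))"]) auto
    have "c * (L2norm M (\<lambda>_. 1))\<^sup>2 \<le> 0\<^sup>2"
      by (rule LIMSEQ_le[of "\<lambda>n. c * (L2norm M (G n))\<^sup>2" _ "\<lambda>n. (L2norm M (deriv (G n)))\<^sup>2"])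
        (use Gin in \<open>auto intro!: tendsto_intros 1 tendsto_eq_intros(1) tendsto_power[OF 2, of 2, simplified]\<close>)
    then show False using c mass_pos by (simp add: L2norm_const mult_le_0_iff)
  qed
  define \<alpha> where "\<alpha> = ip M \<phi> g0 / A"
  have "c * (L2norm M (\<lambda>x. \<phi> x - \<alpha>))\<^sup>2 \<le> (L2norm M (deriv \<phi>))\<^sup>2"
  proof (rule main[OF \<phi>, of "\<lambda>n. ip M \<phi> g0 / a n"])
    show "(\<lambda>n. ip M \<phi> g0 / a n) \<longlonglongrightarrow> \<alpha>" unfolding \<alpha>_def by (intro tendsto_intros aA A)
    have "\<forall>\<^sub>F n in sequentially. a n \<noteq> 0" by (rule tendsto_imp_eventually_ne[OF aA A])
    then show "\<forall>\<^sub>F n in sequentially. ip M (\<lambda>x. \<phi> x - ip M \<phi> g0 / a n * cutoff n x) g0 = 0"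
      by eventually_elim (subst ip_F[OF \<phi>], simp)
  qed
  then have "(sqrt c * L2norm M (\<lambda>x. \<phi> x - \<alpha>))\<^sup>2 \<le> (L2norm M (deriv \<phi>))\<^sup>2"
    using c by (simp add: power_mult_distrib)
  then have "sqrt c * L2norm M (\<lambda>x. \<phi> x - \<alpha>) \<le> L2norm M (deriv \<phi>)" by (rule power2_le_imp_le) simp
  then have "L2norm M (\<lambda>x. \<phi> x - \<alpha>) \<le> (1 / sqrt c) * L2norm M (deriv \<phi>)"
    using c by (simp add: field_simps)
  then show ?thesis using L2norm_minus_mean_le[OF test_L2[OF \<phi>], of \<alpha>] by linarith
qed

end

section \<open>Boundedness under a Poincare inequality\<close>

lemma closure_graphI:
  assumes "f \<in> L2 M" "g \<in> L2 M"
    and "\<And>\<epsilon>. 0 < \<epsilon> \<Longrightarrow> \<exists>\<phi>. test_fun \<phi> \<and> L2norm M (\<lambda>x. \<phi> x - f x) < \<epsilon> \<and> L2norm M (\<lambda>x. T \<phi> x - g x) < \<epsilon>"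
  shows "(f, g) \<in> closure_graph M T"
proof -
  have "\<exists>\<phi>. test_fun \<phi> \<and> L2norm M (\<lambda>x. \<phi> x - f x) < inverse (real (Suc k))
      \<and> L2norm M (\<lambda>x. T \<phi> x - g x) < inverse (real (Suc k))" for k
    by (rule assms(3)) simp
  then obtain \<phi> where p: "\<And>k. test_fun (\<phi> k)" "\<And>k. L2norm M (\<lambda>x. \<phi> k x - f x) < inverse (real (Suc k))"
    "\<And>k. L2norm M (\<lambda>x. T (\<phi> k) x - g x) < inverse (real (Suc k))"
    by metis
  have "(\<lambda>k. L2norm M (\<lambda>x. \<phi> k x - f x)) \<longlonglongrightarrow> 0" "(\<lambda>k. L2norm M (\<lambda>x. T (\<phi> k) x - g x)) \<longlonglongrightarrow> 0"
    by (rule Lim_null_comparison[OF _ LIMSEQ_inverse_real_of_nat];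
        use p(2,3) in \<open>auto intro!: always_eventually less_imp_le\<close>)+
  then show ?thesis using p(1) assms(1,2) unfolding closure_graph_def by blast
qed

locale Poincare_line = weighted_line +
  fixes C :: real
  assumes C_pos: "0 < C"
    and Poincare: "test_fun \<phi> \<Longrightarrow> L2norm M (\<lambda>x. \<phi> x - mean \<phi>) \<le> C * L2norm M (deriv \<phi>)"
begin

lemma mean_tendsto:
  assumes "\<And>k. f k \<in> L2 M" "g \<in> L2 M" "(\<lambda>k. L2norm M (\<lambda>x. f k x - g x)) \<longlonglongrightarrow> 0"
  shows "(\<lambda>k. mean (f k)) \<longlonglongrightarrow> mean g"
  unfolding mean_def using mass_pos
  by (intro tendsto_divide tendsto_const ip_tendsto_left[OF assms(1,2) const_L2 assms(3)]) simp

lemma prim_test_L2: assumes u: "test_fun u" shows "prim u \<in> L2 M"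
  by (rule L2_M_bounded[OF _ prim_abs_le[OF test_fun_integrable[OF u]]])
    (intro prim_measurable smooth_measurable test_fun_smooth u)

text \<open>\<open>prim u\<close> is constant near each end but need not vanish there, so the
  Poincare inequality is applied to its product with a cut-off. The extra term in the derivative is
  at most \<open>B\<close> times the derivative of the cut-off and disappears in the limit.\<close>

lemma R_bound_test: assumes u: "test_fun u" shows "L2norm M (R u) \<le> C * L2norm M u"
proof -
  define B where "B = (\<integral>y. \<bar>u y\<bar> \<partial>lborel)"
  have B: "\<bar>prim u x\<bar> \<le> B" for x unfolding B_def by (rule prim_abs_le[OF test_fun_integrable[OF u]])
  obtain Bu where Bu: "0 < Bu" "\<And>x. \<bar>u x\<bar> \<le> Bu" by (rule test_fun_bounded[OF u]) blast
  obtain D where D: "0 < D" "\<And>n x. \<bar>deriv (cutoff n) x\<bar> \<le> D / real (Suc n)" by (rule cutoff_deriv_bound) blast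
  have us: "smooth u" by (rule test_fun_smooth[OF u])
  have uL: "u \<in> L2 M" by (rule test_L2[OF u])
  have pL: "prim u \<in> L2 M" by (rule prim_test_L2[OF u])
  define F where "F n = (\<lambda>x. prim u x * cutoff n x)" for n
  have F: "test_fun (F n)" for n
    unfolding F_def by (rule test_fun_mult_smooth[OF test_fun_cutoff prim_smooth(1)[OF us]])
  have dF: "deriv (F n) = (\<lambda>x. u x * cutoff n x + deriv (cutoff n) x * prim u x)" for n
  proof
    fix x show "deriv (F n) x = u x * cutoff n x + deriv (cutoff n) x * prim u x"
      unfolding F_def
      by (rule DERIV_imp_deriv, rule DERIV_mult[OF prim_smooth(2)[OF us] smooth_has_deriv[OF smooth_cutoff]])
  qed
  have meas: "f \<in> borel_measurable M" if "test_fun f" for f using test_L2[OF that] L2_measurable by blast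
  have F_lim: "(\<lambda>n. L2norm M (\<lambda>x. F n x - prim u x)) \<longlonglongrightarrow> 0"
  proof (rule L2_dominated_convergence(3)[where d="\<lambda>_. B"])
    have "(\<lambda>n. F n x) \<longlonglongrightarrow> prim u x * 1" for x
      unfolding F_def by (intro tendsto_intros cutoff_tendsto)
    then show "AE x in M. (\<lambda>n. F n x) \<longlonglongrightarrow> prim u x" by simp
    have "\<bar>F n x\<bar> \<le> B * 1" for n x
      unfolding F_def abs_mult using B[of x]
      by (intro mult_mono) (auto simp: cutoff_nonneg cutoff_le_1 intro: order_trans[OF abs_ge_zero])
    then show "AE x in M. \<bar>F n x\<bar> \<le> B" for n by simp
  qed (auto intro!: meas F L2_measurable[OF pL])
  have dF_lim: "(\<lambda>n. L2norm M (\<lambda>x. deriv (F n) x - u x)) \<longlonglongrightarrow> 0"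
  proof (rule L2_dominated_convergence(3)[where d="\<lambda>_. Bu + D * B"])
    have D0: "(\<lambda>n. deriv (cutoff n) x) \<longlonglongrightarrow> 0" for x
      by (rule Lim_null_comparison[of _ "\<lambda>n. D / real (Suc n)"])
        (use D(2) tendsto_mult[OF tendsto_const[of D] LIMSEQ_inverse_real_of_nat] in \<open>auto simp: divide_inverse\<close>)
    have "(\<lambda>n. deriv (F n) x) \<longlonglongrightarrow> u x * 1 + 0 * prim u x" for x
      unfolding dF by (intro tendsto_intros cutoff_tendsto D0)
    then show "AE x in M. (\<lambda>n. deriv (F n) x) \<longlonglongrightarrow> u x" by simp
    have "\<bar>deriv (F n) x\<bar> \<le> Bu * 1 + D * B" for n x
    proof -
      have "D / real (Suc n) \<le> D" using D(1) by (simp add: field_simps)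
      then have "\<bar>deriv (cutoff n) x\<bar> \<le> D" using D(2)[of n x] by linarith
      then have "\<bar>deriv (cutoff n) x * prim u x\<bar> \<le> D * B"
        unfolding abs_mult using B[of x] D(1) by (intro mult_mono) auto
      moreover have "\<bar>u x * cutoff n x\<bar> \<le> Bu * 1"
        unfolding abs_mult using Bu by (intro mult_mono) (auto simp: cutoff_nonneg cutoff_le_1)
      ultimately show ?thesis unfolding dF by linarith
    qed
    then show "AE x in M. \<bar>deriv (F n) x\<bar> \<le> Bu + D * B" for n by simp
  qed (auto intro!: meas F test_fun_deriv u)
  have mF: "(\<lambda>n. mean (F n)) \<longlonglongrightarrow> mean (prim u)"
    by (rule mean_tendsto[OF test_L2[OF F] pL F_lim])
  have "(\<lambda>n. L2norm M (\<lambda>x. F n x - mean (F n))) \<longlonglongrightarrow> L2norm M (R u)"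
  proof (rule L2norm_tendsto)
    show "R u \<in> L2 M" unfolding R_def[abs_def] by (intro L2_diff pL const_L2)
    show "(\<lambda>x. F n x - mean (F n)) \<in> L2 M" for n by (intro L2_diff test_L2 F const_L2)
    have "L2norm M (\<lambda>x. (F n x - mean (F n)) - R u x) \<le> L2norm M (\<lambda>x. F n x - prim u x)" for n
      using L2norm_minus_mean_le'[OF L2_diff[OF test_L2[OF F[of n]] pL]]
      by (simp add: R_def mean_diff[OF test_L2[OF F] pL] algebra_simps)
    then show "(\<lambda>n. L2norm M (\<lambda>x. (F n x - mean (F n)) - R u x)) \<longlonglongrightarrow> 0"
      by (intro Lim_null_comparison[OF _ F_lim]) auto
  qed
  moreover have "(\<lambda>n. C * L2norm M (deriv (F n))) \<longlonglongrightarrow> C * L2norm M u"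
    by (intro tendsto_intros L2norm_tendsto[OF _ uL dF_lim] test_L2 test_fun_deriv F)
  ultimately show ?thesis
    by (rule LIMSEQ_le) (use Poincare[OF F] in auto)
qed

lemma prim_tendsto:
  assumes "\<And>k. u k \<in> L2 M" "u' \<in> L2 M" "(\<lambda>k. L2norm M (\<lambda>x. u k x - u' x)) \<longlonglongrightarrow> 0"
  shows "(\<lambda>k. prim (u k) x) \<longlonglongrightarrow> prim u' x"
  using ip_tendsto_left[OF assms(1,2) kern_weight_L2 assms(3)]
  by (simp add: prim_eq_ip assms(1,2) ip_commute[of M "\<lambda>y. kern x y / w y"])

text \<open>Uniform in x because |\<open>kern x\<close>| is dominated by |\<open>kern 1\<close>| for
  x in [0, 1].\<close>

lemma prim_bound_unit_interval:
  assumes u: "u \<in> L2 M" and x: "x \<in> {0..1}"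
  shows "\<bar>prim u x\<bar> \<le> L2norm M (\<lambda>y. kern 1 y / w y) * L2norm M u"
proof -
  have "\<bar>prim u x\<bar> \<le> L2norm M (\<lambda>y. kern x y / w y) * L2norm M u"
    unfolding prim_eq_ip[OF u] by (rule ip_Cauchy_Schwarz[OF kern_weight_L2 u])
  also have "\<dots> \<le> L2norm M (\<lambda>y. kern 1 y / w y) * L2norm M u"
  proof (rule mult_right_mono[OF L2norm_mono[OF kern_weight_L2 kern_weight_L2]])
    have "\<bar>kern x y\<bar> \<le> \<bar>kern 1 y\<bar>" for y using x by (auto simp: kern_def)
    then show "AE y in M. \<bar>kern x y / w y\<bar> \<le> \<bar>kern 1 y / w y\<bar>"
      by (intro AE_I2) (simp add: abs_of_pos[OF w_pos] divide_right_mono less_imp_le[OF w_pos])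
  qed simp
  finally show ?thesis .
qed

text \<open>Square integrability of \<open>prim u\<close> is not known yet, so a constant m stands
  in for its mean. For approximating test functions the images under \<open>R\<close> are bounded in
  norm and the primitives are bounded on [0, 1]; hence the subtracted means are bounded, a
  subsequence of them converges, and Fatou passes to the limit.\<close>

lemma prim_L2_aux:
  assumes u: "u \<in> L2 M"
  shows "\<exists>m. (\<lambda>x. prim u x - m) \<in> L2 M \<and> L2norm M (\<lambda>x. prim u x - m) \<le> C * L2norm M u"
proof -
  obtain \<phi> where \<phi>: "\<And>k. test_fun (\<phi> k)" and lim: "(\<lambda>k. L2norm M (\<lambda>x. \<phi> k x - u x)) \<longlonglongrightarrow> 0"
    by (rule test_fun_dense_sequence[OF finite_M sets_M u]) blast
  have \<phi>L: "\<phi> k \<in> L2 M" and pL: "prim (\<phi> k) \<in> L2 M" for k by (auto intro: test_L2 \<phi> prim_test_L2)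
  have nl: "(\<lambda>k. L2norm M (\<phi> k)) \<longlonglongrightarrow> L2norm M u" by (rule L2norm_tendsto[OF \<phi>L u lim])
  then obtain N where "\<And>k. norm (L2norm M (\<phi> k)) \<le> N"
    using convergent_imp_Bseq[OF convergentI[OF nl]] unfolding Bseq_def by blast
  then have N: "L2norm M (\<phi> k) \<le> N" for k by simp
  define f where "f k = R (\<phi> k)" for k
  define m where "m k = mean (prim (\<phi> k))" for k
  have fL: "f k \<in> L2 M" for k unfolding f_def R_def[abs_def] by (intro L2_diff pL const_L2)
  have fb: "L2norm M (f k) \<le> C * L2norm M (\<phi> k)" for k unfolding f_def by (rule R_bound_test[OF \<phi>])
  \<comment> \<open>On \<open>{0..1}\<close> the primitives are uniformly bounded, which bounds their means.\<close>
  let ?I = "indicat_real {0..1}"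
  have IL: "?I \<in> L2 M" by (rule L2_M_bounded[of _ 1]) auto
  have I1: "ip M ?I (\<lambda>_. 1) = measure M {0..1}" by (simp add: ip_def)
  define P where "P = L2norm M (\<lambda>y. kern 1 y / w y) * N"
  have P: "\<bar>prim (\<phi> k) x * ?I x\<bar> \<le> P" for k x
  proof (cases "x \<in> {0..1}")
    case True
    have "\<bar>prim (\<phi> k) x\<bar> \<le> L2norm M (\<lambda>y. kern 1 y / w y) * L2norm M (\<phi> k)"
      by (rule prim_bound_unit_interval[OF \<phi>L True])
    also have "\<dots> \<le> P" unfolding P_def by (intro mult_left_mono N) simp
    finally show ?thesis using True by simp
  next
    case False
    have "0 \<le> P" unfolding P_def
      by (intro mult_nonneg_nonneg order_trans[OF L2norm_nonneg N]) simp
    then show ?thesis using False by simp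
  qed
  have mb: "\<bar>m k\<bar> \<le> (P * mass + C * N * L2norm M ?I) / measure M {0..1}" for k
  proof -
    have "f k = (\<lambda>x. prim (\<phi> k) x - m k)" by (simp add: f_def R_def[abs_def] m_def)
    then have "ip M (f k) ?I = ip M (prim (\<phi> k)) ?I - m k * measure M {0..1}"
      by (simp add: ip_diff_left[OF pL const_L2 IL] ip_const_left I1)
    moreover have "\<bar>ip M (f k) ?I\<bar> \<le> C * N * L2norm M ?I"
    proof -
      have "\<bar>ip M (f k) ?I\<bar> \<le> L2norm M (f k) * L2norm M ?I" by (rule ip_Cauchy_Schwarz[OF fL IL])
      also have "\<dots> \<le> (C * N) * L2norm M ?I"
        using C_pos by (intro mult_right_mono order_trans[OF fb mult_left_mono[OF N]]) auto
      finally show ?thesis .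
    qed
    moreover have "\<bar>ip M (prim (\<phi> k)) ?I\<bar> \<le> P * mass"
    proof -
      interpret finite_measure M by (rule finite_M)
      have "\<bar>\<integral>x. prim (\<phi> k) x * ?I x \<partial>M\<bar> \<le> (\<integral>x. \<bar>prim (\<phi> k) x * ?I x\<bar> \<partial>M)"
        using integral_norm_bound[of M "\<lambda>x. prim (\<phi> k) x * ?I x"] by simp
      also have "\<dots> \<le> (\<integral>x. P \<partial>M)"
        by (rule integral_mono) (use P L2_mult_integrable[OF pL[of k] IL] in auto)
      finally show ?thesis by (simp add: ip_def mass_def mult.commute)
    qed
    ultimately have "\<bar>m k * measure M {0..1}\<bar> \<le> P * mass + C * N * L2norm M ?I" by linarith
    then have "\<bar>m k\<bar> * measure M {0..1} \<le> P * mass + C * N * L2norm M ?I"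
      by (simp add: abs_mult)
    then show ?thesis using measure_M_Icc_pos[of 0 1] by (simp add: pos_le_divide_eq)
  qed
  then have "bounded (range m)" unfolding bounded_iff by auto
  then obtain l r where r: "strict_mono r" and l: "(m \<circ> r) \<longlonglongrightarrow> l"
    using bounded_imp_convergent_subsequence by blast
  have "(\<lambda>k. f (r k) x) \<longlonglongrightarrow> prim u x - l" for x
  proof -
    have "(\<lambda>k. prim (\<phi> (r k)) x) \<longlonglongrightarrow> prim u x"
      using LIMSEQ_subseq_LIMSEQ[OF prim_tendsto[OF \<phi>L u lim] r] by (simp add: o_def)
    then show ?thesis using l unfolding f_def R_def m_def o_def by (intro tendsto_diff)
  qed
  moreover have "(\<lambda>k. C * L2norm M (\<phi> (r k))) \<longlonglongrightarrow> C * L2norm M u"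
    using LIMSEQ_subseq_LIMSEQ[OF nl r] by (intro tendsto_intros) (simp add: o_def)
  moreover have "(\<lambda>x. prim u x - l) \<in> borel_measurable M"
    by (intro borel_M borel_measurable_diff prim_measurable L2_borel u) simp
  ultimately have "(\<lambda>x. prim u x - l) \<in> L2 M \<and> L2norm M (\<lambda>x. prim u x - l) \<le> C * L2norm M u"
    using L2_Fatou[of "\<lambda>k. f (r k)" M "\<lambda>x. prim u x - l" "\<lambda>k. C * L2norm M (\<phi> (r k))" "C * L2norm M u"] fL fb
    by simp
  then show ?thesis by blast
qed

lemma prim_L2: assumes u: "u \<in> L2 M" shows "prim u \<in> L2 M"
proof -
  obtain m where "(\<lambda>x. prim u x - m) \<in> L2 M" using prim_L2_aux[OF u] by blast
  then have "(\<lambda>x. (prim u x - m) + m) \<in> L2 M" by (rule L2_add[OF _ const_L2])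
  then show ?thesis by simp
qed

lemma R_L2: "u \<in> L2 M \<Longrightarrow> R u \<in> L2 M"
  unfolding R_def[abs_def] by (intro L2_diff prim_L2 const_L2)

lemma R_bound: assumes u: "u \<in> L2 M" shows "L2norm M (R u) \<le> C * L2norm M u"
proof -
  obtain m where "L2norm M (\<lambda>x. prim u x - m) \<le> C * L2norm M u" using prim_L2_aux[OF u] by blast
  then show ?thesis
    using L2norm_minus_mean_le[OF prim_L2[OF u], of m] by (simp add: R_def[abs_def])
qed

lemma R_add: "u \<in> L2 M \<Longrightarrow> u' \<in> L2 M \<Longrightarrow> R (\<lambda>x. u x + u' x) = (\<lambda>x. R u x + R u' x)"
  by (simp add: R_def fun_eq_iff prim_add mean_add prim_L2)

lemma R_scale: "R (\<lambda>x. c * u x) = (\<lambda>x. c * R u x)"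
  by (simp add: R_def fun_eq_iff prim_scale mean_scale right_diff_distrib)

lemma R_diff: "u \<in> L2 M \<Longrightarrow> u' \<in> L2 M \<Longrightarrow> R (\<lambda>x. u x - u' x) = (\<lambda>x. R u x - R u' x)"
  using R_add[of u "\<lambda>x. -1 * u' x"] R_scale[of "-1" u'] L2_scale[of u' M "-1"] by simp

lemma R_cong: "u \<in> L2 M \<Longrightarrow> u' \<in> L2 M \<Longrightarrow> AE x in M. u x = u' x \<Longrightarrow> R u = R u'"
  using prim_cong_AE[of u u'] by (simp add: R_def[abs_def])

lemma R_mean_zero: "u \<in> L2 M \<Longrightarrow> ip M (R u) (\<lambda>_. 1) = 0"
  unfolding mean_zero_iff[symmetric] R_def[abs_def] by (simp add: mean_diff prim_L2 mean_const)

section \<open>Linearity of \<open>S\<close> and its bound by duality\<close>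

lemma S_add: 
  assumes "h \<in> L2 M" "g \<in> L2 M" shows "S (\<lambda>x. h x + g x) = (\<lambda>x. S h x + S g x)"
proof
  fix x
  have "(\<lambda>y. h y + g y - (mean h + mean g)) = (\<lambda>y. (h y - mean h) + (g y - mean g))"
    by (simp add: fun_eq_iff)
  then have "ip M (indicator {..x}) (\<lambda>y. h y + g y - (mean h + mean g))
     = ip M (indicator {..x}) (\<lambda>y. h y - mean h) + ip M (indicator {..x}) (\<lambda>y. g y - mean g)"
    using assms by (simp add: ip_add_right L2_diff indicator_Iic_L2)
  then show "S (\<lambda>x. h x + g x) x = S h x + S g x"
    using assms by (simp add: S_def mean_add field_simps)
qed

lemma S_scale: "S (\<lambda>x. c * h x) = (\<lambda>x. c * S h x)"
proof
  fix x
  have "(\<lambda>y. c * h y - c * mean h) = (\<lambda>y. c * (h y - mean h))" by (simp add: fun_eq_iff algebra_simps)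
  then have "ip M (indicator {..x}) (\<lambda>y. c * h y - c * mean h) = c * ip M (indicator {..x}) (\<lambda>y. h y - mean h)"
    by (simp only: ip_scale_right)
  then show "S (\<lambda>x. c * h x) x = c * S h x" by (simp add: S_def mean_scale)
qed

lemma S_diff: "u \<in> L2 M \<Longrightarrow> u' \<in> L2 M \<Longrightarrow> S (\<lambda>x. u x - u' x) = (\<lambda>x. S u x - S u' x)"
  using S_add[of u "\<lambda>x. -1 * u' x"] S_scale[of "-1" u'] L2_scale[of u' M "-1"] by simp

lemma S_cong:
  assumes "h \<in> L2 M" "g \<in> L2 M" "AE x in M. h x = g x" shows "S h = S g"
proof
  fix x
  have "mean h = mean g" by (rule mean_cong_AE[OF assms(3,1,2)])
  then have "ip M (indicator {..x}) (\<lambda>y. h y - mean h) = ip M (indicator {..x}) (\<lambda>y. g y - mean g)"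
    using assms by (intro ip_cong_AE) (auto intro!: L2_diff indicator_Iic_L2)
  then show "S h x = S g x" by (simp add: S_def)
qed

lemma S_one: "S (\<lambda>_. 1) = (\<lambda>_. 0)"
  by (simp add: S_def[abs_def] mean_const ip_def)

lemma S_locally_bounded:
  assumes h: "h \<in> L2 M"
  obtains B where "\<And>x. \<bar>x\<bar> \<le> T \<Longrightarrow> \<bar>S h x\<bar> \<le> B"
proof -
  obtain B where B: "0 < B" "\<And>x. \<bar>x\<bar> \<le> T \<Longrightarrow> 1 / w x \<le> B" by (rule inverse_weight_bounded) blast
  define N where "N = L2norm M (\<lambda>_. 1) * L2norm M (\<lambda>y. h y - mean h)"
  have hL: "(\<lambda>y. h y - mean h) \<in> L2 M" by (intro L2_diff h const_L2)
  have "\<bar>ip M (indicator {..x}) (\<lambda>y. h y - mean h)\<bar> \<le> N" for x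
  proof -
    have "\<bar>ip M (indicator {..x}) (\<lambda>y. h y - mean h)\<bar> \<le> L2norm M (indicator {..x}) * L2norm M (\<lambda>y. h y - mean h)"
      by (rule ip_Cauchy_Schwarz[OF indicator_Iic_L2 hL])
    also have "\<dots> \<le> N" unfolding N_def
      by (intro mult_right_mono L2norm_mono indicator_Iic_L2 const_L2) (auto simp: indicator_def)
    finally show ?thesis .
  qed
  then have "\<bar>ip M (indicator {..x}) (\<lambda>y. h y - mean h)\<bar> * (1 / w x) \<le> N * B" if "\<bar>x\<bar> \<le> T" for x
    using B that by (intro mult_mono) (auto simp: less_imp_le intro: order_trans[OF abs_ge_zero])
  then have "\<bar>S h x\<bar> \<le> N * B" if "\<bar>x\<bar> \<le> T" for x
    using that by (simp add: S_def abs_of_pos[OF w_pos])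
  then show ?thesis by (rule that)
qed

definition trunc :: "nat \<Rightarrow> (real \<Rightarrow> real) \<Rightarrow> real \<Rightarrow> real" where
  "trunc n u = (\<lambda>x. indicator {- real n..real n} x * u x)"

text \<open>On a compact interval 1 / w is bounded, so the truncation is w times a product of two
  functions in L2.\<close>

lemma trunc_integrable: assumes "u \<in> L2 M" shows "integrable lborel (trunc n u)"
proof -
  obtain B where B: "0 < B" "\<And>x. \<bar>x\<bar> \<le> real n \<Longrightarrow> 1 / w x \<le> B" by (rule inverse_weight_bounded) blast
  have [measurable]: "u \<in> borel_measurable borel" by (rule L2_borel[OF assms])
  have "(\<lambda>x. indicator {- real n..real n} x * (1 / w x)) \<in> L2 M"
  proof (rule L2_M_bounded[of _ B])
    show "\<bar>indicator {- real n..real n} x * (1 / w x)\<bar> \<le> B" for x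
      using B by (auto simp: indicator_def abs_of_pos[OF w_pos] less_imp_le)
  qed measurable
  then have "integrable M (\<lambda>x. (indicator {- real n..real n} x * (1 / w x)) * u x)"
    by (rule L2_mult_integrable[OF _ assms])
  then have "integrable lborel (\<lambda>x. w x * ((indicator {- real n..real n} x * (1 / w x)) * u x))"
    by (subst (asm) integrable_M) measurable
  moreover have "(\<lambda>x. w x * ((indicator {- real n..real n} x * (1 / w x)) * u x)) = trunc n u"
    by (simp add: trunc_def fun_eq_iff)
  ultimately show ?thesis by simp
qed

lemma trunc_measurable: "u \<in> borel_measurable borel \<Longrightarrow> trunc n u \<in> borel_measurable borel"
  unfolding trunc_def by measurable

lemma trunc_tendsto: "(\<lambda>n. trunc n u x) \<longlonglongrightarrow> u x"
proof (rule tendsto_eventually)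
  obtain N where "\<bar>x\<bar> \<le> real N" using real_arch_simple by blast
  then have "trunc n u x = u x" if "N \<le> n" for n using that by (auto simp: trunc_def indicator_def)
  then show "\<forall>\<^sub>F n in sequentially. trunc n u x = u x" by (rule eventually_sequentiallyI)
qed

lemma trunc_abs_le: "\<bar>trunc n u x\<bar> \<le> \<bar>u x\<bar>"
  by (simp add: trunc_def indicator_def)

lemma trunc_L2: assumes u: "u \<in> L2 M" shows "trunc n u \<in> L2 M"
  by (rule L2_bounded_by[OF u borel_M[OF trunc_measurable[OF L2_borel[OF u]]]]) (simp add: trunc_abs_le)

lemma trunc_L2_tendsto:
  assumes u: "u \<in> L2 M"
  shows "(\<lambda>n. L2norm M (\<lambda>x. trunc n u x - u x)) \<longlonglongrightarrow> 0"
  by (rule L2_dominated_convergence(3)[OF L2_measurable[OF trunc_L2[OF u]] L2_measurable[OF u] L2_abs[OF u]])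
    (auto simp: trunc_tendsto trunc_abs_le)

lemma R_adjoint_integrable:
  assumes u: "u \<in> L2 M" "integrable lborel u" and h: "h \<in> L2 M"
  shows "ip M (R u) h = ip M u (S h)"
proof -
  have hL: "(\<lambda>x. h x - mean h) \<in> L2 M" by (intro L2_diff h const_L2)
  have "ip M (\<lambda>x. h x - mean h) (\<lambda>_. 1) = 0"
    unfolding mean_zero_iff[symmetric] using h by (simp add: mean_diff mean_const)
  then have 1: "ip M (\<lambda>_. c) (\<lambda>x. h x - mean h) = 0" for c by (simp add: ip_const_left)
  have "ip M (R u) h = ip M (R u) (\<lambda>x. h x - mean h)"
    using ip_const_right[of "R u" "mean h"] R_mean_zero[OF u(1)]
    by (simp add: ip_diff_right[OF h const_L2 R_L2[OF u(1)]])
  also have "\<dots> = ip M (prim u) (\<lambda>x. h x - mean h)"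
    unfolding R_def[abs_def] by (simp add: ip_diff_left[OF prim_L2[OF u(1)] const_L2 hL] 1)
  also have "\<dots> = ip M u (S h)" by (rule prim_adjoint[OF u(2) h])
  finally show ?thesis .
qed

text \<open>Duality before \<open>S h\<close> is known to be square integrable: its truncations are
  bounded, and the adjoint identity bounds the squared norm of each by C times its own norm times
  that of h. Norm zero is treated apart for the division, and Fatou removes the truncation.\<close>

lemma S_L2: "h \<in> L2 M \<Longrightarrow> S h \<in> L2 M"
  and S_bound: "h \<in> L2 M \<Longrightarrow> L2norm M (S h) \<le> C * L2norm M h"
proof -
  assume h: "h \<in> L2 M"
  have tL: "trunc n (S h) \<in> L2 M" and ti: "integrable lborel (trunc n (S h))" for n
  proof -
    obtain B where B: "\<And>x. \<bar>x\<bar> \<le> real n \<Longrightarrow> \<bar>S h x\<bar> \<le> B" by (rule S_locally_bounded[OF h]) blast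
    have "\<bar>trunc n (S h) x\<bar> \<le> max B 0" for x using B[of x] by (auto simp: trunc_def indicator_def abs_le_iff)
    then show tL: "trunc n (S h) \<in> L2 M" by (rule L2_M_bounded[OF trunc_measurable[OF S_measurable[OF h]]])
    have "trunc n (trunc n (S h)) = trunc n (S h)" by (auto simp: trunc_def indicator_def fun_eq_iff)
    then show "integrable lborel (trunc n (S h))" using trunc_integrable[OF tL, of n] by simp
  qed
  have bd: "L2norm M (trunc n (S h)) \<le> C * L2norm M h" for n
  proof (cases "L2norm M (trunc n (S h)) = 0")
    case True
    then show ?thesis using C_pos by simp
  next
    case False
    have "(L2norm M (trunc n (S h)))\<^sup>2 = ip M (trunc n (S h)) (S h)"
      unfolding ip_self_eq[symmetric] ip_def
      by (rule Bochner_Integration.integral_cong) (auto simp: trunc_def indicator_def)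
    also have "\<dots> = ip M (R (trunc n (S h))) h" by (rule R_adjoint_integrable[OF tL ti h, symmetric])
    also have "\<dots> \<le> L2norm M (R (trunc n (S h))) * L2norm M h"
      using ip_Cauchy_Schwarz[OF R_L2[OF tL] h, of n] by linarith
    also have "\<dots> \<le> (C * L2norm M (trunc n (S h))) * L2norm M h"
      by (intro mult_right_mono R_bound tL) simp
    finally have "L2norm M (trunc n (S h)) * L2norm M (trunc n (S h)) \<le> L2norm M (trunc n (S h)) * (C * L2norm M h)"
      by (simp add: power2_eq_square mult_ac)
    moreover have "0 < L2norm M (trunc n (S h))" using False L2norm_nonneg[of M "trunc n (S h)"] by linarith
    ultimately show ?thesis by (rule mult_left_le_imp_le)
  qed
  show "S h \<in> L2 M" "L2norm M (S h) \<le> C * L2norm M h"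
    using L2_Fatou[of "\<lambda>n. trunc n (S h)", OF tL _ borel_M[OF S_measurable[OF h]] bd tendsto_const]
      trunc_tendsto by auto
qed

text \<open>Both sides are continuous in u, so truncation removes the assumption of Lebesgue
  integrability.\<close>

lemma R_adjoint:
  assumes u: "u \<in> L2 M" and h: "h \<in> L2 M"
  shows "ip M (R u) h = ip M u (S h)"
proof (rule LIMSEQ_unique)
  show "(\<lambda>n. ip M (trunc n u) (S h)) \<longlonglongrightarrow> ip M u (S h)"
    by (rule ip_tendsto_left[OF trunc_L2[OF u] u S_L2[OF h] trunc_L2_tendsto[OF u]])
  have "(\<lambda>n. L2norm M (\<lambda>x. R (trunc n u) x - R u x)) \<longlonglongrightarrow> 0"
  proof (rule Lim_null_comparison)
    show "(\<lambda>n. C * L2norm M (\<lambda>x. trunc n u x - u x)) \<longlonglongrightarrow> 0"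
      using tendsto_mult_right_zero[OF trunc_L2_tendsto[OF u]] .
    show "\<forall>\<^sub>F n in sequentially. norm (L2norm M (\<lambda>x. R (trunc n u) x - R u x)) \<le> C * L2norm M (\<lambda>x. trunc n u x - u x)"
      using R_bound[OF L2_diff[OF trunc_L2[OF u] u]] by (simp add: R_diff[OF trunc_L2[OF u] u])
  qed
  then have "(\<lambda>n. ip M (R (trunc n u)) h) \<longlonglongrightarrow> ip M (R u) h"
    by (rule ip_tendsto_left[OF R_L2[OF trunc_L2[OF u]] R_L2[OF u] h])
  then show "(\<lambda>n. ip M (trunc n u) (S h)) \<longlonglongrightarrow> ip M (R u) h"
    by (simp add: R_adjoint_integrable[OF trunc_L2[OF u] trunc_integrable[OF u] h])
qed

end

section \<open>The closures of the two products\<close>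

context Poincare_line
begin

lemma R_deriv:
  assumes \<phi>: "test_fun \<phi>" shows "R (deriv \<phi>) = (\<lambda>x. \<phi> x - mean \<phi>)"
proof -
  have s: "smooth \<phi>" by (rule test_fun_smooth[OF \<phi>])
  have p: "prim (deriv \<phi>) = (\<lambda>x. \<phi> x - \<phi> 0)"
    using prim_deriv[OF smooth_has_deriv[OF s] smooth_isCont[OF smooth_deriv[OF s]]] by (simp add: fun_eq_iff)
  have "mean (prim (deriv \<phi>)) = mean \<phi> - \<phi> 0"
    unfolding p using test_L2[OF \<phi>] by (simp add: mean_diff mean_const)
  then show ?thesis by (simp add: R_def[abs_def] p)
qed

lemma S_minus_const:
  assumes "h \<in> L2 M" shows "S (\<lambda>x. h x - c) = S h"
  using S_diff[OF assms const_L2[of c]] S_scale[of c "\<lambda>_. 1"] by (simp add: S_one)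

lemma RS_adj_deriv: "test_fun \<phi> \<Longrightarrow> R (S (adj (deriv \<phi>))) = (\<lambda>x. \<phi> x - mean \<phi>)"
  by (simp add: S_adj test_fun_deriv R_deriv)

lemma SR_deriv_adj: "test_fun u \<Longrightarrow> S (R (deriv (adj u))) = u"
  by (simp add: R_deriv test_fun_adj S_minus_const test_L2 S_adj)

lemma RS_bound:
  assumes h: "h \<in> L2 M" and g: "g \<in> L2 M"
  shows "L2norm M (\<lambda>x. R (S h) x - R (S g) x) \<le> C\<^sup>2 * L2norm M (\<lambda>x. h x - g x)"
proof -
  have d: "(\<lambda>x. h x - g x) \<in> L2 M" by (rule L2_diff[OF h g])
  have "(\<lambda>x. R (S h) x - R (S g) x) = R (S (\<lambda>x. h x - g x))"
    by (simp add: S_diff[OF h g] R_diff[OF S_L2[OF h] S_L2[OF g]])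
  then have "L2norm M (\<lambda>x. R (S h) x - R (S g) x) \<le> C * L2norm M (S (\<lambda>x. h x - g x))"
    using R_bound[OF S_L2[OF d]] by simp
  also have "\<dots> \<le> C * (C * L2norm M (\<lambda>x. h x - g x))"
    using C_pos by (intro mult_left_mono S_bound d) auto
  finally show ?thesis by (simp add: power2_eq_square)
qed

lemma SR_bound:
  assumes h: "h \<in> L2 M" and g: "g \<in> L2 M"
  shows "L2norm M (\<lambda>x. S (R h) x - S (R g) x) \<le> C\<^sup>2 * L2norm M (\<lambda>x. h x - g x)"
proof -
  have d: "(\<lambda>x. h x - g x) \<in> L2 M" by (rule L2_diff[OF h g])
  have "(\<lambda>x. S (R h) x - S (R g) x) = S (R (\<lambda>x. h x - g x))"
    by (simp add: R_diff[OF h g] S_diff[OF R_L2[OF h] R_L2[OF g]])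
  then have "L2norm M (\<lambda>x. S (R h) x - S (R g) x) \<le> C * L2norm M (R (\<lambda>x. h x - g x))"
    using S_bound[OF R_L2[OF d]] by simp
  also have "\<dots> \<le> C * (C * L2norm M (\<lambda>x. h x - g x))"
    using C_pos by (intro mult_left_mono R_bound d) auto
  finally show ?thesis by (simp add: power2_eq_square)
qed

text \<open>This puts the pair of 1 and 0 into the closure of the lower operator. The derivative of
  e is a bump of integral 1 left of -1 minus one right of 1, both with small \<open>adj\<close>, so
  e is 1 on [-1, 1]. Boundedness of R S brings e close to its mean, and the value 1 on [-1, 1]
  forces the mean close to 1.\<close>

lemma near_one:
  assumes \<eta>: "0 < \<eta>"
  obtains e where "test_fun e" "L2norm M (adj (deriv e)) < \<eta>" "L2norm M (\<lambda>x. e x - 1) < \<eta>"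
proof -
  define \<mu> where "\<mu> = sqrt (measure M {-1..1})"
  have \<mu>: "0 < \<mu>" using measure_M_Icc_pos[of "-1" 1] by (simp add: \<mu>_def)
  \<comment> \<open>The three parts of \<open>E\<close> pay for \<open>adj (deriv e)\<close>, for
    the distance of e to its mean, and for the distance of the mean to 1; dividing by \<mu> reflects
    that e is known to be 1 on [-1, 1] only.\<close>
  define E where "E = 1 + C\<^sup>2 * (1 + sqrt mass / \<mu>)"
  have E1: "1 \<le> E" using \<mu> mass_pos by (simp add: E_def)
  define \<epsilon> where "\<epsilon> = \<eta> / (2 * E)"
  have \<epsilon>: "0 < \<epsilon>" using \<eta> E1 by (simp add: \<epsilon>_def)
  obtain vR where vR: "test_fun vR" "\<And>x. x \<notin> {1<..} \<Longrightarrow> vR x = 0" "(\<integral>x. vR x \<partial>lborel) = 1" "L2norm M (adj vR) < \<epsilon>"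
    using small_adj_unit_integral[of "{1<..}", OF _ \<epsilon>] by blast
  obtain vL where vL: "test_fun vL" "\<And>x. x \<notin> {..< -1} \<Longrightarrow> vL x = 0" "(\<integral>x. vL x \<partial>lborel) = 1" "L2norm M (adj vL) < \<epsilon>"
    using small_adj_unit_integral[of "{..< -1}", OF _ \<epsilon>] by blast
  define u where "u = (\<lambda>x. vL x - 1 * vR x)"
  have u: "test_fun u" unfolding u_def by (intro test_fun_diff test_fun_scale vL vR)
  have "(\<integral>x. u x \<partial>lborel) = 0"
    unfolding u_def using vL(3) vR(3) test_fun_integrable[OF vL(1)] test_fun_integrable[OF vR(1)] by simp
  then obtain e where e: "test_fun e" "deriv e = u" by (rule test_fun_antiderivative[OF u])
  \<comment> \<open>For such x the half-line up to x contains the support of \<open>vL\<close> and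
    misses that of \<open>vR\<close>.\<close>
  have one: "e x = 1" if "x \<in> {-1..1}" for x
  proof -
    have "e x = (\<integral>y. indicator {..x} y * u y \<partial>lborel)" using integral_Iic_test_deriv[OF e(1), of x] e(2) by simp
    also have "\<dots> = (\<integral>y. vL y \<partial>lborel)"
    proof (rule Bochner_Integration.integral_cong)
      show "indicator {..x} y * u y = vL y" for y
        using vL(2)[of y] vR(2)[of y] that by (auto simp: u_def indicator_def)
    qed simp
    finally show ?thesis using vL(3) by simp
  qed
  have aL: "adj vL \<in> L2 M" "adj vR \<in> L2 M" "adj u \<in> L2 M" by (auto intro!: test_L2 test_fun_adj vL vR u)
  have "adj u = (\<lambda>x. adj vL x - 1 * adj vR x)"
    unfolding u_def by (rule adj_diff_scale[OF test_fun_smooth[OF vL(1)] test_fun_smooth[OF vR(1)]])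
  then have au: "L2norm M (adj u) < 2 * \<epsilon>"
    using L2norm_triangle_diff[OF aL(1,2)] vL(4) vR(4) by simp
  have eL: "e \<in> L2 M" by (rule test_L2[OF e(1)])
  define m where "m = mean e"
  have "(\<lambda>x. e x - m) = (\<lambda>x. R (S (adj u)) x - R (S (\<lambda>_. 0)) x)"
    using RS_adj_deriv[OF e(1)] S_scale[of 0 "\<lambda>_. 0"] R_scale[of 0 "\<lambda>_. 0"] by (simp add: e(2) m_def)
  then have "L2norm M (\<lambda>x. e x - m) \<le> C\<^sup>2 * L2norm M (adj u)"
    using RS_bound[OF aL(3) L2_zero] by simp
  also have "\<dots> \<le> C\<^sup>2 * (2 * \<epsilon>)" using au by (intro mult_left_mono) auto
  finally have em: "L2norm M (\<lambda>x. e x - m) \<le> C\<^sup>2 * (2 * \<epsilon>)" .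
  have IL: "indicat_real {-1..1} \<in> L2 M" by (rule L2_M_bounded[of _ 1]) auto
  have "L2norm M (\<lambda>x. (1 - m) * indicat_real {-1..1} x) \<le> L2norm M (\<lambda>x. e x - m)"
    by (rule L2norm_mono[OF L2_diff[OF eL const_L2] L2_scale[OF IL]])
      (auto simp: indicator_def one intro!: AE_I2)
  moreover have "L2norm M (indicat_real {-1..1}) = \<mu>"
  proof -
    have "(indicat_real {-1..1} x)\<^sup>2 = indicat_real {-1..1} x" for x :: real
      by (simp add: indicator_def)
    then show ?thesis by (simp add: L2norm_def \<mu>_def)
  qed
  ultimately have "\<bar>1 - m\<bar> * \<mu> \<le> C\<^sup>2 * (2 * \<epsilon>)" using em by (simp add: L2norm_scale)
  then have m1: "\<bar>1 - m\<bar> \<le> C\<^sup>2 * (2 * \<epsilon>) / \<mu>" using \<mu> by (simp add: pos_le_divide_eq)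
  have "L2norm M (\<lambda>x. e x - 1) \<le> L2norm M (\<lambda>x. e x - m) + L2norm M (\<lambda>_. m - 1)"
    using L2norm_triangle_mid[OF eL const_L2[of m] const_L2[of 1]] .
  also have "\<dots> \<le> C\<^sup>2 * (2 * \<epsilon>) + C\<^sup>2 * (2 * \<epsilon>) / \<mu> * sqrt mass"
    unfolding L2norm_const using em mult_right_mono[OF m1, of "sqrt mass"] mass_pos
    by (simp add: abs_minus_commute)
  also have "\<dots> = (E - 1) * (2 * \<epsilon>)" by (simp add: E_def algebra_simps)
  also have "\<dots> < E * (2 * \<epsilon>)" using \<epsilon> by simp
  also have "\<dots> = \<eta>" using E1 by (simp add: \<epsilon>_def)
  finally have "L2norm M (\<lambda>x. e x - 1) < \<eta>" .
  moreover have "2 * \<epsilon> \<le> E * (2 * \<epsilon>)" using E1 \<epsilon> by simp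
  then have "2 * \<epsilon> \<le> \<eta>" using E1 by (simp add: \<epsilon>_def)
  then have "L2norm M (adj (deriv e)) < \<eta>" using au by (simp add: e(2))
  ultimately show ?thesis using that e(1) by blast
qed

text \<open>A close approximation has almost the right mean; a multiple of a fixed cut-off repairs
  it, and Cauchy-Schwarz controls the multiple. \<open>K\<close> is the factor by which this repair
  can enlarge the error.\<close>

lemma mean_zero_test_dense:
  assumes h: "h \<in> L2 M" and hm: "ip M h (\<lambda>_. 1) = 0" and \<delta>: "0 < \<delta>"
  obtains \<psi> where "test_fun \<psi>" "ip M \<psi> (\<lambda>_. 1) = 0" "L2norm M (\<lambda>x. \<psi> x - h x) < \<delta>"
proof -
  define c where "c = ip M (cutoff 0) (\<lambda>_. 1)"
  have cL: "cutoff 0 \<in> L2 M" by (rule test_L2[OF test_fun_cutoff])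
  have c: "0 < c"
  proof -
    interpret finite_measure M by (rule finite_M)
    have "0 < measure M {-1..1}" by (rule measure_M_Icc_pos) simp
    also have "measure M {-1..1} = (\<integral>x. indicator {-1..1} x \<partial>M)" by simp
    also have "\<dots> \<le> (\<integral>x. cutoff 0 x * 1 \<partial>M)"
    proof (rule integral_mono)
      show "integrable M (\<lambda>x. cutoff 0 x * 1)" by (rule L2_mult_integrable[OF cL const_L2])
      show "indicat_real {-1..1} x \<le> cutoff 0 x * 1" for x
        by (cases "x \<in> {-1..1}") (auto simp: cutoff_eq_1 cutoff_nonneg abs_le_iff)
    qed (auto simp: sets_M emeasure_eq_measure intro!: integrable_real_indicator)
    finally show ?thesis by (simp add: c_def ip_def)
  qed
  define K where "K = 1 + sqrt mass * L2norm M (cutoff 0) / c"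
  have K: "0 < K" unfolding K_def using c mass_pos by (intro add_pos_nonneg) auto
  obtain \<psi>0 where p: "test_fun \<psi>0" "L2norm M (\<lambda>x. \<psi>0 x - h x) < \<delta> / K"
    using test_fun_dense[OF finite_M sets_M h, of "\<delta> / K"] \<delta> K by auto
  have pL: "\<psi>0 \<in> L2 M" by (rule test_L2[OF p(1)])
  define t where "t = ip M \<psi>0 (\<lambda>_. 1) / c"
  have "ip M \<psi>0 (\<lambda>_. 1) = ip M (\<lambda>x. \<psi>0 x - h x) (\<lambda>_. 1)"
    using hm by (simp add: ip_diff_left[OF pL h const_L2])
  then have "\<bar>ip M \<psi>0 (\<lambda>_. 1)\<bar> \<le> L2norm M (\<lambda>x. \<psi>0 x - h x) * sqrt mass"
    using ip_Cauchy_Schwarz[OF L2_diff[OF pL h] const_L2[of 1]] L2norm_const[of 1] by simp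
  then have t: "\<bar>t\<bar> \<le> L2norm M (\<lambda>x. \<psi>0 x - h x) * sqrt mass / c"
    using c by (simp add: t_def divide_right_mono)
  define \<psi> where "\<psi> = (\<lambda>x. \<psi>0 x - t * cutoff 0 x)"
  have "L2norm M (\<lambda>x. \<psi> x - h x) \<le> L2norm M (\<lambda>x. \<psi>0 x - h x) + \<bar>t\<bar> * L2norm M (cutoff 0)"
  proof -
    have "(\<lambda>x. \<psi> x - h x) = (\<lambda>x. (\<psi>0 x - h x) - t * cutoff 0 x)" by (simp add: \<psi>_def fun_eq_iff)
    then show ?thesis
      using L2norm_triangle_diff[OF L2_diff[OF pL h] L2_scale[OF cL, of t]] by (simp add: L2norm_scale)
  qed
  also have "\<dots> \<le> L2norm M (\<lambda>x. \<psi>0 x - h x) + L2norm M (\<lambda>x. \<psi>0 x - h x) * sqrt mass / c * L2norm M (cutoff 0)"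
    using mult_right_mono[OF t, of "L2norm M (cutoff 0)"] by simp
  also have "\<dots> = L2norm M (\<lambda>x. \<psi>0 x - h x) * K" by (simp add: K_def algebra_simps)
  also have "\<dots> < \<delta>" using p(2) K by (simp add: pos_less_divide_eq)
  finally have "L2norm M (\<lambda>x. \<psi> x - h x) < \<delta>" .
  moreover have "test_fun \<psi>" unfolding \<psi>_def by (intro test_fun_diff p(1) test_fun_scale test_fun_cutoff)
  moreover have "ip M \<psi> (\<lambda>_. 1) = 0"
    unfolding \<psi>_def using c
    by (simp only: ip_diff_left[OF pL L2_scale[OF cL] const_L2] ip_scale_left) (simp add: t_def c_def)
  ultimately show ?thesis using that by blast
qed

text \<open>Worked backwards from h: a mean-zero approximation is in the range of
  \<open>adj\<close>, the Lebesgue integral of its preimage is cancelled by a corrector, and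
  integration gives \<phi> up to a constant, which a multiple of a function from
  \<open>near_one\<close> supplies. Closeness to f follows from closeness to h because R S is
  bounded.\<close>

lemma lower_core:
  assumes f: "f \<in> L2 M" and h: "h \<in> L2 M" and hm: "ip M h (\<lambda>_. 1) = 0"
    and AEf: "AE x in M. f x = m + R (S h) x" and \<epsilon>: "0 < \<epsilon>"
  shows "\<exists>\<phi>. test_fun \<phi> \<and> L2norm M (\<lambda>x. \<phi> x - f x) < \<epsilon> \<and> L2norm M (\<lambda>x. adj (deriv \<phi>) x - h x) < \<epsilon>"
proof -
  \<comment> \<open>The error in h will be below 3 \<delta> and that in f below (2 C^2 + 1)
    \<delta>; both fit into 4 (1 + C^2) \<delta> = \<epsilon>.\<close>
  define \<delta> where "\<delta> = \<epsilon> / (4 * (1 + C\<^sup>2))"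
  have D: "0 < 1 + C\<^sup>2" by (simp add: add_pos_nonneg)
  have \<delta>: "0 < \<delta>" using \<epsilon> D by (simp add: \<delta>_def)
  have \<delta>\<epsilon>: "4 * \<delta> + C\<^sup>2 * (4 * \<delta>) = \<epsilon>" using D by (simp add: \<delta>_def divide_simps) (simp add: algebra_simps)
  obtain \<psi> where \<psi>: "test_fun \<psi>" "ip M \<psi> (\<lambda>_. 1) = 0" "L2norm M (\<lambda>x. \<psi> x - h x) < \<delta>"
    by (rule mean_zero_test_dense[OF h hm \<delta>]) blast
  obtain u where u: "test_fun u" "adj u = \<psi>" by (rule adj_preimage[OF \<psi>(1,2)]) blast
  define I where "I = (\<integral>x. u x \<partial>lborel)"
  \<comment> \<open>The corrector enters with coefficient \<open>I\<close>; the added 1 covers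
    \<open>I\<close> = 0.\<close>
  have "0 < \<delta> / (1 + \<bar>I\<bar>)" using \<delta> by (simp add: add_pos_nonneg)
  then obtain q where q: "test_fun q" "(\<integral>x. q x \<partial>lborel) = 1" "L2norm M (adj q) < \<delta> / (1 + \<bar>I\<bar>)"
    using small_adj_unit_integral[of "{1<..}"] by blast
  have small: "\<bar>t\<bar> * s < \<delta>" if "s < \<delta> / (1 + \<bar>t\<bar>)" "0 \<le> s" for s t
  proof -
    have "s * (1 + \<bar>t\<bar>) < \<delta>" using that(1) by (simp add: pos_less_divide_eq add_pos_nonneg)
    then show ?thesis using that(2) by (simp add: algebra_simps)
  qed
  define u' where "u' = (\<lambda>x. u x - I * q x)"
  have u': "test_fun u'" unfolding u'_def by (intro test_fun_diff u test_fun_scale q)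
  have "(\<integral>x. u' x \<partial>lborel) = 0"
    unfolding u'_def using test_fun_integrable[OF u(1)] test_fun_integrable[OF q(1)] q(2) by (simp add: I_def)
  then obtain \<phi>0 where p: "test_fun \<phi>0" "deriv \<phi>0 = u'" by (rule test_fun_antiderivative[OF u'])
  have qL: "adj q \<in> L2 M" and \<psi>L: "\<psi> \<in> L2 M" and u'L: "adj u' \<in> L2 M" and pL: "\<phi>0 \<in> L2 M"
    by (auto intro: test_L2 test_fun_adj q \<psi> u' p)
  have au': "adj u' = (\<lambda>x. \<psi> x - I * adj q x)"
    unfolding u'_def adj_diff_scale[OF test_fun_smooth[OF u(1)] test_fun_smooth[OF q(1)]] u(2) ..
  have 1: "L2norm M (\<lambda>x. adj u' x - h x) < 2 * \<delta>"
  proof -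
    have "(\<lambda>x. adj u' x - h x) = (\<lambda>x. (\<psi> x - h x) - I * adj q x)" by (simp add: au' fun_eq_iff)
    then have "L2norm M (\<lambda>x. adj u' x - h x) \<le> L2norm M (\<lambda>x. \<psi> x - h x) + \<bar>I\<bar> * L2norm M (adj q)"
      using L2norm_triangle_diff[OF L2_diff[OF \<psi>L h] L2_scale[OF qL, of I]] by (simp add: L2norm_scale)
    then show ?thesis using \<psi>(3) small[OF q(3)] by simp
  qed
  define m0 where "m0 = mean \<phi>0"
  define t where "t = m - m0"
  have "0 < \<delta> / (1 + \<bar>t\<bar>)" using \<delta> by (simp add: add_pos_nonneg)
  then obtain e where e: "test_fun e" "L2norm M (adj (deriv e)) < \<delta> / (1 + \<bar>t\<bar>)" "L2norm M (\<lambda>x. e x - 1) < \<delta> / (1 + \<bar>t\<bar>)"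
    by (rule near_one) blast
  have eL: "e \<in> L2 M" "adj (deriv e) \<in> L2 M" by (auto intro: test_L2 test_fun_adj test_fun_deriv e)
  define \<phi> where "\<phi> = (\<lambda>x. \<phi>0 x - (- t) * e x)"
  have \<phi>: "test_fun \<phi>" unfolding \<phi>_def by (intro test_fun_diff p test_fun_scale e)
  have "deriv \<phi> = (\<lambda>x. u' x - (- t) * deriv e x)"
    unfolding \<phi>_def deriv_diff_scale[OF test_fun_smooth[OF p(1)] test_fun_smooth[OF e(1)]] p(2) ..
  then have a\<phi>: "adj (deriv \<phi>) = (\<lambda>x. adj u' x - (- t) * adj (deriv e) x)"
    using adj_diff_scale[OF test_fun_smooth[OF u'] smooth_deriv[OF test_fun_smooth[OF e(1)]], of "- t"] by simp
  have "L2norm M (\<lambda>x. adj (deriv \<phi>) x - h x) \<le> L2norm M (\<lambda>x. adj u' x - h x) + \<bar>t\<bar> * L2norm M (adj (deriv e))"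
  proof -
    have "(\<lambda>x. adj (deriv \<phi>) x - h x) = (\<lambda>x. (adj u' x - h x) + t * adj (deriv e) x)"
      by (simp add: a\<phi> fun_eq_iff)
    then show ?thesis
      using L2norm_triangle[OF L2_diff[OF u'L h] L2_scale[OF eL(2), of t]] by (simp add: L2norm_scale)
  qed
  then have N3: "L2norm M (\<lambda>x. adj (deriv \<phi>) x - h x) < 3 * \<delta>"
    using 1 small[OF e(2)] by simp
  have RSh: "R (S h) \<in> L2 M" by (intro R_L2 S_L2 h)
  have "R (S (adj u')) = (\<lambda>x. \<phi>0 x - m0)" using RS_adj_deriv[OF p(1)] by (simp add: p(2) m0_def)
  then have 2: "L2norm M (\<lambda>x. (\<phi>0 x - m0) - R (S h) x) \<le> C\<^sup>2 * (2 * \<delta>)"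
    using RS_bound[OF u'L h] mult_left_mono[OF less_imp_le[OF 1], of "C\<^sup>2"] by simp
  have "L2norm M (\<lambda>x. \<phi> x - f x) = L2norm M (\<lambda>x. \<phi> x - (m + R (S h) x))"
  proof (rule L2norm_cong_AE)
    show "AE x in M. \<phi> x - f x = \<phi> x - (m + R (S h) x)" using AEf by eventually_elim simp
  qed (intro L2_diff L2_add test_L2 \<phi> f const_L2 RSh)+
  also have "(\<lambda>x. \<phi> x - (m + R (S h) x)) = (\<lambda>x. ((\<phi>0 x - m0) - R (S h) x) + t * (e x - 1))"
    by (simp add: \<phi>_def t_def fun_eq_iff algebra_simps)
  also have "L2norm M \<dots> \<le> L2norm M (\<lambda>x. (\<phi>0 x - m0) - R (S h) x) + \<bar>t\<bar> * L2norm M (\<lambda>x. e x - 1)"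
    using L2norm_triangle[OF L2_diff[OF L2_diff[OF pL const_L2[of m0]] RSh] L2_scale[OF L2_diff[OF eL(1) const_L2[of 1]], of t]]
    by (simp add: L2norm_scale)
  also have "\<dots> < C\<^sup>2 * (2 * \<delta>) + \<delta>" using 2 small[OF e(3)] by simp
  finally have F3: "L2norm M (\<lambda>x. \<phi> x - f x) < C\<^sup>2 * (2 * \<delta>) + \<delta>" .
  have "0 \<le> C\<^sup>2 * \<delta>" using \<delta> by simp
  then have "C\<^sup>2 * (2 * \<delta>) + \<delta> \<le> \<epsilon>" "3 * \<delta> \<le> \<epsilon>" using \<delta>\<epsilon> \<delta> by linarith+
  then show ?thesis using N3 F3 \<phi> by (intro exI[of _ \<phi>]) auto
qed

text \<open>On test functions the description is exact, with m the mean. Mean and R S are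
  continuous, so for a limit pair the defect d has norm zero, which is the first inclusion.\<close>

lemma closure_graph_lower:
  "closure_graph M (\<lambda>\<phi>. adj (deriv \<phi>)) = {(f, h). f \<in> L2 M \<and> h \<in> L2 M \<and> ip M h (\<lambda>_. 1) = 0 \<and>
     (\<exists>m. AE x in M. f x = m + R (S h) x)}"
proof (intro equalityI subsetI; clarify)
  fix f h assume "(f, h) \<in> closure_graph M (\<lambda>\<phi>. adj (deriv \<phi>))"
  then obtain \<phi> where f: "f \<in> L2 M" and h: "h \<in> L2 M" and \<phi>: "\<And>k. test_fun (\<phi> k)"
    and l1: "(\<lambda>k. L2norm M (\<lambda>x. \<phi> k x - f x)) \<longlonglongrightarrow> 0"
    and l2: "(\<lambda>k. L2norm M (\<lambda>x. adj (deriv (\<phi> k)) x - h x)) \<longlonglongrightarrow> 0"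
    by (auto simp: closure_graph_def)
  define \<psi> where "\<psi> k = adj (deriv (\<phi> k))" for k
  have \<psi>L: "\<psi> k \<in> L2 M" and \<phi>L: "\<phi> k \<in> L2 M" for k
    by (auto simp: \<psi>_def intro: test_L2 test_fun_adj test_fun_deriv \<phi>)
  have "(\<lambda>k. ip M (\<psi> k) (\<lambda>_. 1)) \<longlonglongrightarrow> ip M h (\<lambda>_. 1)"
    by (rule ip_tendsto_left[OF \<psi>L h const_L2]) (use l2 in \<open>simp add: \<psi>_def\<close>)
  moreover have "ip M (\<psi> k) (\<lambda>_. 1) = 0" for k unfolding \<psi>_def by (intro adj_mean_zero test_fun_deriv \<phi>)
  ultimately have hm: "ip M h (\<lambda>_. 1) = 0" by (simp add: LIMSEQ_const_iff)
  define d where "d = (\<lambda>x. (f x - mean f) - R (S h) x)"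
  have dL: "d \<in> L2 M" unfolding d_def by (intro L2_diff f const_L2 R_L2 S_L2 h)
  have "L2norm M d \<le> L2norm M (\<lambda>x. \<phi> k x - f x) + C\<^sup>2 * L2norm M (\<lambda>x. \<psi> k x - h x)" for k
  proof -
    have fd: "(\<lambda>x. f x - \<phi> k x) \<in> L2 M" by (intro L2_diff f \<phi>L)
    have "d = (\<lambda>x. ((f x - \<phi> k x) - mean (\<lambda>x. f x - \<phi> k x)) + (R (S (\<psi> k)) x - R (S h) x))"
      using RS_adj_deriv[OF \<phi>, of k] by (simp add: d_def \<psi>_def mean_diff[OF f \<phi>L] fun_eq_iff)
    then have "L2norm M d \<le> L2norm M (\<lambda>x. (f x - \<phi> k x) - mean (\<lambda>x. f x - \<phi> k x)) + L2norm M (\<lambda>x. R (S (\<psi> k)) x - R (S h) x)"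
      using L2norm_triangle[OF L2_diff[OF fd const_L2[of "mean (\<lambda>x. f x - \<phi> k x)"]]
          L2_diff[OF R_L2[OF S_L2[OF \<psi>L[of k]]] R_L2[OF S_L2[OF h]]]] by simp
    then show ?thesis
      using L2norm_minus_mean_le'[OF fd] RS_bound[OF \<psi>L[of k] h] L2norm_diff_commute[of M f "\<phi> k"] by linarith
  qed
  moreover have "(\<lambda>k. L2norm M (\<lambda>x. \<phi> k x - f x) + C\<^sup>2 * L2norm M (\<lambda>x. \<psi> k x - h x)) \<longlonglongrightarrow> 0 + C\<^sup>2 * 0"
    using l2 by (intro tendsto_intros l1) (simp add: \<psi>_def)
  ultimately have "L2norm M d \<le> 0 + C\<^sup>2 * 0" by (intro LIMSEQ_le_const[of _ "0 + C\<^sup>2 * 0" "L2norm M d"]) auto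
  then have "L2norm M d = 0" using L2norm_nonneg[of M d] by simp
  then have "AE x in M. d x = 0" using L2norm_eq_0_iff[OF dL] by blast
  then have "AE x in M. f x = mean f + R (S h) x" by eventually_elim (simp add: d_def)
  then show "f \<in> L2 M \<and> h \<in> L2 M \<and> ip M h (\<lambda>_. 1) = 0 \<and> (\<exists>m. AE x in M. f x = m + R (S h) x)"
    using f h hm by blast
next
  fix f h m assume "f \<in> L2 M" "h \<in> L2 M" "ip M h (\<lambda>_. 1) = 0" "AE x in M. f x = m + R (S h) x"
  then show "(f, h) \<in> closure_graph M (\<lambda>\<phi>. adj (deriv \<phi>))"
    by (intro closure_graphI lower_core)
qed

text \<open>The two scalar conditions come in the opposite order. The Lebesgue integral of
  \<open>k1\<close> is removed with a wide cut-off, whose integral grows while its norm stays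
  bounded, and the mean of the primitive with a cut-off of small derivative. Cut-offs suffice
  because \<open>adj\<close> is never applied to them: u is found afterwards as a preimage.\<close>

lemma upper_core:
  assumes k: "k \<in> L2 M" and \<epsilon>: "0 < \<epsilon>"
  shows "\<exists>u. test_fun u \<and> L2norm M (\<lambda>x. u x - S (R k) x) < \<epsilon> \<and> L2norm M (\<lambda>x. deriv (adj u) x - k x) < \<epsilon>"
proof -
  define \<delta> where "\<delta> = \<epsilon> / (4 * (1 + C\<^sup>2))"
  have D: "0 < 1 + C\<^sup>2" by (simp add: add_pos_nonneg)
  have \<delta>: "0 < \<delta>" using \<epsilon> D by (simp add: \<delta>_def)
  have \<delta>\<epsilon>: "4 * \<delta> + C\<^sup>2 * (4 * \<delta>) = \<epsilon>" using D by (simp add: \<delta>_def divide_simps) (simp add: algebra_simps)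
  obtain k1 where k1: "test_fun k1" "L2norm M (\<lambda>x. k1 x - k x) < \<delta>"
    by (rule test_fun_dense[OF finite_M sets_M k \<delta>]) blast
  define i where "i = (\<integral>x. k1 x \<partial>lborel)"
  have cL: "cutoff n \<in> L2 M" for n by (rule test_L2[OF test_fun_cutoff])
  have cn: "L2norm M (cutoff n) \<le> sqrt mass" for n
    using L2norm_bounded[OF finite_M L2_measurable[OF cL], of n 1] by (simp add: cutoff_nonneg cutoff_le_1 mass_def abs_of_nonneg)
  have cint: "real (Suc n) \<le> (\<integral>x. cutoff n x \<partial>lborel)" for n
  proof -
    have "real (Suc n) \<le> measure lborel {- real (Suc n)..real (Suc n)}" by simp
    also have "\<dots> = (\<integral>x. indicator {- real (Suc n)..real (Suc n)} x \<partial>lborel)" by simp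
    also have "\<dots> \<le> (\<integral>x. cutoff n x \<partial>lborel)"
    proof (rule integral_mono)
      show "indicat_real {- real (Suc n)..real (Suc n)} x \<le> cutoff n x" for x
      proof (cases "x \<in> {- real (Suc n)..real (Suc n)}")
        case True
        then have "\<bar>x\<bar> \<le> real (Suc n)" by auto
        then show ?thesis by (simp add: cutoff_eq_1 indicator_def)
      qed (simp add: cutoff_nonneg)
    qed (auto intro: test_fun_integrable test_fun_cutoff)
    finally show ?thesis .
  qed
  \<comment> \<open>So wide that the multiple \<open>i / I\<close> of the cut-off has norm below
    \<delta>.\<close>
  obtain n where n: "\<bar>i\<bar> * sqrt mass / \<delta> < real (Suc n)" 
    using reals_Archimedean2[of "\<bar>i\<bar> * sqrt mass / \<delta>"] by (metis less_trans lessI of_nat_less_iff)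
  define I where "I = (\<integral>x. cutoff n x \<partial>lborel)"
  have I: "real (Suc n) \<le> I" unfolding I_def by (rule cint)
  then have I0: "0 < I" using of_nat_0_less_iff[of "Suc n"] by linarith
  define k2 where "k2 = (\<lambda>x. k1 x - (i / I) * cutoff n x)"
  have k2: "test_fun k2" unfolding k2_def by (intro test_fun_diff k1 test_fun_scale test_fun_cutoff)
  have k2i: "(\<integral>x. k2 x \<partial>lborel) = 0"
    unfolding k2_def using test_fun_integrable[OF k1(1)] test_fun_integrable[OF test_fun_cutoff[of n]] I0
    by (simp add: i_def I_def)
  have k1L: "k1 \<in> L2 M" and k2L: "k2 \<in> L2 M" by (auto intro: test_L2 k1 k2)
  have 2: "L2norm M (\<lambda>x. k2 x - k x) < 2 * \<delta>"
  proof -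
    have "(\<lambda>x. k2 x - k x) = (\<lambda>x. (k1 x - k x) - (i / I) * cutoff n x)" by (simp add: k2_def fun_eq_iff)
    then have "L2norm M (\<lambda>x. k2 x - k x) \<le> L2norm M (\<lambda>x. k1 x - k x) + \<bar>i / I\<bar> * L2norm M (cutoff n)"
      using L2norm_triangle_diff[OF L2_diff[OF k1L k] L2_scale[OF cL[of n], of "i / I"]] by (simp only: L2norm_scale)
    moreover have "\<bar>i / I\<bar> * L2norm M (cutoff n) < \<delta>"
    proof -
      have "\<bar>i / I\<bar> * L2norm M (cutoff n) \<le> \<bar>i / I\<bar> * sqrt mass" by (intro mult_left_mono cn) simp
      also have "\<dots> = \<bar>i\<bar> * sqrt mass / I" using I0 by simp
      also have "\<dots> < \<delta>"
      proof -
        have "\<bar>i\<bar> * sqrt mass / \<delta> < I" using n I by linarith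
        then show ?thesis using \<delta> I0 by (simp add: divide_less_eq mult.commute)
      qed
      finally show ?thesis .
    qed
    ultimately show ?thesis using k1(2) by linarith
  qed
  obtain q where q: "test_fun q" "deriv q = k2" by (rule test_fun_antiderivative[OF k2 k2i])
  have qL: "q \<in> L2 M" by (rule test_L2[OF q(1)])
  define j where "j = ip M q (\<lambda>_. 1)"
  define \<mu> where "\<mu> = measure M {-1..1}"
  have \<mu>: "0 < \<mu>" unfolding \<mu>_def by (rule measure_M_Icc_pos) simp
  \<comment> \<open>One lower bound for the integrals of all cut-offs, so that \<open>j / c\<close>
    is bounded before p is chosen.\<close>
  have cm: "\<mu> \<le> ip M (cutoff p) (\<lambda>_. 1)" for p
  proof -
    interpret finite_measure M by (rule finite_M)
    have "\<mu> = (\<integral>x. indicator {-1..1} x \<partial>M)" by (simp add: \<mu>_def)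
    also have "\<dots> \<le> (\<integral>x. cutoff p x * 1 \<partial>M)"
    proof (rule integral_mono)
      show "integrable M (\<lambda>x. cutoff p x * 1)" by (rule L2_mult_integrable[OF cL const_L2])
      show "indicat_real {-1..1} x \<le> cutoff p x * 1" for x
        by (cases "x \<in> {-1..1}") (auto simp: cutoff_eq_1 cutoff_nonneg abs_le_iff)
    qed (auto simp: sets_M emeasure_eq_measure intro!: integrable_real_indicator)
    finally show ?thesis by (simp add: ip_def)
  qed
  have "0 < \<delta> / (1 + \<bar>j\<bar> / \<mu>)" using \<delta> \<mu> by (intro divide_pos_pos add_pos_nonneg) auto
  then have "\<forall>\<^sub>F p in sequentially. L2norm M (deriv (cutoff p)) < \<delta> / (1 + \<bar>j\<bar> / \<mu>)"
    by (rule order_tendstoD(2)[OF cutoff_deriv_L2_tendsto])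
  then obtain p where p: "L2norm M (deriv (cutoff p)) < \<delta> / (1 + \<bar>j\<bar> / \<mu>)"
    using eventually_happens'[OF sequentially_bot] by blast
  define c where "c = ip M (cutoff p) (\<lambda>_. 1)"
  have c: "\<mu> \<le> c" "0 < c" using cm[of p] \<mu> by (auto simp: c_def)
  define q' where "q' = (\<lambda>x. q x - (j / c) * cutoff p x)"
  have q': "test_fun q'" unfolding q'_def by (intro test_fun_diff q test_fun_scale test_fun_cutoff)
  have q'm: "ip M q' (\<lambda>_. 1) = 0"
    unfolding q'_def using c by (simp only: ip_diff_left[OF qL L2_scale[OF cL] const_L2] ip_scale_left)
      (simp add: j_def c_def)
  have dq': "deriv q' = (\<lambda>x. k2 x - (j / c) * deriv (cutoff p) x)"
    unfolding q'_def deriv_diff_scale[OF test_fun_smooth[OF q(1)] smooth_cutoff] q(2) ..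
  obtain u where u: "test_fun u" "adj u = q'" by (rule adj_preimage[OF q' q'm]) blast
  have dL: "deriv (cutoff p) \<in> L2 M" by (intro test_L2 test_fun_deriv test_fun_cutoff)
  have HL: "deriv (adj u) \<in> L2 M" by (intro test_L2 test_fun_deriv test_fun_adj u)
  have 3: "L2norm M (\<lambda>x. deriv (adj u) x - k x) < 3 * \<delta>"
  proof -
    have "(\<lambda>x. deriv (adj u) x - k x) = (\<lambda>x. (k2 x - k x) - (j / c) * deriv (cutoff p) x)"
      by (simp add: u(2) dq' fun_eq_iff)
    then have "L2norm M (\<lambda>x. deriv (adj u) x - k x) \<le> L2norm M (\<lambda>x. k2 x - k x) + \<bar>j / c\<bar> * L2norm M (deriv (cutoff p))"
      using L2norm_triangle_diff[OF L2_diff[OF k2L k] L2_scale[OF dL, of "j / c"]] by (simp only: L2norm_scale)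
    moreover have "\<bar>j / c\<bar> * L2norm M (deriv (cutoff p)) < \<delta>"
    proof -
      have "\<bar>j / c\<bar> \<le> \<bar>j\<bar> / \<mu>" using c \<mu> by (simp add: frac_le)
      then have "\<bar>j / c\<bar> * L2norm M (deriv (cutoff p)) \<le> \<bar>j\<bar> / \<mu> * L2norm M (deriv (cutoff p))"
        by (intro mult_right_mono) auto
      also have "\<dots> \<le> (1 + \<bar>j\<bar> / \<mu>) * L2norm M (deriv (cutoff p))" by (intro mult_right_mono) auto
      also have "\<dots> < \<delta>"
        using p \<mu> by (simp add: pos_less_divide_eq add_pos_nonneg mult.commute)
      finally show ?thesis .
    qed
    ultimately show ?thesis using 2 by linarith
  qed
  have "L2norm M (\<lambda>x. u x - S (R k) x) \<le> C\<^sup>2 * L2norm M (\<lambda>x. deriv (adj u) x - k x)"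
    using SR_bound[OF HL k] by (simp add: SR_deriv_adj[OF u(1)])
  also have "\<dots> \<le> C\<^sup>2 * (3 * \<delta>)" using 3 by (intro mult_left_mono) auto
  finally have 4: "L2norm M (\<lambda>x. u x - S (R k) x) \<le> C\<^sup>2 * (3 * \<delta>)" .
  have "0 \<le> C\<^sup>2 * \<delta>" using \<delta> by simp
  then have "C\<^sup>2 * (3 * \<delta>) < \<epsilon>" "3 * \<delta> \<le> \<epsilon>" using \<delta>\<epsilon> \<delta> by linarith+
  then show ?thesis using 3 4 u(1) by (intro exI[of _ u]) auto
qed

lemma closure_graph_upper:
  "closure_graph M (\<lambda>u. deriv (adj u)) = {(u, k). u \<in> L2 M \<and> k \<in> L2 M \<and> (AE x in M. u x = S (R k) x)}"
proof (intro equalityI subsetI; clarify)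
  fix f h assume "(f, h) \<in> closure_graph M (\<lambda>u. deriv (adj u))"
  then obtain \<phi> where f: "f \<in> L2 M" and h: "h \<in> L2 M" and \<phi>: "\<And>k. test_fun (\<phi> k)"
    and l1: "(\<lambda>k. L2norm M (\<lambda>x. \<phi> k x - f x)) \<longlonglongrightarrow> 0"
    and l2: "(\<lambda>k. L2norm M (\<lambda>x. deriv (adj (\<phi> k)) x - h x)) \<longlonglongrightarrow> 0"
    by (auto simp: closure_graph_def)
  define d where "d = (\<lambda>x. f x - S (R h) x)"
  have dL: "d \<in> L2 M" unfolding d_def by (intro L2_diff f R_L2 S_L2 h)
  have "L2norm M d \<le> L2norm M (\<lambda>x. \<phi> k x - f x) + C\<^sup>2 * L2norm M (\<lambda>x. deriv (adj (\<phi> k)) x - h x)" for k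
  proof -
    have L: "deriv (adj (\<phi> k)) \<in> L2 M" by (intro test_L2 test_fun_deriv test_fun_adj \<phi>)
    have "L2norm M d \<le> L2norm M (\<lambda>x. f x - \<phi> k x) + L2norm M (\<lambda>x. \<phi> k x - S (R h) x)"
      unfolding d_def by (intro L2norm_triangle_mid f test_L2 \<phi> S_L2 R_L2 h)
    also have "L2norm M (\<lambda>x. \<phi> k x - S (R h) x) \<le> C\<^sup>2 * L2norm M (\<lambda>x. deriv (adj (\<phi> k)) x - h x)"
      using SR_bound[OF L h] by (simp add: SR_deriv_adj[OF \<phi>])
    finally show ?thesis by (simp add: L2norm_diff_commute[of M f])
  qed
  moreover have "(\<lambda>k. L2norm M (\<lambda>x. \<phi> k x - f x) + C\<^sup>2 * L2norm M (\<lambda>x. deriv (adj (\<phi> k)) x - h x)) \<longlonglongrightarrow> 0 + C\<^sup>2 * 0"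
    by (intro tendsto_intros l1 l2)
  ultimately have "L2norm M d \<le> 0 + C\<^sup>2 * 0" by (intro LIMSEQ_le_const[of _ "0 + C\<^sup>2 * 0" "L2norm M d"]) auto
  then have "L2norm M d = 0" using L2norm_nonneg[of M d] by simp
  then have "AE x in M. d x = 0" using L2norm_eq_0_iff[OF dL] by blast
  then have "AE x in M. f x = S (R h) x" by eventually_elim (simp add: d_def)
  then show "f \<in> L2 M \<and> h \<in> L2 M \<and> (AE x in M. f x = S (R h) x)"
    using f h by blast
next
  fix u k assume u: "u \<in> L2 M" and k: "k \<in> L2 M" and AEu: "AE x in M. u x = S (R k) x"
  show "(u, k) \<in> closure_graph M (\<lambda>u. deriv (adj u))"
  proof (rule closure_graphI[OF u k])
    fix \<epsilon> :: real assume "0 < \<epsilon>"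
    then obtain z where z: "test_fun z" "L2norm M (\<lambda>x. z x - S (R k) x) < \<epsilon>" "L2norm M (\<lambda>x. deriv (adj z) x - k x) < \<epsilon>"
      using upper_core[OF k] by blast
    have "L2norm M (\<lambda>x. z x - u x) = L2norm M (\<lambda>x. z x - S (R k) x)"
    proof (rule L2norm_cong_AE)
      show "AE x in M. z x - u x = z x - S (R k) x" using AEu by eventually_elim simp
    qed (intro L2_diff test_L2 z u S_L2 R_L2 k)+
    then show "\<exists>z. test_fun z \<and> L2norm M (\<lambda>x. z x - u x) < \<epsilon> \<and> L2norm M (\<lambda>x. deriv (adj z) x - k x) < \<epsilon>"
      using z by (intro exI[of _ z]) simp
  qed
qed

end

section \<open>The Schroedinger operator\<close>

locale twisted_line = Poincare_line +
  fixes b :: "real \<Rightarrow> real"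
  assumes smooth_b: "smooth b" and b_nz: "b x \<noteq> 0"
begin

definition M' :: "real measure" where
  "M' = density lborel (\<lambda>x. ennreal (w x / (b x)\<^sup>2))"

definition schr_b :: "(real \<Rightarrow> real) \<Rightarrow> real \<Rightarrow> real" where
  "schr_b f = (\<lambda>x. b x * deriv (adj (\<lambda>y. f y / b y)) x)"

lemma b_measurable [measurable]: "b \<in> borel_measurable borel"
  by (rule smooth_measurable[OF smooth_b])

lemma borel_M': "f \<in> borel_measurable M' \<longleftrightarrow> f \<in> borel_measurable borel"
proof -
  have "sets M' = sets borel" by (simp add: M'_def)
  then show ?thesis using measurable_cong_sets by blast
qed

lemma borel_M_iff: "f \<in> borel_measurable M \<longleftrightarrow> f \<in> borel_measurable borel"
  using measurable_cong_sets[OF sets_M refl] by blast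

lemma borel_divide_b: "(\<lambda>x. f x / b x) \<in> borel_measurable borel \<longleftrightarrow> f \<in> borel_measurable borel"
proof
  assume [measurable]: "(\<lambda>x. f x / b x) \<in> borel_measurable borel"
  have "(\<lambda>x. (f x / b x) * b x) \<in> borel_measurable borel" by measurable
  then show "f \<in> borel_measurable borel" using b_nz by simp
qed (intro borel_measurable_divide b_measurable)

lemma AE_M': "(AE x in M'. P x) \<longleftrightarrow> (AE x in M. P x)"
  unfolding AE_M M'_def by (subst AE_density) (auto simp: b_nz)

lemma integral_M': "f \<in> borel_measurable borel \<Longrightarrow> (\<integral>x. f x \<partial>M') = (\<integral>x. f x / (b x)\<^sup>2 \<partial>M)"
  unfolding M'_def by (subst integral_density) (auto simp: integral_M less_imp_le)

lemma integrable_M': "f \<in> borel_measurable borel \<Longrightarrow> integrable M' f \<longleftrightarrow> integrable M (\<lambda>x. f x / (b x)\<^sup>2)"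
  unfolding M'_def by (subst integrable_density) (auto simp: integrable_M less_imp_le)

text \<open>Division by b is a unitary map onto L2 of the untwisted measure; with the next two
  lemmas it transports the analysis to the weight w.\<close>

lemma L2_M': "f \<in> L2 M' \<longleftrightarrow> (\<lambda>x. f x / b x) \<in> L2 M"
  by (auto simp: L2_def borel_M' borel_M_iff borel_divide_b integrable_M' power_divide)

lemma ip_M': "f \<in> L2 M' \<Longrightarrow> g \<in> L2 M' \<Longrightarrow> ip M' f g = ip M (\<lambda>x. f x / b x) (\<lambda>x. g x / b x)"
  by (auto simp: ip_def L2_def borel_M' integral_M' power2_eq_square)

lemma L2norm_M': "f \<in> borel_measurable borel \<Longrightarrow> L2norm M' f = L2norm M (\<lambda>x. f x / b x)"
  by (simp add: L2norm_def integral_M' power_divide)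

lemma L2_M'_borel: "f \<in> L2 M' \<Longrightarrow> f \<in> borel_measurable borel"
  by (simp add: L2_def borel_M')

lemma mult_b_L2: "f \<in> L2 M \<Longrightarrow> (\<lambda>x. b x * f x) \<in> L2 M'"
  by (simp add: L2_M' b_nz)

text \<open>Composing with a unitary map changes neither the bounds nor the adjoint relation, so the
  constant \<open>C\<close> is kept.\<close>

lemma adjoint_pair_twisted:
  "adjoint_pair M M' (\<lambda>u. R (\<lambda>x. u x / b x)) (\<lambda>h x. b x * S h x) C"
proof (rule adjoint_pair.intro)
  show "finite_measure M" by (rule finite_M)
  show "emeasure M (space M) \<noteq> 0"
  proof -
    interpret finite_measure M by (rule finite_M)
    show ?thesis using mass_pos by (simp add: emeasure_eq_measure mass_def)
  qed
  show "R (\<lambda>x. u x / b x) \<in> L2 M" if "u \<in> L2 M'" for u using that by (intro R_L2) (simp add: L2_M')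
  show "(\<lambda>x. b x * S h x) \<in> L2 M'" if "h \<in> L2 M" for h using that by (intro mult_b_L2 S_L2)
  show "R (\<lambda>x. (u x + z x) / b x) = (\<lambda>x. R (\<lambda>x. u x / b x) x + R (\<lambda>x. z x / b x) x)"
    if "u \<in> L2 M'" "z \<in> L2 M'" for u z
    using that R_add[of "\<lambda>x. u x / b x" "\<lambda>x. z x / b x"] by (simp add: L2_M' add_divide_distrib)
  show "(\<lambda>x. b x * S (\<lambda>x. h x + g x) x) = (\<lambda>x. b x * S h x + b x * S g x)" if "h \<in> L2 M" "g \<in> L2 M" for h g
    using that by (simp add: S_add algebra_simps)
  show "R (\<lambda>x. c * u x / b x) = (\<lambda>x. c * R (\<lambda>x. u x / b x) x)" for u c
    using R_scale[of c "\<lambda>x. u x / b x"] by simp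
  show "(\<lambda>x. b x * S (\<lambda>x. c * h x) x) = (\<lambda>x. c * (b x * S h x))" for h c
    by (simp add: S_scale mult.left_commute)
  show "R (\<lambda>x. u x / b x) = R (\<lambda>x. z x / b x)" if "u \<in> L2 M'" "z \<in> L2 M'" "AE x in M'. u x = z x" for u z
  proof (rule R_cong)
    show "AE x in M. u x / b x = z x / b x" using that(3) unfolding AE_M' by eventually_elim simp
  qed (use that in \<open>auto simp: L2_M'\<close>)
  show "(\<lambda>x. b x * S h x) = (\<lambda>x. b x * S g x)" if "h \<in> L2 M" "g \<in> L2 M" "AE x in M. h x = g x" for h g
    using S_cong[OF that] by simp
  show "L2norm M (R (\<lambda>x. u x / b x)) \<le> C * L2norm M' u" if "u \<in> L2 M'" for u
    using R_bound[of "\<lambda>x. u x / b x"] that by (simp add: L2_M' L2norm_M' L2_M'_borel)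
  show "L2norm M' (\<lambda>x. b x * S h x) \<le> C * L2norm M h" if "h \<in> L2 M" for h
    using S_bound[OF that] L2norm_M'[OF L2_M'_borel[OF mult_b_L2[OF S_L2[OF that]]]] by (simp add: b_nz)
  show "ip M (R (\<lambda>x. u x / b x)) h = ip M' u (\<lambda>x. b x * S h x)" if "u \<in> L2 M'" "h \<in> L2 M" for u h
    using that R_adjoint[of "\<lambda>x. u x / b x" h] ip_M'[OF that(1) mult_b_L2[OF S_L2[OF that(2)]]]
    by (simp add: L2_M' b_nz)
  show "ip M (R (\<lambda>x. u x / b x)) (\<lambda>_. 1) = 0" if "u \<in> L2 M'" for u
    using that by (intro R_mean_zero) (simp add: L2_M')
  show "(\<lambda>x. b x * S (\<lambda>_. 1) x) = (\<lambda>_. 0)" by (simp add: S_one)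
  show "0 < C" by (rule C_pos)
qed

text \<open>Multiplication and division by b map test functions to test functions, so approximating
  sequences correspond in both directions.\<close>

lemma closure_graph_twisted:
  "closure_graph M' schr_b = {(f, g). f \<in> L2 M' \<and> g \<in> L2 M' \<and>
     (AE x in M'. f x = b x * S (R (\<lambda>x. g x / b x)) x)}"
proof -
  have norm1: "L2norm M' (\<lambda>x. \<phi> x - f x) = L2norm M (\<lambda>x. \<phi> x / b x - f x / b x)"
    if "test_fun \<phi>" "f \<in> L2 M'" for \<phi> f
    using L2norm_M'[OF borel_measurable_diff[OF smooth_measurable[OF test_fun_smooth[OF that(1)]]
          L2_M'_borel[OF that(2)]]]
    by (simp add: diff_divide_distrib)
  have div: "test_fun (\<lambda>x. \<phi> x / b x)" if "test_fun \<phi>" for \<phi>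
    using test_fun_mult_smooth[OF that smooth_inverse[OF smooth_b b_nz]] by (simp add: divide_inverse mult.commute)
  have norm2: "L2norm M' (\<lambda>x. schr_b \<phi> x - g x) = L2norm M (\<lambda>x. deriv (adj (\<lambda>y. \<phi> y / b y)) x - g x / b x)"
    if "test_fun \<phi>" "g \<in> L2 M'" for \<phi> g
  proof -
    have [measurable]: "deriv (adj (\<lambda>y. \<phi> y / b y)) \<in> borel_measurable borel" "g \<in> borel_measurable borel"
      using smooth_measurable[OF test_fun_smooth[OF test_fun_deriv[OF test_fun_adj[OF div[OF that(1)]]]]]
        L2_M'_borel[OF that(2)] by auto
    have "(\<lambda>x. schr_b \<phi> x - g x) \<in> borel_measurable borel" unfolding schr_b_def by measurable
    then show ?thesis using L2norm_M'[of "\<lambda>x. schr_b \<phi> x - g x"]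
      by (simp add: schr_b_def diff_divide_distrib b_nz)
  qed
  have "(f, g) \<in> closure_graph M' schr_b \<longleftrightarrow> f \<in> L2 M' \<and> g \<in> L2 M' \<and>
      (\<lambda>x. f x / b x, \<lambda>x. g x / b x) \<in> closure_graph M (\<lambda>u. deriv (adj u))" for f g
  proof
    assume "(f, g) \<in> closure_graph M' schr_b"
    then obtain \<phi> where f: "f \<in> L2 M'" and g: "g \<in> L2 M'" and \<phi>: "\<And>k. test_fun (\<phi> k)"
      and l: "(\<lambda>k. L2norm M' (\<lambda>x. \<phi> k x - f x)) \<longlonglongrightarrow> 0" "(\<lambda>k. L2norm M' (\<lambda>x. schr_b (\<phi> k) x - g x)) \<longlonglongrightarrow> 0"
      by (auto simp: closure_graph_def)
    have "(\<lambda>x. f x / b x, \<lambda>x. g x / b x) \<in> closure_graph M (\<lambda>u. deriv (adj u))"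
      using f g l div[OF \<phi>] unfolding closure_graph_def norm1[OF \<phi> f] norm2[OF \<phi> g]
      by (auto simp: L2_M' intro!: exI[of _ "\<lambda>k x. \<phi> k x / b x"])
    then show "f \<in> L2 M' \<and> g \<in> L2 M' \<and> (\<lambda>x. f x / b x, \<lambda>x. g x / b x) \<in> closure_graph M (\<lambda>u. deriv (adj u))"
      using f g by blast
  next
    assume a: "f \<in> L2 M' \<and> g \<in> L2 M' \<and> (\<lambda>x. f x / b x, \<lambda>x. g x / b x) \<in> closure_graph M (\<lambda>u. deriv (adj u))"
    then obtain u where f: "f \<in> L2 M'" and g: "g \<in> L2 M'" and u: "\<And>k. test_fun (u k)"
      and l: "(\<lambda>k. L2norm M (\<lambda>x. u k x - f x / b x)) \<longlonglongrightarrow> 0"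
        "(\<lambda>k. L2norm M (\<lambda>x. deriv (adj (u k)) x - g x / b x)) \<longlonglongrightarrow> 0"
      by (auto simp: closure_graph_def)
    have bu: "test_fun (\<lambda>x. b x * u k x)" for k by (rule test_fun_mult_smooth[OF u smooth_b])
    have "(\<lambda>k. L2norm M' (\<lambda>x. b x * u k x - f x)) \<longlonglongrightarrow> 0"
      using l(1) unfolding norm1[OF bu f] by (simp add: b_nz)
    moreover have "(\<lambda>k. L2norm M' (\<lambda>x. schr_b (\<lambda>x. b x * u k x) x - g x)) \<longlonglongrightarrow> 0"
      using l(2) unfolding norm2[OF bu g] by (simp add: b_nz)
    ultimately show "(f, g) \<in> closure_graph M' schr_b"
      using f g bu unfolding closure_graph_def by (auto intro!: exI[of _ "\<lambda>k x. b x * u k x"])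
  qed
  then show ?thesis
    unfolding closure_graph_upper AE_M' using b_nz
    by (auto simp: L2_M' set_eq_iff nonzero_divide_eq_eq mult.commute)
qed

end

section \<open>The conjugation identity and the theorem\<close>

lemma Vw_smooth:
  assumes "smooth V" "a \<in> Fcls" shows "smooth (Vw V a)"
  unfolding Vw_def power2_eq_square using assms
  by (intro smooth_add smooth_ln smooth_mult) (auto simp: Fcls_def zero_less_mult_iff linorder_neq_iff)

lemma deriv_mult_smooth:
  "smooth f \<Longrightarrow> smooth g \<Longrightarrow> deriv (\<lambda>x. f x * g x) = (\<lambda>x. deriv f x * g x + f x * deriv g x)"
  using DERIV_imp_deriv[OF DERIV_mult[OF smooth_has_deriv smooth_has_deriv]]
  by (simp add: fun_eq_iff mult.commute)

lemma deriv_add_smooth: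
  "smooth f \<Longrightarrow> smooth g \<Longrightarrow> deriv (\<lambda>x. f x + g x) = (\<lambda>x. deriv f x + deriv g x)"
  using DERIV_imp_deriv[OF DERIV_add[OF smooth_has_deriv smooth_has_deriv]]
  by (simp add: fun_eq_iff)

lemma deriv2_mult_smooth:
  assumes "smooth f" "smooth g"
  shows "deriv (deriv (\<lambda>x. f x * g x)) =
    (\<lambda>x. deriv (deriv f) x * g x + 2 * (deriv f x * deriv g x) + f x * deriv (deriv g) x)"
  using assms
  by (simp add: deriv_mult_smooth deriv_add_smooth smooth_mult smooth_deriv fun_eq_iff)

text \<open>Writing f = b u, the part of \<open>Mab\<close> with 1 / b cancels the terms containing
  u without derivative that the second-order operator produces, and only the one with v'' remains.
  The rest is an identity between derivatives of v, b and u at one point.\<close>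

lemma schr_eq_conjugate:
  assumes V: "smooth V" and a: "a \<in> Fcls" and b: "b \<in> Fcls" and f: "smooth f"
  shows "schr V a b f = (\<lambda>x. b x * deriv (\<lambda>y. deriv (Vw V a) y * (f y / b y) - deriv (\<lambda>y. f y / b y) y) x)"
proof
  fix x
  define v where "v = Vw V a"
  define u where "u = (\<lambda>y. f y / b y)"
  define r where "r = (\<lambda>y. 1 / b y)"
  have sb: "smooth b" and bnz: "\<And>x. b x \<noteq> 0" and anz: "\<And>x. a x \<noteq> 0" using a b by (auto simp: Fcls_def)
  have sv: "smooth v" unfolding v_def by (rule Vw_smooth[OF V a])
  have su: "smooth u" unfolding u_def by (intro smooth_divide f sb bnz)
  have sr: "smooth r" unfolding r_def by (intro smooth_divide smooth_const sb bnz)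
  have fu: "f = (\<lambda>y. b y * u y)" using bnz by (simp add: u_def)
  \<comment> \<open>Differentiating b r = 1 once and twice expresses the derivatives of the
    reciprocal through those of b.\<close>
  have one: "(\<lambda>y. b y * r y) = (\<lambda>_. 1)" using bnz by (simp add: r_def)
  have r1: "deriv b x * r x + b x * deriv r x = 0"
    using fun_cong[OF deriv_mult_smooth[OF sb sr], of x] by (simp add: one)
  have r2: "deriv (deriv b) x * r x + 2 * (deriv b x * deriv r x) + b x * deriv (deriv r) x = 0"
    using fun_cong[OF deriv2_mult_smooth[OF sb sr], of x] by (simp add: one)
  have bx: "b x \<noteq> 0" by (rule bnz)
  have rx: "r x = 1 / b x" by (simp add: r_def)
  have dr: "deriv r x = - deriv b x / (b x)\<^sup>2"
    using r1 bx unfolding rx by (simp add: field_simps power2_eq_square)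
  have ddr: "deriv (deriv r) x = - deriv (deriv b) x / (b x)\<^sup>2 + 2 * (deriv b x)\<^sup>2 / (b x) ^ 3"
    using r2 bx unfolding rx dr by (simp add: field_simps power2_eq_square power3_eq_cube)
  have "Vw V (\<lambda>y. a y * b y) = (\<lambda>y. v y + ln ((b y)\<^sup>2))"
    using anz bnz by (simp add: fun_eq_iff Vw_def v_def power_mult_distrib ln_mult)
  moreover have "((\<lambda>y. v y + ln ((b y)\<^sup>2)) has_real_derivative (deriv v x + 2 * deriv b x / b x)) (at x)"
    using smooth_has_deriv[OF sv, of x] smooth_has_deriv[OF sb, of x] bx zero_less_power2[of "b x"]
    by (auto intro!: derivative_eq_intros simp: field_simps power2_eq_square)
  ultimately have dVab: "deriv (Vw V (\<lambda>y. a y * b y)) x = deriv v x + 2 * deriv b x / b x"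
    using DERIV_imp_deriv by simp
  have "deriv (\<lambda>y. deriv v y * u y - deriv u y) x
      = deriv (deriv v) x * u x + deriv v x * deriv u x - deriv (deriv u) x"
    using DERIV_imp_deriv[OF DERIV_diff[OF DERIV_mult[OF smooth_has_deriv[OF smooth_deriv[OF sv]] smooth_has_deriv[OF su]]
          smooth_has_deriv[OF smooth_deriv[OF su]]], of x]
    by (simp add: mult.commute)
  moreover have "schr V a b f x = b x * (deriv (deriv v) x * u x + deriv v x * deriv u x - deriv (deriv u) x)"
    unfolding schr_def Lop_def Mab_def v_def[symmetric] r_def[symmetric] dVab dr ddr
    unfolding fu deriv2_mult_smooth[OF sb su] unfolding deriv_mult_smooth[OF sb su]
    using bx by (simp add: field_simps power2_eq_square power3_eq_cube)
  ultimately show "schr V a b f x = b x * deriv (\<lambda>y. deriv (Vw V a) y * (f y / b y) - deriv (\<lambda>y. f y / b y) y) x"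
    by (simp add: u_def v_def)
qed

theorem mainTheorem2:
  fixes V a :: "real \<Rightarrow> real"
  assumes "smooth V"
    and "a \<in> Fcls"
    and "emeasure (mu V a) UNIV < \<infinity>"
    and "maxmin (mu V a) (closure_graph (mu V a) (negL V a)) 1 > 0"
  shows "\<forall>b\<in>Fcls.
     spec (mu V a) (closure_graph (mu V a) (negL V a)) - {0}
       = spec (mu V (\<lambda>x. a x * b x)) (closure_graph (mu V (\<lambda>x. a x * b x)) (schr V a b))
   \<and> spec_ess (mu V a) (closure_graph (mu V a) (negL V a))
       = spec_ess (mu V (\<lambda>x. a x * b x)) (closure_graph (mu V (\<lambda>x. a x * b x)) (schr V a b))
   \<and> (\<forall>n::nat. n \<ge> 1 \<longrightarrow>
       maxmin (mu V a) (closure_graph (mu V a) (negL V a)) n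
         = maxmin (mu V (\<lambda>x. a x * b x)) (closure_graph (mu V (\<lambda>x. a x * b x)) (schr V a b)) (n - 1))"
proof
  fix b assume b: "b \<in> Fcls"
  define v where "v = Vw V a"
  have sv: "smooth v" unfolding v_def by (rule Vw_smooth[OF assms(1,2)])
  have [measurable]: "v \<in> borel_measurable borel" by (rule smooth_measurable[OF sv])
  have "(\<integral>\<^sup>+x. ennreal (exp (- v x)) \<partial>lborel) < \<infinity>"
    using assms(3) by (simp add: mu_def v_def[symmetric] emeasure_density)
  then have iw: "integrable lborel (\<lambda>x. exp (- v x))" by (intro integrableI_nonneg) auto
  interpret W: weighted_line v by unfold_locales (rule sv iw)+
  have M: "mu V a = W.M" by (simp add: mu_def W.M_def W.w_def v_def[symmetric])
  have N: "negL V a = (\<lambda>\<phi>. W.adj (deriv \<phi>))"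
    by (simp add: negL_def Lop_def W.adj_def v_def[symmetric] fun_eq_iff)
  \<comment> \<open>A positive supremum yields a single constraint function whose infimum is
    positive.\<close>
  obtain g0 c where g0: "g0 \<in> L2 W.M" and c: "0 < c"
    and gap: "\<And>f g. (f, g) \<in> closure_graph W.M (\<lambda>\<phi>. W.adj (deriv \<phi>)) \<Longrightarrow> \<not> (AE x in W.M. f x = 0) \<Longrightarrow>
        ip W.M f g0 = 0 \<Longrightarrow> c \<le> ip W.M f g / ip W.M f f"
  proof -
    obtain gs :: "nat \<Rightarrow> real \<Rightarrow> real" where gs: "gs \<in> {gs. \<forall>i<1. gs i \<in> L2 W.M}"
      and pos: "0 < (INF fg \<in> {(f, g). (f, g) \<in> closure_graph W.M (\<lambda>\<phi>. W.adj (deriv \<phi>)) \<and> \<not> (AE x in W.M. f x = 0) \<and> (\<forall>i<1. ip W.M f (gs i) = 0)}.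
           ereal (ip W.M (fst fg) (snd fg) / ip W.M (fst fg) (fst fg)))" (is "0 < (INF fg \<in> ?F. ?r fg)")
      using assms(4) unfolding M N maxmin_def less_SUP_iff by (rule bexE)
    \<comment> \<open>The infimum may be infinite; a positive value strictly below it is a real
      number.\<close>
    obtain c :: ereal where c: "0 < c" "c < (INF fg \<in> ?F. ?r fg)" using dense[OF pos] by blast
    then obtain c' where c': "c = ereal c'" by (cases c) auto
    have "c' \<le> ip W.M f g / ip W.M f f"
      if "(f, g) \<in> closure_graph W.M (\<lambda>\<phi>. W.adj (deriv \<phi>))" "\<not> (AE x in W.M. f x = 0)" "ip W.M f (gs 0) = 0" for f g
    proof -
      have "(f, g) \<in> ?F" using that by simp
      then have "(INF fg \<in> ?F. ?r fg) \<le> ?r (f, g)" by (rule INF_lower)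
      then have "c \<le> ?r (f, g)" using c(2) by simp
      then show ?thesis by (simp add: c')
    qed
    then show thesis using that[of "gs 0" c'] gs c(1) c' by simp
  qed
  have "c * (L2norm W.M \<phi>)\<^sup>2 \<le> (L2norm W.M (deriv \<phi>))\<^sup>2" if \<phi>: "test_fun \<phi>" and orth: "ip W.M \<phi> g0 = 0" for \<phi>
  \<comment> \<open>Null functions are excluded from the max-min infimum and are treated
    apart.\<close>
  proof (cases "AE x in W.M. \<phi> x = 0")
    case True
    then show ?thesis using L2norm_eq_0_iff[OF W.test_L2[OF \<phi>]] by simp
  next
    case False
    have "(\<phi>, W.adj (deriv \<phi>)) \<in> closure_graph W.M (\<lambda>\<phi>. W.adj (deriv \<phi>))"
      by (rule closure_graphI) (use \<phi> in \<open>auto intro!: W.test_L2 W.test_fun_adj test_fun_deriv exI[of _ \<phi>] simp: L2norm_def\<close>)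
    from gap[OF this False orth]
    have "c \<le> (L2norm W.M (deriv \<phi>))\<^sup>2 / (L2norm W.M \<phi>)\<^sup>2"
      using W.ip_adj_by_parts[OF test_fun_deriv[OF \<phi>] test_fun_smooth[OF \<phi>]] by (simp add: ip_self_eq)
    moreover have "0 < L2norm W.M \<phi>"
      using False L2norm_eq_0_iff[OF W.test_L2[OF \<phi>]] L2norm_nonneg[of W.M \<phi>] by linarith
    ultimately show ?thesis by (simp add: pos_le_divide_eq)
  qed
  note Poincare = W.Poincare_from_constraint[OF g0 c this]
  have sb: "smooth b" and bnz: "\<And>x. b x \<noteq> 0" and anz: "\<And>x. a x \<noteq> 0"
    using b assms(2) by (auto simp: Fcls_def)
  interpret T: twisted_line v "1 / sqrt c" b
    by unfold_locales (use c Poincare sb bnz in auto)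
  have M': "mu V (\<lambda>x. a x * b x) = T.M'"
  proof -
    have "exp (- Vw V (\<lambda>x. a x * b x) x) = W.w x / (b x)\<^sup>2" for x
    proof -
      have "Vw V (\<lambda>x. a x * b x) x = v x + ln ((b x)\<^sup>2)"
        using anz[of x] bnz[of x] by (simp add: Vw_def v_def power_mult_distrib ln_mult)
      then show ?thesis using bnz[of x] by (simp add: W.w_def exp_diff)
    qed
    then show ?thesis by (simp add: mu_def T.M'_def)
  qed
  \<comment> \<open>Agreement on test functions determines the closure, as
    \<open>closure_graph\<close> evaluates the operator nowhere else.\<close>
  have H: "schr V a b f = T.schr_b f" if "test_fun f" for f
    unfolding schr_eq_conjugate[OF assms(1,2) b test_fun_smooth[OF that], folded v_def] T.schr_b_def W.adj_def[abs_def] ..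
  interpret A: adjoint_pair W.M T.M' "\<lambda>u. W.R (\<lambda>x. u x / b x)" "\<lambda>h x. b x * W.S h x" "1 / sqrt c"
    by (rule T.adjoint_pair_twisted)
  have lower: "closure_graph (mu V a) (negL V a) = A.lower_graph"
    unfolding M N T.closure_graph_lower A.lower_graph_def by (simp add: bnz)
  have upper: "closure_graph (mu V (\<lambda>x. a x * b x)) (schr V a b) = A.upper_graph"
  proof -
    have "closure_graph (mu V (\<lambda>x. a x * b x)) (schr V a b) = closure_graph T.M' T.schr_b"
      unfolding closure_graph_def M' using H by auto
    then show ?thesis unfolding T.closure_graph_twisted A.upper_graph_def .
  qed
  show "spec (mu V a) (closure_graph (mu V a) (negL V a)) - {0}
       = spec (mu V (\<lambda>x. a x * b x)) (closure_graph (mu V (\<lambda>x. a x * b x)) (schr V a b))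
   \<and> spec_ess (mu V a) (closure_graph (mu V a) (negL V a))
       = spec_ess (mu V (\<lambda>x. a x * b x)) (closure_graph (mu V (\<lambda>x. a x * b x)) (schr V a b))
   \<and> (\<forall>n::nat. n \<ge> 1 \<longrightarrow>
       maxmin (mu V a) (closure_graph (mu V a) (negL V a)) n
         = maxmin (mu V (\<lambda>x. a x * b x)) (closure_graph (mu V (\<lambda>x. a x * b x)) (schr V a b)) (n - 1))"
    unfolding lower upper unfolding M M'
    using A.spec_lower_minus_zero A.spec_ess_eq A.maxmin_eq by blast
qed

end
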